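(* Let $G$ be a $k$-player free game with question sets $Y_1,\dots,Y_k$ and answer sets $B_1,\dots,B_k$, where $|B_i|\ge2$ for all $i\in[k]$. There is a deterministic algorithm that approximates $\omega(G)$ to within additive error $\pm\varepsilon$ in time $$\exp\!\left(O\!\left(\frac{k^2}{\varepsilon^2}\sum_{i<j}\log(|Y_i||B_i|)\cdot\log(|Y_j||B_j|)\right)\right)=n^{O(\varepsilon^{-2}k^2\log n)},$$ where $n=|Y_1||B_1|\cdots|Y_k||B_k|$ is the input size.
   Context: A $k$-player free game $G$ consists of finite question sets $Y_1,\dots,Y_k$, finite answer sets $B_1,\dots,B_k$, and a verification function $V:Y_1\times\cdots\times Y_k\times B_1\times\cdots\times B_k\to[0,1]$ (given explicitly). Its value is $\omega(G)=\max_{b_1,\dots,b_k}\mathbb{E}_{y_1\in Y_1,\dots,y_k\in Y_k}[V(y_1,\dots,y_k,b_1(y_1),\dots,b_k(y_k))]$, the maximum over response functions $b_i:Y_i\to B_i$, with the $y_i$ independent and uniform.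
   Formalization: The formal theorem assumes k ≥ 2 (for k = 1 the sum over i<j is empty and the claimed constant time is impossible) and reads O(x) in the exponents as O(max(1,x)), which changes nothing for ε ≤ 1. *)

theory Defs
  imports "HOL-Probability.Probability"
begin

section \<open>Free games\<close>

text \<open>
  Players are numbered from \<open>0\<close>. Tuples of questions or answers are extensional functions
  on \<open>{..<players G}\<close>, and a response function of player \<open>i\<close> is an extensional function on
  the \<open>i\<close>-th question set.
\<close>

record ('q, 'a) free_game =
  players :: nat
  questions :: "nat \<Rightarrow> 'q set"
  answers :: "nat \<Rightarrow> 'a set"
  verify :: "(nat \<Rightarrow> 'q) \<Rightarrow> (nat \<Rightarrow> 'a) \<Rightarrow> real"

definition question_tuples :: "('q, 'a) free_game \<Rightarrow> (nat \<Rightarrow> 'q) set" where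
  "question_tuples G = (\<Pi>\<^sub>E i\<in>{..<players G}. questions G i)"

definition answer_tuples :: "('q, 'a) free_game \<Rightarrow> (nat \<Rightarrow> 'a) set" where
  "answer_tuples G = (\<Pi>\<^sub>E i\<in>{..<players G}. answers G i)"

definition is_free_game :: "('q, 'a) free_game \<Rightarrow> bool" where
  "is_free_game G \<longleftrightarrow>
     (\<forall>i<players G. finite (questions G i) \<and> questions G i \<noteq> {} \<and>
                    finite (answers G i) \<and> answers G i \<noteq> {}) \<and>
     (\<forall>y\<in>question_tuples G. \<forall>b\<in>answer_tuples G. verify G y b \<in> {0..1})"

definition response_profiles :: "('q, 'a) free_game \<Rightarrow> (nat \<Rightarrow> 'q \<Rightarrow> 'a) set" where
  "response_profiles G = (\<Pi>\<^sub>E i\<in>{..<players G}. questions G i \<rightarrow>\<^sub>E answers G i)"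

definition question_pmf :: "('q, 'a) free_game \<Rightarrow> (nat \<Rightarrow> 'q) pmf" where
  "question_pmf G = Pi_pmf {..<players G} undefined (\<lambda>i. pmf_of_set (questions G i))"

definition profile_value :: "('q, 'a) free_game \<Rightarrow> (nat \<Rightarrow> 'q \<Rightarrow> 'a) \<Rightarrow> real" where
  "profile_value G b =
     measure_pmf.expectation (question_pmf G) (\<lambda>y. verify G y (\<lambda>i\<in>{..<players G}. b i (y i)))"

definition game_value :: "('q, 'a) free_game \<Rightarrow> real" where
  "game_value G = Max (profile_value G ` response_profiles G)"

definition player_size :: "('q, 'a) free_game \<Rightarrow> nat \<Rightarrow> nat" where
  "player_size G i = card (questions G i) * card (answers G i)"

definition input_size :: "('q, 'a) free_game \<Rightarrow> nat" where
  "input_size G = (\<Prod>i<players G. player_size G i)"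


section \<open>The machine model\<close>

text \<open>
  A deterministic real RAM, programmed by structured commands. Natural-number cells are used for
  counting and addressing, real cells for the input probabilities and the accuracy; both sorts
  have scalar variables and arrays with indirect addressing. Every operation takes unit time, and
  a compound expression is charged for each of its nodes.

  To keep the unit-cost measure honest, the instruction set is smaller than that of the usual real
  RAM: there is no multiplication on either sort, no rounding from reals to naturals, no real
  constant other than a natural number, and reals can only be divided by naturals. Hence no
  number, and for rational inputs no numerator or denominator, can get longer than polynomial in
  the running time and the length of the inputs.
\<close>

datatype nexp =
    NConst nat
  | NVar string
  | NArr string nexp
  | NPlus nexp nexp
  | NMinus nexp nexp

datatype rexp =
    RNat nexp
  | RVar string
  | RArr string nexp
  | RPlus rexp rexp
  | RMinus rexp rexp
  | RDiv rexp nexp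

datatype bexp =
    NLess nexp nexp
  | RLess rexp rexp
  | Not bexp
  | And bexp bexp

datatype com =
    Skip
  | NAssign string nexp
  | NStore string nexp nexp
  | RAssign string rexp
  | RStore string nexp rexp
  | Seq com com
  | If bexp com com
  | While bexp com

record state =
  nvar :: "string \<Rightarrow> nat"
  narr :: "string \<Rightarrow> nat \<Rightarrow> nat"
  rvar :: "string \<Rightarrow> real"
  rarr :: "string \<Rightarrow> nat \<Rightarrow> real"

fun nval :: "nexp \<Rightarrow> state \<Rightarrow> nat" where
  "nval (NConst c) s = c"
| "nval (NVar x) s = nvar s x"
| "nval (NArr a e) s = narr s a (nval e s)"
| "nval (NPlus e f) s = nval e s + nval f s"
| "nval (NMinus e f) s = nval e s - nval f s"

fun rval :: "rexp \<Rightarrow> state \<Rightarrow> real" where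
  "rval (RNat e) s = real (nval e s)"
| "rval (RVar x) s = rvar s x"
| "rval (RArr a e) s = rarr s a (nval e s)"
| "rval (RPlus e f) s = rval e s + rval f s"
| "rval (RMinus e f) s = rval e s - rval f s"
| "rval (RDiv e f) s = rval e s / real (nval f s)"

fun bval :: "bexp \<Rightarrow> state \<Rightarrow> bool" where
  "bval (NLess e f) s \<longleftrightarrow> nval e s < nval f s"
| "bval (RLess e f) s \<longleftrightarrow> rval e s < rval f s"
| "bval (Not b) s \<longleftrightarrow> \<not> bval b s"
| "bval (And b c) s \<longleftrightarrow> bval b s \<and> bval c s"

fun ncost :: "nexp \<Rightarrow> nat" where
  "ncost (NConst c) = 1"
| "ncost (NVar x) = 1"
| "ncost (NArr a e) = 1 + ncost e"
| "ncost (NPlus e f) = 1 + ncost e + ncost f"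
| "ncost (NMinus e f) = 1 + ncost e + ncost f"

fun rcost :: "rexp \<Rightarrow> nat" where
  "rcost (RNat e) = 1 + ncost e"
| "rcost (RVar x) = 1"
| "rcost (RArr a e) = 1 + ncost e"
| "rcost (RPlus e f) = 1 + rcost e + rcost f"
| "rcost (RMinus e f) = 1 + rcost e + rcost f"
| "rcost (RDiv e f) = 1 + rcost e + ncost f"

fun bcost :: "bexp \<Rightarrow> nat" where
  "bcost (NLess e f) = 1 + ncost e + ncost f"
| "bcost (RLess e f) = 1 + rcost e + rcost f"
| "bcost (Not b) = 1 + bcost b"
| "bcost (And b c) = 1 + bcost b + bcost c"

text \<open>\<open>exec c s t s'\<close>: started in \<open>s\<close>, the command \<open>c\<close> halts after exactly \<open>t\<close> steps in \<open>s'\<close>.\<close>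

inductive exec :: "com \<Rightarrow> state \<Rightarrow> nat \<Rightarrow> state \<Rightarrow> bool" where
  exec_Skip: "exec Skip s 1 s"
| exec_NAssign: "exec (NAssign x e) s (1 + ncost e) (s\<lparr>nvar := (nvar s)(x := nval e s)\<rparr>)"
| exec_NStore: "exec (NStore a i e) s (1 + ncost i + ncost e)
    (s\<lparr>narr := (narr s)(a := (narr s a)(nval i s := nval e s))\<rparr>)"
| exec_RAssign: "exec (RAssign x e) s (1 + rcost e) (s\<lparr>rvar := (rvar s)(x := rval e s)\<rparr>)"
| exec_RStore: "exec (RStore a i e) s (1 + ncost i + rcost e)
    (s\<lparr>rarr := (rarr s)(a := (rarr s a)(nval i s := rval e s))\<rparr>)"
| exec_Seq: "exec c s t s' \<Longrightarrow> exec d s' u s'' \<Longrightarrow> exec (Seq c d) s (t + u) s''"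
| exec_IfTrue: "bval b s \<Longrightarrow> exec c s t s' \<Longrightarrow> exec (If b c d) s (1 + bcost b + t) s'"
| exec_IfFalse: "\<not> bval b s \<Longrightarrow> exec d s t s' \<Longrightarrow> exec (If b c d) s (1 + bcost b + t) s'"
| exec_WhileFalse: "\<not> bval b s \<Longrightarrow> exec (While b c) s (1 + bcost b) s"
| exec_WhileTrue: "bval b s \<Longrightarrow> exec c s t s' \<Longrightarrow> exec (While b c) s' u s'' \<Longrightarrow>
    exec (While b c) s (1 + bcost b + t + u) s''"

inductive_cases exec_SkipE: "exec Skip s t s'"
inductive_cases exec_NAssignE: "exec (NAssign x e) s t s'"
inductive_cases exec_NStoreE: "exec (NStore a i e) s t s'"
inductive_cases exec_RAssignE: "exec (RAssign x e) s t s'"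
inductive_cases exec_RStoreE: "exec (RStore a i e) s t s'"
inductive_cases exec_SeqE: "exec (Seq c d) s t s'"
inductive_cases exec_IfE: "exec (If b c d) s t s'"
inductive_cases exec_WhileE: "exec (While b c) s t s'"

lemma exec_deterministic:
  "exec c s t s' \<Longrightarrow> exec c s u s'' \<Longrightarrow> u = t \<and> s'' = s'"
proof (induction arbitrary: u s'' rule: exec.induct)
  case exec_Skip
  then show ?case by (rule exec_SkipE) simp
next
  case exec_NAssign
  then show ?case by (rule exec_NAssignE) simp
next
  case exec_NStore
  then show ?case by (rule exec_NStoreE) simp
next
  case exec_RAssign
  then show ?case by (rule exec_RAssignE) simp
next
  case exec_RStore
  then show ?case by (rule exec_RStoreE) simp
next
  case exec_Seq
  from exec_Seq.prems show ?case
    by (rule exec_SeqE) (use exec_Seq.IH in metis)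
next
  case exec_IfTrue
  from exec_IfTrue.prems show ?case
    by (rule exec_IfE) (use exec_IfTrue.hyps in \<open>auto dest: exec_IfTrue.IH\<close>)
next
  case exec_IfFalse
  from exec_IfFalse.prems show ?case
    by (rule exec_IfE) (use exec_IfFalse.hyps in \<open>auto dest: exec_IfFalse.IH\<close>)
next
  case exec_WhileFalse
  from exec_WhileFalse.prems show ?case
    by (rule exec_WhileE) (use exec_WhileFalse.hyps in auto)
next
  case exec_WhileTrue
  from exec_WhileTrue.prems show ?case
    by (rule exec_WhileE) (use exec_WhileTrue.hyps in \<open>auto dest!: exec_WhileTrue.IH\<close>)
qed


section \<open>Input of a game\<close>

text \<open>
  The elements of every question and answer set are numbered from \<open>0\<close>, in an arbitrary way. The
  values of the verification function are stored in one array of length \<open>input_size G\<close>, in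
  mixed-radix order, where the question coordinates are less significant than the answer
  coordinates. Cells that do not belong to the input may hold anything.
\<close>

definition tuple_index :: "(nat \<Rightarrow> nat) \<Rightarrow> nat \<Rightarrow> (nat \<Rightarrow> nat) \<Rightarrow> nat" where
  "tuple_index d k x = (\<Sum>i<k. x i * (\<Prod>j<i. d j))"

definition table_index ::
  "('q, 'a) free_game \<Rightarrow> (nat \<Rightarrow> 'q \<Rightarrow> nat) \<Rightarrow> (nat \<Rightarrow> 'a \<Rightarrow> nat) \<Rightarrow>
     (nat \<Rightarrow> 'q) \<Rightarrow> (nat \<Rightarrow> 'a) \<Rightarrow> nat" where
  "table_index G \<eta> \<beta> y b =
     tuple_index (\<lambda>i. card (questions G i)) (players G) (\<lambda>i. \<eta> i (y i)) +
     (\<Prod>i<players G. card (questions G i)) *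
       tuple_index (\<lambda>i. card (answers G i)) (players G) (\<lambda>i. \<beta> i (b i))"

definition is_input :: "('q, 'a) free_game \<Rightarrow> real \<Rightarrow> state \<Rightarrow> bool" where
  "is_input G \<epsilon> s \<longleftrightarrow>
     nvar s ''k'' = players G \<and>
     (\<forall>i<players G. narr s ''Y'' i = card (questions G i) \<and> narr s ''B'' i = card (answers G i)) \<and>
     rvar s ''eps'' = \<epsilon> \<and>
     (\<exists>\<eta> \<beta>.
        (\<forall>i<players G. bij_betw (\<eta> i) (questions G i) {..<card (questions G i)} \<and>
                       bij_betw (\<beta> i) (answers G i) {..<card (answers G i)}) \<and>
        (\<forall>y\<in>question_tuples G. \<forall>b\<in>answer_tuples G.
           rarr s ''V'' (table_index G \<eta> \<beta> y b) = verify G y b))"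

lemma tuple_index_less:
  assumes "\<And>i. i < k \<Longrightarrow> x i < d i"
  shows "tuple_index d k x < (\<Prod>i<k. d i)"
  using assms
proof (induction k)
  case (Suc k)
  have "tuple_index d (Suc k) x < (\<Prod>i<k. d i) + x k * (\<Prod>i<k. d i)"
    using Suc by (simp add: tuple_index_def)
  also have "\<dots> = Suc (x k) * (\<Prod>i<k. d i)" by simp
  also have "\<dots> \<le> d k * (\<Prod>i<k. d i)"
    using Suc.prems[of k] by (intro mult_right_mono) auto
  finally show ?case by (simp add: mult.commute)
qed (simp add: tuple_index_def)

lemma mixed_radix_inject:
  fixes m :: nat
  assumes "a < m" "a' < m" "a + m * c = a' + m * c'"
  shows "a = a' \<and> c = c'"
proof -
  have "(a + m * c) mod m = a" "(a' + m * c') mod m = a'" using assms(1,2) by auto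
  then have "a = a'" using assms(3) by metis
  then show ?thesis using assms by auto
qed

lemma tuple_index_inject:
  assumes "\<And>i. i < k \<Longrightarrow> x i < d i" "\<And>i. i < k \<Longrightarrow> x' i < d i"
    and "tuple_index d k x = tuple_index d k x'" "i < k"
  shows "x i = x' i"
  using assms
proof (induction k)
  case (Suc k)
  have "tuple_index d k x + (\<Prod>i<k. d i) * x k = tuple_index d k x' + (\<Prod>i<k. d i) * x' k"
    using Suc.prems(3) by (simp add: tuple_index_def mult.commute)
  moreover have "tuple_index d k x < (\<Prod>i<k. d i)" "tuple_index d k x' < (\<Prod>i<k. d i)"
    using Suc.prems by (auto intro!: tuple_index_less)
  ultimately have "tuple_index d k x = tuple_index d k x' \<and> x k = x' k"
    by (intro mixed_radix_inject)
  with Suc show ?case by (cases "i = k") auto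
qed simp

lemma table_index_inject:
  assumes num: "\<forall>i<players G. bij_betw (\<eta> i) (questions G i) {..<card (questions G i)} \<and>
                      bij_betw (\<beta> i) (answers G i) {..<card (answers G i)}"
    and y: "y \<in> question_tuples G" "y' \<in> question_tuples G"
    and b: "b \<in> answer_tuples G" "b' \<in> answer_tuples G"
    and eq: "table_index G \<eta> \<beta> y b = table_index G \<eta> \<beta> y' b'"
  shows "y = y' \<and> b = b'"
proof -
  let ?k = "players G"
  have q: "\<eta> i (z i) < card (questions G i)" if "i < ?k" "z \<in> question_tuples G" for i z
    using num that unfolding question_tuples_def bij_betw_def by blast
  have a: "\<beta> i (z i) < card (answers G i)" if "i < ?k" "z \<in> answer_tuples G" for i z
    using num that unfolding answer_tuples_def bij_betw_def by blast
  have *: "tuple_index (\<lambda>i. card (questions G i)) ?k (\<lambda>i. \<eta> i (y i)) =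
           tuple_index (\<lambda>i. card (questions G i)) ?k (\<lambda>i. \<eta> i (y' i)) \<and>
           tuple_index (\<lambda>i. card (answers G i)) ?k (\<lambda>i. \<beta> i (b i)) =
           tuple_index (\<lambda>i. card (answers G i)) ?k (\<lambda>i. \<beta> i (b' i))"
    using eq q y unfolding table_index_def
    by (intro mixed_radix_inject[where m = "\<Prod>i<?k. card (questions G i)"] tuple_index_less) auto
  have "y i = y' i" if i: "i < ?k" for i
  proof -
    have "\<eta> i (y i) = \<eta> i (y' i)"
      using tuple_index_inject[of ?k "\<lambda>i. \<eta> i (y i)" "\<lambda>i. card (questions G i)" "\<lambda>i. \<eta> i (y' i)"]
        * q y i by blast
    moreover have "inj_on (\<eta> i) (questions G i)" "y i \<in> questions G i" "y' i \<in> questions G i"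
      using num i y unfolding question_tuples_def bij_betw_def by blast+
    ultimately show ?thesis by (auto dest: inj_onD)
  qed
  then have "y = y'"
    using y unfolding question_tuples_def by (auto intro: PiE_ext)
  moreover have "b i = b' i" if i: "i < ?k" for i
  proof -
    have "\<beta> i (b i) = \<beta> i (b' i)"
      using tuple_index_inject[of ?k "\<lambda>i. \<beta> i (b i)" "\<lambda>i. card (answers G i)" "\<lambda>i. \<beta> i (b' i)"]
        * a b i by blast
    moreover have "inj_on (\<beta> i) (answers G i)" "b i \<in> answers G i" "b' i \<in> answers G i"
      using num i b unfolding answer_tuples_def bij_betw_def by blast+
    ultimately show ?thesis by (auto dest: inj_onD)
  qed
  then have "b = b'"
    using b unfolding answer_tuples_def by (auto intro: PiE_ext)
  ultimately show ?thesis ..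
qed

lemma is_input_exists:
  assumes "is_free_game G"
  shows "\<exists>s. is_input G \<epsilon> s"
proof -
  let ?k = "players G"
  have "\<forall>i. \<exists>h. i < ?k \<longrightarrow> bij_betw h (questions G i) {..<card (questions G i)}"
    using assms ex_bij_betw_finite_nat unfolding is_free_game_def
    by (metis atLeast0LessThan)
  then obtain \<eta> where \<eta>: "\<And>i. i < ?k \<Longrightarrow> bij_betw (\<eta> i) (questions G i) {..<card (questions G i)}"
    by metis
  have "\<forall>i. \<exists>h. i < ?k \<longrightarrow> bij_betw h (answers G i) {..<card (answers G i)}"
    using assms ex_bij_betw_finite_nat unfolding is_free_game_def
    by (metis atLeast0LessThan)
  then obtain \<beta> where \<beta>: "\<And>i. i < ?k \<Longrightarrow> bij_betw (\<beta> i) (answers G i) {..<card (answers G i)}"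
    by metis
  have num: "\<forall>i<?k. bij_betw (\<eta> i) (questions G i) {..<card (questions G i)} \<and>
                     bij_betw (\<beta> i) (answers G i) {..<card (answers G i)}"
    using \<eta> \<beta> by blast
  let ?ix = "\<lambda>(y, b). table_index G \<eta> \<beta> y b"
  let ?T = "question_tuples G \<times> answer_tuples G"
  have inj: "inj_on ?ix ?T"
    using table_index_inject[OF num] by (auto simp: inj_on_def)
  define tab where "tab = (\<lambda>n. case inv_into ?T ?ix n of (y, b) \<Rightarrow> verify G y b)"
  have tab: "tab (table_index G \<eta> \<beta> y b) = verify G y b"
    if "y \<in> question_tuples G" "b \<in> answer_tuples G" for y b
    using inv_into_f_f[OF inj, of "(y, b)"] that by (simp add: tab_def)
  define s where "s = \<lparr>nvar = (\<lambda>_. ?k),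
     narr = (\<lambda>x i. if x = ''Y'' then card (questions G i) else card (answers G i)),
     rvar = (\<lambda>_. \<epsilon>), rarr = (\<lambda>_. tab)\<rparr>"
  have "is_input G \<epsilon> s"
    unfolding is_input_def s_def using num tab
    by (intro conjI exI[of _ \<eta>] exI[of _ \<beta>]) simp_all
  then show ?thesis ..
qed

end

theory Submission
  imports Defs
begin

text \<open>
  Fix optimal responses and replace them one player at a time, from the last player to the first.
  When player \<open>j\<close> is replaced, draw about \<open>k\<^sup>2 ln |B\<^sub>j| / \<epsilon>\<^sup>2\<close> question tuples of the players
  below \<open>j\<close>, note their optimal answers, and let player \<open>j\<close> answer each question by maximising the
  average of \<open>V\<close> over these samples and, exactly, over the players above \<open>j\<close>, whose new responses are
  already known. For a suitable sample this loses at most \<open>\<epsilon> / k\<close>. The algorithm tries all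
  possible samples and answers, computes the exact value of each resulting profile, and takes the
  maximum. Up to a constant factor, the logarithm of the number of trials is the sum of
  \<open>k\<^sup>2 / \<epsilon>\<^sup>2 ln |B\<^sub>j| ln (|Y\<^sub>i| |B\<^sub>i|)\<close> over all \<open>i < j\<close>, and each trial takes polynomial time.
\<close>

section \<open>Sampling\<close>

text \<open>One sample has to serve all questions of player \<open>j\<close>, but its loss is
  counted only on average over them. So the expected loss of a random sample can be bounded for each
  question separately and then added up: the union over answers costs the factor \<open>ln\<close>
  of |B_j|, and no union over questions occurs. Descending from the last player is what yields a sum
  over \<open>i < j\<close>: the replies of the players above \<open>j\<close> can be recomputed, so
  a guess for \<open>j\<close> concerns only the players below it. With m the ceiling of k /
  \<epsilon>, player \<open>j\<close> gets 4 m^2 times the ceiling of the binary logarithm of |B_j|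
  samples, enough for a loss of \<epsilon> / k. The machine lacks multiplication, integer division
  and rounding, so all of these become loops. This is harmless: if X is k^2 / \<epsilon>^2 times the
  sum over pairs, a number \<open>Z\<close> of order exp (48 X) exceeds every loop bound, and the
  total time is of order \<open>Z ^ 6\<close>, which changes only the constant in the
  exponent.\<close>

lemma sum_PiE_insert:
  fixes f :: "('i \<Rightarrow> 'b) \<Rightarrow> real"
  assumes "i \<notin> S"
  shows "(\<Sum>g\<in>PiE (insert i S) A. f g) = (\<Sum>y\<in>A i. \<Sum>g\<in>PiE S A. f (g(i := y)))"
proof -
  have inj: "inj_on (\<lambda>(y, g). g(i := y)) (A i \<times> PiE S A)"
    using inj_combinator[OF assms, of A] by (simp add: inj_on_def)
  show ?thesis
    unfolding PiE_insert_eq sum.reindex[OF inj]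
    by (simp add: sum.cartesian_product case_prod_unfold)
qed

text \<open>Independence of the draws: applied to an exponential \<open>h\<close>, it factors the
  exponential moment of a sum of samples.\<close>

lemma sum_PiE_prod:
  fixes h :: "'b \<Rightarrow> real"
  assumes "finite S"
  shows "(\<Sum>g\<in>PiE S (\<lambda>_. X). \<Prod>s\<in>S. h (g s)) = (\<Sum>x\<in>X. h x) ^ card S"
  using assms
proof (induction S)
  case (insert i S)
  have "(\<Prod>s\<in>S. h ((g(i := y)) s)) = (\<Prod>s\<in>S. h (g s))" for g y
    using insert.hyps by (intro prod.cong) auto
  then show ?case
    using insert by (simp add: sum_PiE_insert flip: sum_distrib_left sum_distrib_right)
qed simp

text \<open>Each single draw is uniform on \<open>X\<close>; this gives the mean of the empirical
  sums.\<close>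

lemma sum_PiE_coord:
  fixes h :: "'b \<Rightarrow> real"
  assumes "finite S" "s \<in> S"
  shows "(\<Sum>g\<in>PiE S (\<lambda>_. X). h (g s)) = real (card X) ^ (card S - 1) * (\<Sum>x\<in>X. h x)"
proof -
  have S: "insert s (S - {s}) = S" using assms by auto
  have "(\<Sum>g\<in>PiE (insert s (S - {s})) (\<lambda>_. X). h (g s)) = 
      (\<Sum>y\<in>X. \<Sum>g\<in>PiE (S - {s}) (\<lambda>_. X). h y)"
    by (subst sum_PiE_insert) auto
  also have "\<dots> = real (card X) ^ (card S - 1) * (\<Sum>x\<in>X. h x)"
    using assms by (simp add: card_PiE sum_distrib_left)
  finally show ?thesis unfolding S .
qed

text \<open>For negative \<open>x\<close>, \<open>exp x\<close> is at most
  \<open>1 / (1 - x)\<close>, and \<open>(1 + x + x\<^sup>2) * (1 - x) = 1 - x ^ 3\<close> is at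
  least 1.\<close>

lemma exp_le_quadratic:
  fixes x :: real
  assumes "x \<le> 1"
  shows "exp x \<le> 1 + x + x\<^sup>2"
proof (cases "0 \<le> x")
  case True
  then show ?thesis using exp_bound assms by simp
next
  case False
  have "(1 + x + x\<^sup>2) * (1 - x) = 1 - x ^ 3" by algebra
  also have "\<dots> \<ge> 1" using False by (simp add: power3_eq_cube mult_nonneg_nonpos mult_nonpos_nonpos)
  finally have 1: "1 \<le> (1 + x + x\<^sup>2) * (1 - x)" .
  have "exp x = 1 / exp (- x)" by (simp add: exp_minus field_simps)
  also have "\<dots> \<le> 1 / (1 - x)"
    using False exp_ge_add_one_self[of "- x"] by (intro divide_left_mono) auto
  also have "\<dots> \<le> 1 + x + x\<^sup>2" using 1 False by (simp add: field_simps)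
  finally show ?thesis .
qed

text \<open>A coarse form of Hoeffding's lemma. In the quadratic bound on \<open>exp\<close> the
  linear terms cancel because \<mu> is the mean, and the quadratic ones are at most
  \<open>t\<^sup>2\<close>. The restriction \<open>t \<le> 1\<close> keeps the exponents in the
  range of that bound.\<close>

lemma exp_moment_le:
  fixes f :: "'x \<Rightarrow> real"
  assumes "finite X" "X \<noteq> {}" and f: "\<And>x. x \<in> X \<Longrightarrow> f x \<in> {0..1}" and t: "0 \<le> t" "t \<le> 1"
  defines "\<mu> \<equiv> (\<Sum>x\<in>X. f x) / card X"
  shows "(\<Sum>x\<in>X. exp (t * (f x - \<mu>))) \<le> card X * exp (t\<^sup>2)"
proof -
  have c: "0 < real (card X)" using assms by (simp add: card_gt_0_iff)
  have mu: "0 \<le> \<mu>" "\<mu> \<le> 1"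
    using sum_nonneg[of X f] sum_mono[of X f "\<lambda>_. 1"] f c by (auto simp: \<mu>_def)
  have "(\<Sum>x\<in>X. exp (t * (f x - \<mu>))) \<le> (\<Sum>x\<in>X. 1 + t * (f x - \<mu>) + t\<^sup>2)"
  proof (rule sum_mono)
    fix x assume "x \<in> X"
    then have d: "f x - \<mu> \<le> 1" "-1 \<le> f x - \<mu>" using f mu by force+
    then have "t * (f x - \<mu>) \<le> 1" using t mult_mono[of t 1 "f x - \<mu>" 1] mult_le_cancel_left1
      by (smt (verit) mult_left_le)
    then have "exp (t * (f x - \<mu>)) \<le> 1 + t * (f x - \<mu>) + (t * (f x - \<mu>))\<^sup>2"
      by (rule exp_le_quadratic)
    also have "(t * (f x - \<mu>))\<^sup>2 \<le> t\<^sup>2"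
      using d by (simp add: power_mult_distrib mult_left_le abs_square_le_1 abs_le_iff)
    finally show "exp (t * (f x - \<mu>)) \<le> 1 + t * (f x - \<mu>) + t\<^sup>2" by simp
  qed
  also have "\<dots> = card X + t * ((\<Sum>x\<in>X. f x) - card X * \<mu>) + card X * t\<^sup>2"
    by (simp add: sum.distrib sum_subtractf flip: sum_distrib_left)
  also have "\<dots> = card X * (1 + t\<^sup>2)" using c by (simp add: \<mu>_def algebra_simps)
  also have "\<dots> \<le> card X * exp (t\<^sup>2)" by (intro mult_left_mono) auto
  finally show ?thesis .
qed

lemma ex_ge_if_sum_ge:
  fixes f :: "'x \<Rightarrow> real" and c :: real
  assumes "finite A" "A \<noteq> {}" "(\<Sum>x\<in>A. f x) \<ge> card A * c"
  shows "\<exists>x\<in>A. f x \<ge> c"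
proof (rule ccontr)
  assume "\<not> ?thesis"
  then have "(\<Sum>x\<in>A. f x) < (\<Sum>x\<in>A. c)" using assms by (intro sum_strict_mono) (auto simp: not_le)
  then show False using assms by simp
qed

text \<open>
  A fixed answer has an unbiased empirical mean, so only the upward deviations of the other answers
  matter. Their maximum is bounded through \<open>z \<le> c - 1 + exp (z - c)\<close>, which avoids Jensen's inequality.
\<close>
lemma sampled_response:
  fixes F :: "'x \<Rightarrow> 'y \<Rightarrow> nat \<Rightarrow> real" and \<delta> L :: real and B :: "'y \<Rightarrow> nat" and \<kappa> :: nat
    and resp :: "(nat \<Rightarrow> 'x) \<Rightarrow> 'y \<Rightarrow> nat"
  assumes X: "finite X" "X \<noteq> {}" and Y: "finite Y"
    and F: "\<And>x y b. x \<in> X \<Longrightarrow> y \<in> Y \<Longrightarrow> b < B y \<Longrightarrow> F x y b \<in> {0..1}"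
    and best: "\<And>y. y \<in> Y \<Longrightarrow> best y < B y"
    and B: "\<And>y. y \<in> Y \<Longrightarrow> B y \<le> L"
    and resp: "\<And>g y. g \<in> PiE {..<\<kappa>} (\<lambda>_. X) \<Longrightarrow> y \<in> Y \<Longrightarrow> resp g y < B y"
      "\<And>g y b. g \<in> PiE {..<\<kappa>} (\<lambda>_. X) \<Longrightarrow> y \<in> Y \<Longrightarrow> b < B y \<Longrightarrow>
         (\<Sum>s<\<kappa>. F (g s) y b) \<le> (\<Sum>s<\<kappa>. F (g s) y (resp g y))"
    and \<delta>: "0 < \<delta>" "\<delta> \<le> 1" and L: "1 \<le> L" and \<kappa>: "4 * ln L / \<delta>\<^sup>2 \<le> real \<kappa>" "0 < \<kappa>"
  shows "\<exists>g\<in>PiE {..<\<kappa>} (\<lambda>_. X).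
     (\<Sum>y\<in>Y. \<Sum>x\<in>X. F x y (best y)) - card X * card Y * \<delta> \<le> (\<Sum>y\<in>Y. \<Sum>x\<in>X. F x y (resp g y))"
proof -
  define P where "P = PiE {..<\<kappa>} (\<lambda>_. X)"
  define \<mu> where "\<mu> y b = (\<Sum>x\<in>X. F x y b) / card X" for y b
  \<comment> \<open>Dividing \<open>c\<close> below by \<open>\<kappa> * t\<close> gives
    \<open>ln L / (\<kappa> * t) + t\<close>. For \<open>t = \<delta> / 2\<close> the lower bound on
    \<kappa> makes each summand at most \<open>\<delta> / 2\<close>; this is the origin of the
    factor 4.\<close>
  define t where "t = \<delta> / 2"
  define c where "c = ln L + \<kappa> * t\<^sup>2"
  define Z :: "(nat \<Rightarrow> 'x) \<Rightarrow> 'y \<Rightarrow> nat \<Rightarrow> real" where "Z g y b = (\<Sum>s<\<kappa>. F (g s) y b) - \<kappa> * \<mu> y b" for g y b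
  have t: "0 < t" "t \<le> 1" using \<delta> by (auto simp: t_def)
  have cX: "0 < real (card X)" using X by (simp add: card_gt_0_iff)
  have finP: "finite P" and neP: "P \<noteq> {}"
    using X unfolding P_def by (auto intro: finite_PiE simp: PiE_eq_empty_iff)
  have cardP: "real (card P) = real (card X) ^ \<kappa>" by (simp add: P_def card_PiE)
  have moment: "(\<Sum>g\<in>P. exp (t * Z g y b)) \<le> card P * exp (\<kappa> * t\<^sup>2)" if "y \<in> Y" "b < B y" for y b
  proof -
    have "exp (t * Z g y b) = (\<Prod>s<\<kappa>. exp (t * (F (g s) y b - \<mu> y b)))" for g
      by (simp add: Z_def sum_subtractf flip: exp_sum sum_distrib_left)
    then have "(\<Sum>g\<in>P. exp (t * Z g y b)) = (\<Sum>x\<in>X. exp (t * (F x y b - \<mu> y b))) ^ \<kappa>"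
      unfolding P_def using sum_PiE_prod[of "{..<\<kappa>}" "\<lambda>x. exp (t * (F x y b - \<mu> y b))" X] by simp
    also have "\<dots> \<le> (card X * exp (t\<^sup>2)) ^ \<kappa>"
      unfolding \<mu>_def using X F that t
      by (intro power_mono exp_moment_le sum_nonneg) auto
    also have "\<dots> = card P * exp (\<kappa> * t\<^sup>2)"
      by (simp add: cardP power_mult_distrib flip: exp_of_nat_mult)
    finally show ?thesis .
  qed
  have zero: "(\<Sum>g\<in>P. Z g y b) = 0" for y b
  proof -
    have "(\<Sum>g\<in>P. \<Sum>s<\<kappa>. F (g s) y b) = (\<Sum>s<\<kappa>. \<Sum>g\<in>P. F (g s) y b)" by (rule sum.swap)
    also have "\<dots> = (\<Sum>s<\<kappa>. real (card X) ^ (\<kappa> - 1) * (\<Sum>x\<in>X. F x y b))"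
      unfolding P_def by (intro sum.cong refl) (subst sum_PiE_coord, auto)
    also have "\<dots> = card P * (\<kappa> * \<mu> y b)"
      using cX \<kappa>(2) by (cases \<kappa>) (auto simp: cardP \<mu>_def)
    finally show ?thesis by (simp add: Z_def sum_subtractf)
  qed
  \<comment> \<open>Both answers are compared on the same sample. Since the reply wins empirically,
    its true deficit is at most the difference of the two deviations.\<close>
  have main: "\<kappa> * (\<mu> y (best y) - \<mu> y (resp g y)) \<le> Z g y (resp g y) - Z g y (best y)"
    if "g \<in> P" "y \<in> Y" for g y
    using resp(2)[of g y "best y"] best that by (simp add: Z_def P_def algebra_simps)
  have dev: "(\<Sum>g\<in>P. t * Z g y (resp g y)) \<le> card P * c" if y: "y \<in> Y" for y
  proof -
    have "t * Z g y (resp g y) \<le> c - 1 + (\<Sum>b<B y. exp (t * Z g y b - c))" if g: "g \<in> P" for g :: "nat \<Rightarrow> 'x"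
    proof -
      have "t * Z g y (resp g y) - c + 1 \<le> exp (t * Z g y (resp g y) - c)"
        using exp_ge_add_one_self[of "t * Z g y (resp g y) - c"] by linarith
      \<comment> \<open>The reply depends on \<open>g\<close>, so its term is replaced by the sum
        over all answers, each of which has a known moment.\<close>
      also have "\<dots> \<le> (\<Sum>b<B y. exp (t * Z g y b - c))"
        using resp(1) g y by (intro member_le_sum) (auto simp: P_def)
      finally show ?thesis by simp
    qed
    then have "(\<Sum>g\<in>P. t * Z g y (resp g y)) \<le> (\<Sum>g\<in>P. c - 1 + (\<Sum>b<B y. exp (t * Z g y b - c)))"
      by (rule sum_mono)
    also have "\<dots> = card P * (c - 1) + (\<Sum>b<B y. exp (- c) * (\<Sum>g\<in>P. exp (t * Z g y b)))"
      unfolding sum.distrib sum.swap[of _ "{..<B y}" P]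
      by (simp add: exp_diff exp_minus sum_distrib_left divide_inverse mult.commute)
    also have "\<dots> \<le> card P * (c - 1) + (\<Sum>b<B y. exp (- c) * (card P * exp (\<kappa> * t\<^sup>2)))"
      using moment y by (intro add_left_mono sum_mono mult_left_mono) auto
    also have "\<dots> = card P * (c - 1) + card P * (B y * exp (- ln L))"
      by (simp add: c_def exp_add exp_minus exp_diff field_simps)
    also have "\<dots> \<le> card P * (c - 1) + real (card P) * 1"
      using L B[OF y] by (intro add_left_mono mult_left_mono) (simp_all add: exp_minus divide_simps)
    finally show ?thesis by (simp add: algebra_simps)
  qed
  have "c \<le> \<kappa> * t * \<delta>"
  proof -
    have "ln L \<le> \<kappa> * \<delta>\<^sup>2 / 4" using \<kappa> \<delta> by (simp add: field_simps)
    then show ?thesis by (simp add: c_def t_def power2_eq_square field_simps)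
  qed
  have sum: "(\<Sum>g\<in>P. \<mu> y (best y) - \<mu> y (resp g y)) \<le> card P * \<delta>" if "y \<in> Y" for y
  proof -
    have "\<kappa> * t * (\<Sum>g\<in>P. \<mu> y (best y) - \<mu> y (resp g y)) = 
        t * (\<Sum>g\<in>P. \<kappa> * (\<mu> y (best y) - \<mu> y (resp g y)))"
      by (simp add: sum_distrib_left mult_ac)
    also have "\<dots> \<le> t * (\<Sum>g\<in>P. Z g y (resp g y) - Z g y (best y))"
      using main that t by (intro mult_left_mono sum_mono) auto
    also have "\<dots> = (\<Sum>g\<in>P. t * Z g y (resp g y))"
      using zero[of y "best y"] by (simp add: sum_subtractf sum_distrib_left right_diff_distrib flip: sum_distrib_left)
    also have "\<dots> \<le> card P * c" by (rule dev[OF that])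
    also have "\<dots> \<le> card P * (\<kappa> * t * \<delta>)" using \<open>c \<le> _\<close> by (intro mult_left_mono) auto
    finally have "\<kappa> * t * (\<Sum>g\<in>P. \<mu> y (best y) - \<mu> y (resp g y)) \<le> \<kappa> * t * (card P * \<delta>)"
      by (simp add: mult_ac)
    then show ?thesis using t \<kappa>(2) by (subst (asm) mult_le_cancel_left_pos) auto
  qed
  \<comment> \<open>The questions are summed before a sample is picked, so that a single
    \<open>g\<close> serves all of them.\<close>
  have "(\<Sum>g\<in>P. (\<Sum>y\<in>Y. \<mu> y (resp g y)) - (\<Sum>y\<in>Y. \<mu> y (best y)) + card Y * \<delta>)
     = - (\<Sum>y\<in>Y. \<Sum>g\<in>P. \<mu> y (best y) - \<mu> y (resp g y)) + card P * (card Y * \<delta>)"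
    by (simp add: sum.distrib sum_subtractf sum.swap[of _ Y] sum_distrib_left)
  also have "\<dots> \<ge> - (\<Sum>y\<in>Y. card P * \<delta>) + card P * (card Y * \<delta>)"
    using sum by (intro add_right_mono le_imp_neg_le sum_mono)
  finally have "(\<Sum>g\<in>P. (\<Sum>y\<in>Y. \<mu> y (resp g y)) - (\<Sum>y\<in>Y. \<mu> y (best y)) + card Y * \<delta>) \<ge> real (card P) * 0"
    by simp
  from ex_ge_if_sum_ge[OF finP neP this] obtain g where g: "g \<in> P"
    and "(\<Sum>y\<in>Y. \<mu> y (resp g y)) - (\<Sum>y\<in>Y. \<mu> y (best y)) + card Y * \<delta> \<ge> 0" by blast
  then have "card X * ((\<Sum>y\<in>Y. \<mu> y (resp g y)) - (\<Sum>y\<in>Y. \<mu> y (best y)) + card Y * \<delta>) \<ge> 0"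
    by simp
  then have "(\<Sum>y\<in>Y. \<Sum>x\<in>X. F x y (best y)) - card X * card Y * \<delta> \<le> (\<Sum>y\<in>Y. \<Sum>x\<in>X. F x y (resp g y))"
    using cX by (simp add: \<mu>_def algebra_simps flip: sum_divide_distrib)
  then show ?thesis using g unfolding P_def by blast
qed

section \<open>Mixed radix expansions\<close>

text \<open>Later indices get the less significant digits, because the last player is the first to
  read its samples. In the induction the new index becomes the lowest digit.\<close>

lemma mixed_radix_exists:
  fixes f r :: "nat \<Rightarrow> nat"
  assumes "\<And>j. j < k \<Longrightarrow> f j < r j"
  shows "\<exists>x < (\<Prod>i<k. r i). \<forall>j<k. x div (\<Prod>i\<in>{j<..<k}. r i) mod r j = f j"
  using assms
proof (induction k)
  case (Suc k)
  then obtain x where x: "x < (\<Prod>i<k. r i)" "\<And>j. j < k \<Longrightarrow> x div (\<Prod>i\<in>{j<..<k}. r i) mod r j = f j"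
    by (metis less_SucI)
  have fk: "f k < r k" using Suc.prems by simp
  let ?x = "f k + r k * x"
  have "?x < r k * Suc x" using fk by simp
  also have "\<dots> \<le> r k * (\<Prod>i<k. r i)" using x(1) by (intro mult_left_mono) auto
  finally have 1: "?x < (\<Prod>i<Suc k. r i)" by (simp add: mult.commute)
  have "?x div (\<Prod>i\<in>{j<..<Suc k}. r i) mod r j = f j" if j: "j < Suc k" for j
  proof (cases "j = k")
    case True
    then have "{j<..<Suc k} = {}" by auto
    then show ?thesis using True fk by simp
  next
    case False
    then have j: "j < k" using j by simp
    then have "{j<..<Suc k} = insert k {j<..<k}" by auto
    then have "?x div (\<Prod>i\<in>{j<..<Suc k}. r i) = ?x div r k div (\<Prod>i\<in>{j<..<k}. r i)"
      by (simp add: div_mult2_eq)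
    moreover have "?x div r k = x" using fk by simp
    ultimately show ?thesis using x(2)[OF j] by simp
  qed
  with 1 show ?case by blast
qed simp

lemma radix_exists:
  fixes f :: "nat \<Rightarrow> nat"
  assumes "\<And>s. s < n \<Longrightarrow> f s < r"
  shows "\<exists>x < r ^ n. \<forall>s<n. x div r ^ s mod r = f s"
proof -
  obtain x where x: "x < (\<Prod>i<n. r)"
    "\<And>j. j < n \<Longrightarrow> x div (\<Prod>i\<in>{j<..<n}. r) mod r = f (n - Suc j)"
    using mixed_radix_exists[of n "\<lambda>j. f (n - Suc j)" "\<lambda>_. r"] assms by auto
  have "x div r ^ s mod r = f s" if "s < n" for s
    using x(2)[of "n - Suc s"] that by simp
  with x(1) show ?thesis by auto
qed

text \<open>The number from which a player reads its samples still carries the digits of the lower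
  players on top. Reducing modulo \<open>r ^ n\<close> removes them without touching the first
  \<open>n\<close> digits.\<close>

lemma mod_power_div_mod:
  fixes q r :: nat
  assumes "s < n"
  shows "q mod r ^ n div r ^ s mod r = q div r ^ s mod r"
proof (cases "r = 0")
  case False
  have n: "r ^ n = r ^ s * r ^ (n - s)" using assms by (simp flip: power_add)
  have "q mod r ^ n div r ^ s = q div r ^ s mod r ^ (n - s)"
    unfolding n mod_mult2_eq using False by simp
  moreover have "r dvd r ^ (n - s)" using assms by simp
  ultimately show ?thesis by (simp add: mod_mod_cancel)
qed (use assms in \<open>auto simp: power_0_left\<close>)

section \<open>Games with numbered questions and answers\<close>

text \<open>This is the scan that the program performs: a tie keeps the smaller answer, and the test
  \<open>n = 0\<close> covers the moment when no maximum has been recorded yet.\<close>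

primrec argm :: "(nat \<Rightarrow> real) \<Rightarrow> nat \<Rightarrow> nat" where
  "argm f 0 = 0"
| "argm f (Suc n) = (if n = 0 \<or> f (argm f n) < f n then n else argm f n)"

lemma sum_list_concat: "sum_list (concat xss) = (\<Sum>xs\<leftarrow>xss. sum_list xs)"
  for xss :: "real list list"
  by (induction xss) auto

lemma argm_less: "0 < n \<Longrightarrow> argm f n < n"
  by (induction n) auto

lemma argm_max: "b < n \<Longrightarrow> f b \<le> f (argm f n)"
  by (induction n) (force simp: less_Suc_eq)+

locale coded_game =
  fixes k :: nat and Y B :: "nat \<Rightarrow> nat" and T :: "nat \<Rightarrow> real" and \<kappa> :: "nat \<Rightarrow> nat"
  assumes Y_pos: "i < k \<Longrightarrow> 0 < Y i" and B_pos: "i < k \<Longrightarrow> 0 < B i"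
begin

text \<open>Place values of player \<open>j\<close> in the question and in the answer part of the
  table. \<open>N\<close> is both the number of question tuples and the shift of the answer
  part.\<close>

definition PY where "PY j = (\<Prod>i<j. Y i)"
definition PB where "PB j = (\<Prod>i<j. B i)"
definition N where "N = PY k"

text \<open>
  A position in the table of the verification function is a sum of one \<open>offset\<close> per player. An
  advice consists of \<open>\<kappa> j\<close> samples per player \<open>j\<close>: the total offset of some questions of the players
  below \<open>j\<close>, together with their supposed answers. The players reply from the last one
  down; \<open>high \<sigma> d\<close> lists the total offsets of the last \<open>d\<close> players over all their questions.
\<close>

definition offset :: "(nat \<Rightarrow> nat \<Rightarrow> nat) \<Rightarrow> nat \<Rightarrow> nat \<Rightarrow> nat" where
  "offset \<gamma> i y = y * PY i + \<gamma> i y * (N * PB i)"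

definition strategy :: "(nat \<Rightarrow> nat \<Rightarrow> nat) \<Rightarrow> bool" where
  "strategy \<gamma> \<longleftrightarrow> (\<forall>i<k. \<forall>y<Y i. \<gamma> i y < B i)"

text \<open>An unnormalised expectation over the questions of the players in \<open>S\<close>.
  Leaving \<open>f\<close> arbitrary allows the offsets of the remaining players to be fixed or
  summed outside.\<close>

definition osum :: "(nat \<Rightarrow> nat \<Rightarrow> nat) \<Rightarrow> nat set \<Rightarrow> (nat \<Rightarrow> real) \<Rightarrow> real" where
  "osum \<gamma> S f = (\<Sum>x\<in>PiE S (\<lambda>i. {..<Y i}). f (\<Sum>i\<in>S. offset \<gamma> i (x i)))"

definition val :: "(nat \<Rightarrow> nat \<Rightarrow> nat) \<Rightarrow> real" where
  "val \<gamma> = osum \<gamma> {..<k} T / N"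

text \<open>Here \<open>w s\<close> is the total offset of the sample numbered \<open>s\<close>, and
  \<open>A\<close> holds the total offsets of the players above \<open>j\<close>. Sums replace
  averages, which does not move the maximiser.\<close>

definition reply :: "nat \<Rightarrow> (nat \<Rightarrow> nat) \<Rightarrow> nat list \<Rightarrow> nat \<Rightarrow> nat" where
  "reply j w A y = argm (\<lambda>b. \<Sum>s<\<kappa> j. \<Sum>a\<leftarrow>A. T (w s + a + y * PY j + b * (N * PB j))) (B j)"

definition extend :: "nat \<Rightarrow> (nat \<Rightarrow> nat) \<Rightarrow> nat list \<Rightarrow> nat list" where
  "extend j w A =
     concat (map (\<lambda>y. map (\<lambda>a. a + y * PY j + reply j w A y * (N * PB j)) A) [0..<Y j])"

primrec high :: "(nat \<Rightarrow> nat \<Rightarrow> nat) \<Rightarrow> nat \<Rightarrow> nat list" where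
  "high \<sigma> 0 = [0]"
| "high \<sigma> (Suc d) = extend (k - Suc d) (\<sigma> (k - Suc d)) (high \<sigma> d)"

definition outcome :: "(nat \<Rightarrow> nat \<Rightarrow> nat) \<Rightarrow> real" where
  "outcome \<sigma> = (\<Sum>a\<leftarrow>high \<sigma> k. T a) / N"

definition strat :: "(nat \<Rightarrow> nat \<Rightarrow> nat) \<Rightarrow> nat \<Rightarrow> nat \<Rightarrow> nat" where
  "strat \<sigma> j = reply j (\<sigma> j) (high \<sigma> (k - Suc j))"

text \<open>
  An advice is coded by a single number, whose least significant digits belong to the last player.
  Not every number codes answers that come from a strategy, but each one yields some profile, so the
  outcome never exceeds the value of the game.
\<close>

definition advice_digit where "advice_digit q j = q mod PY j + N * (q div PY j mod PB j)"
definition radix where "radix j = PY j * PB j"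
definition rest where "rest adv j = adv div (\<Prod>i\<in>{j<..<k}. radix i ^ \<kappa> i)"
definition samples where "samples adv j s = advice_digit (rest adv j div radix j ^ s) j"
definition M where "M = (\<Prod>j<k. radix j ^ \<kappa> j)"

lemma PY_pos: "j \<le> k \<Longrightarrow> 0 < PY j" and PB_pos: "j \<le> k \<Longrightarrow> 0 < PB j"
  using Y_pos B_pos by (auto simp: PY_def PB_def intro!: prod_pos)

lemma N_pos: "0 < N" using PY_pos by (simp add: N_def)

lemma osum_insert:
  assumes "finite S" "i \<notin> S"
  shows "osum \<gamma> (insert i S) f = (\<Sum>y<Y i. osum \<gamma> S (\<lambda>a. f (a + offset \<gamma> i y)))"
proof -
  have "(\<Sum>l\<in>S. offset \<gamma> l ((g(i := y)) l)) = (\<Sum>l\<in>S. offset \<gamma> l (g l))" for g y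
    using assms by (intro sum.cong) auto
  then show ?thesis
    unfolding osum_def sum_PiE_insert[OF assms(2)] using assms
    by (intro sum.cong refl) (simp add: add.commute)
qed

lemma osum_cong:
  assumes "\<And>i. i \<in> S \<Longrightarrow> \<gamma> i = \<gamma>' i"
  shows "osum \<gamma> S f = osum \<gamma>' S f"
  unfolding osum_def using assms by (intro sum.cong refl arg_cong[of _ _ f]) (auto simp: offset_def)

lemma osum_Un:
  assumes "finite S" "finite S'" "S \<inter> S' = {}"
  shows "osum \<gamma> (S \<union> S') f = osum \<gamma> S (\<lambda>a. osum \<gamma> S' (\<lambda>b. f (a + b)))"
  using assms
proof (induction S arbitrary: f)
  case empty
  then show ?case by (simp add: osum_def[of _ "{}"])
next
  case (insert i S)
  have "osum \<gamma> (insert i S \<union> S') f = (\<Sum>y<Y i. osum \<gamma> (S \<union> S') (\<lambda>a. f (a + offset \<gamma> i y)))"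
    using osum_insert[of "S \<union> S'" i] insert by simp
  then show ?case
    using insert by (simp add: osum_insert add_ac)
qed

lemma length_high: "d \<le> k \<Longrightarrow> length (high \<sigma> d) = (\<Prod>i\<in>{k-d..<k}. Y i)"
proof (induction d)
  case (Suc d)
  have *: "{k - Suc d..<k} = insert (k - Suc d) {k - d..<k}" using Suc.prems by auto
  have "length (high \<sigma> (Suc d)) = Y (k - Suc d) * length (high \<sigma> d)"
    by (simp add: extend_def length_concat o_def sum_list_triv)
  then show ?case using Suc unfolding * by simp
qed simp

lemma high_cong:
  assumes "\<And>i. k - d \<le> i \<Longrightarrow> i < k \<Longrightarrow> \<sigma> i = \<sigma>' i" "d \<le> k"
  shows "high \<sigma> d = high \<sigma>' d"
  using assms
proof (induction d)
  case (Suc d)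
  have "high \<sigma> d = high \<sigma>' d" using Suc by auto
  moreover have "\<sigma> (k - Suc d) = \<sigma>' (k - Suc d)" using Suc.prems by auto
  ultimately show ?case by simp
qed simp

text \<open>The link from the list that the program stores to sums over question tuples. The
  function \<open>f\<close> varies in the induction because the next player shifts its
  argument.\<close>

lemma sum_high:
  "d \<le> k \<Longrightarrow> (\<Sum>a\<leftarrow>high \<sigma> d. f a) = osum (strat \<sigma>) {k-d..<k} f"
proof (induction d arbitrary: f)
  case 0
  then show ?case by (simp add: osum_def)
next
  case (Suc d)
  let ?j = "k - Suc d"
  have j: "k - Suc ?j = d" using Suc.prems by auto
  have *: "{k - Suc d..<k} = insert (k - Suc d) {k - d..<k}" using Suc.prems by auto
  have "(\<Sum>a\<leftarrow>high \<sigma> (Suc d). f a) =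
     (\<Sum>y\<leftarrow>[0..<Y ?j]. \<Sum>a\<leftarrow>high \<sigma> d. f (a + offset (strat \<sigma>) ?j y))"
    by (simp add: extend_def sum_list_concat map_concat o_def offset_def strat_def j add.assoc)
  also have "\<dots> = (\<Sum>y<Y ?j. \<Sum>a\<leftarrow>high \<sigma> d. f (a + offset (strat \<sigma>) ?j y))"
    by (simp add: sum_list_distinct_conv_sum_set lessThan_atLeast0)
  also have "\<dots> = (\<Sum>y<Y ?j. osum (strat \<sigma>) {k-d..<k} (\<lambda>a. f (a + offset (strat \<sigma>) ?j y)))"
    using Suc by simp
  also have "\<dots> = osum (strat \<sigma>) {k - Suc d..<k} f"
    unfolding * by (subst osum_insert) (use Suc.prems in auto)
  finally show ?case .
qed

lemma strategy_strat: "strategy (strat \<sigma>)"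
  by (auto simp: strategy_def strat_def reply_def intro!: argm_less B_pos)

lemma outcome_eq_val: "outcome \<sigma> = val (strat \<sigma>)"
  by (simp add: outcome_def val_def sum_high lessThan_atLeast0)

end

section \<open>Replacing optimal responses by sampled replies\<close>

locale bounded_coded_game = coded_game +
  assumes T01: "strategy \<gamma> \<Longrightarrow> x \<in> PiE {..<k} (\<lambda>i. {..<Y i}) \<Longrightarrow>
     T (\<Sum>i<k. offset \<gamma> i (x i)) \<in> {0..1}"
begin

lemma osum_split_player:
  assumes "j < k"
  shows "osum \<gamma> {..<k} f = (\<Sum>x\<in>PiE {..<j} (\<lambda>i. {..<Y i}). \<Sum>y<Y j. osum \<gamma> {j<..<k}
     (\<lambda>a. f ((\<Sum>i<j. offset \<gamma> i (x i)) + a + offset \<gamma> j y)))"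
proof -
  have 1: "{..<k} = {..<j} \<union> insert j {j<..<k}" using assms by auto
  show ?thesis
    unfolding 1 by (subst osum_Un; (subst osum_insert)?) (auto simp: osum_def add_ac)
qed

lemma osum_01:
  assumes "strategy \<gamma>" "j < k" "x \<in> PiE {..<j} (\<lambda>i. {..<Y i})" "y < Y j" "b < B j"
  defines "H \<equiv> (\<Prod>i\<in>{j<..<k}. Y i)"
  shows "osum \<gamma> {j<..<k} (\<lambda>a. T ((\<Sum>i<j. offset \<gamma> i (x i)) + a + y * PY j + b * (N * PB j))) \<in> {0..real H}"
proof -
  \<comment> \<open>Changing \<gamma> at the single question \<open>y\<close> turns the arbitrary
    answer \<open>b\<close> into part of a strategy, so that \<open>T01\<close> applies.\<close>
  let ?\<gamma> = "\<gamma>(j := (\<gamma> j)(y := b))"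
  have st: "strategy ?\<gamma>" using assms(1,2,4,5) by (auto simp: strategy_def)
  have "T ((\<Sum>i<j. offset \<gamma> i (x i)) + (\<Sum>i\<in>{j<..<k}. offset \<gamma> i (z i)) + y * PY j + b * (N * PB j)) \<in> {0..1}"
    if z: "z \<in> PiE {j<..<k} (\<lambda>i. {..<Y i})" for z
  proof -
    let ?w = "\<lambda>i. if i < j then x i else if i = j then y else z i"
    have 1: "{..<k} = {..<j} \<union> insert j {j<..<k}" using assms(2) by auto
    have w: "?w \<in> PiE {..<k} (\<lambda>i. {..<Y i})"
      using z assms(2-4) by (auto simp: PiE_iff extensional_def)
    have "(\<Sum>i<k. offset ?\<gamma> i (?w i)) = (\<Sum>i<j. offset ?\<gamma> i (?w i)) +
        (offset ?\<gamma> j (?w j) + (\<Sum>i\<in>{j<..<k}. offset ?\<gamma> i (?w i)))"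
      unfolding 1 by (subst sum.union_disjoint) auto
    also have "(\<Sum>i<j. offset ?\<gamma> i (?w i)) = (\<Sum>i<j. offset \<gamma> i (x i))"
      by (intro sum.cong) (auto simp: offset_def)
    also have "(\<Sum>i\<in>{j<..<k}. offset ?\<gamma> i (?w i)) = (\<Sum>i\<in>{j<..<k}. offset \<gamma> i (z i))"
      by (intro sum.cong) (auto simp: offset_def)
    also have "offset ?\<gamma> j (?w j) = y * PY j + b * (N * PB j)" by (simp add: offset_def)
    finally have eq: "(\<Sum>i<k. offset ?\<gamma> i (?w i)) = (\<Sum>i<j. offset \<gamma> i (x i)) +
        (\<Sum>i\<in>{j<..<k}. offset \<gamma> i (z i)) + y * PY j + b * (N * PB j)"
      by (simp only: add_ac)
    show ?thesis using T01[OF st w] unfolding eq .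
  qed
  then show ?thesis
    unfolding osum_def H_def 
    using sum_bounded_above[of "PiE {j<..<k} (\<lambda>i. {..<Y i})" _ "1::real"] 
    by (auto simp: card_PiE intro!: sum_nonneg)
qed

lemma val_01:
  assumes "strategy \<gamma>" shows "val \<gamma> \<in> {0..1}"
proof -
  have "osum \<gamma> {..<k} T \<in> {0..real N}"
    unfolding osum_def N_def PY_def
    using T01[OF assms] sum_bounded_above[of "PiE {..<k} (\<lambda>i. {..<Y i})" _ "1::real"]
    by (auto simp: card_PiE intro!: sum_nonneg)
  then show ?thesis using N_pos by (auto simp: val_def field_simps)
qed

definition hybrid :: "(nat \<Rightarrow> nat \<Rightarrow> nat) \<Rightarrow> (nat \<Rightarrow> nat \<Rightarrow> nat) \<Rightarrow> nat \<Rightarrow> nat \<Rightarrow> nat \<Rightarrow> nat" where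
  "hybrid \<gamma> \<gamma>' j i = (if i < j then \<gamma> i else \<gamma>' i)"

lemma strategy_hybrid: "strategy \<gamma> \<Longrightarrow> strategy \<gamma>' \<Longrightarrow> strategy (hybrid \<gamma> \<gamma>' j)"
  by (simp add: strategy_def hybrid_def)

text \<open>The samples used in the analysis: unlike arbitrary advice, their answers do come from
  the strategy \<beta>.\<close>

definition sample_of :: "(nat \<Rightarrow> nat \<Rightarrow> nat) \<Rightarrow> nat \<Rightarrow> nat \<Rightarrow> bool" where
  "sample_of \<beta> j n \<longleftrightarrow> (\<exists>x\<in>PiE {..<j} (\<lambda>i. {..<Y i}). n = (\<Sum>i<j. offset \<beta> i (x i)))"

text \<open>\<open>sampled_response\<close> is applied with the question tuples of the lower players
  as \<open>X\<close>. The players above are summed exactly inside \<open>F\<close>, so sampling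
  error comes only from the players below, who still follow \<beta>.\<close>

lemma hybrid_step:
  assumes \<beta>: "strategy \<beta>" and d: "d < k" and \<delta>: "0 < \<delta>" "\<delta> \<le> 1"
    and \<kappa>: "4 * ln (B (k - Suc d)) / \<delta>\<^sup>2 \<le> \<kappa> (k - Suc d)" "0 < \<kappa> (k - Suc d)"
  shows "\<exists>w. (\<forall>s<\<kappa> (k - Suc d). sample_of \<beta> (k - Suc d) (w s)) \<and>
    val (hybrid \<beta> (strat \<sigma>) (k - d)) - \<delta> \<le>
    val (hybrid \<beta> (strat (\<sigma>(k - Suc d := w))) (k - Suc d))"
proof -
  define j where "j = k - Suc d"
  have j: "j < k" "Suc j = k - d" "k - Suc j = d" using d by (auto simp: j_def)
  define X where "X = PiE {..<j} (\<lambda>i. {..<Y i})"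
  define H where "H = (\<Prod>i\<in>{j<..<k}. Y i)"
  define \<gamma> where "\<gamma> = hybrid \<beta> (strat \<sigma>) (Suc j)"
  define off where "off x = (\<Sum>i<j. offset \<beta> i (x i))" for x
  \<comment> \<open>Division by \<open>H\<close>, the number of question tuples of the players
    above, brings \<open>F\<close> into the unit interval.\<close>
  define F where "F x y b = osum \<gamma> {j<..<k} (\<lambda>a. T (off x + a + y * PY j + b * (N * PB j))) / H" for x y b
  define resp where "resp g y = reply j (\<lambda>s. off (g s)) (high \<sigma> d) y" for g y
  have \<gamma>: "strategy \<gamma>" unfolding \<gamma>_def by (intro strategy_hybrid \<beta> strategy_strat)
  have H: "0 < H" using Y_pos unfolding H_def by (intro prod_pos) auto
  have off: "off x = (\<Sum>i<j. offset \<gamma> i (x i))" for x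
    by (simp add: off_def \<gamma>_def hybrid_def offset_def)
  \<comment> \<open>The scores compared in \<open>reply\<close> are \<open>H\<close> times the
    empirical sums of \<open>F\<close>, so maximising one maximises the other.\<close>
  have est: "(\<Sum>s<\<kappa> j. \<Sum>a\<leftarrow>high \<sigma> d. T (off (g s) + a + y * PY j + b * (N * PB j))) = H * (\<Sum>s<\<kappa> j. F (g s) y b)"
    for g y b
  proof -
    have "{k - d..<k} = {j<..<k}" using j by auto
    moreover have "osum (strat \<sigma>) {j<..<k} f = osum \<gamma> {j<..<k} f" for f
      by (intro osum_cong) (simp add: \<gamma>_def hybrid_def)
    ultimately show ?thesis
      using H d by (simp add: sum_high F_def sum_distrib_left)
  qed
  have "\<exists>g\<in>PiE {..<\<kappa> j} (\<lambda>_. X).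
     (\<Sum>y\<in>{..<Y j}. \<Sum>x\<in>X. F x y (\<beta> j y)) - card X * card {..<Y j} * \<delta>
       \<le> (\<Sum>y\<in>{..<Y j}. \<Sum>x\<in>X. F x y (resp g y))"
  proof (rule sampled_response[where B = "\<lambda>_. B j" and L = "B j"])
    have "0 < Y i" if "i < j" for i using Y_pos that j(1) by simp
    then show "finite X" "X \<noteq> {}" unfolding X_def
      by (auto intro!: finite_PiE simp: PiE_eq_empty_iff lessThan_empty_iff)
    show "F x y b \<in> {0..1}" if "x \<in> X" "y \<in> {..<Y j}" "b < B j" for x y b
      using osum_01[OF \<gamma> j(1), of x y b] that H unfolding F_def off H_def[symmetric] X_def by auto
    show "\<beta> j y < B j" if "y \<in> {..<Y j}" for y using \<beta> j that by (auto simp: strategy_def)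
    show "resp g y < B j" for g y using B_pos j by (simp add: resp_def reply_def argm_less)
    show "(\<Sum>s<\<kappa> j. F (g s) y b) \<le> (\<Sum>s<\<kappa> j. F (g s) y (resp g y))" if "b < B j" for g y b
    proof -
      have "real H * (\<Sum>s<\<kappa> j. F (g s) y b) \<le> real H * (\<Sum>s<\<kappa> j. F (g s) y (resp g y))"
        using argm_max[OF that, of "\<lambda>b. H * (\<Sum>s<\<kappa> j. F (g s) y b)"]
        unfolding resp_def reply_def est by simp
      then show ?thesis using H by simp
    qed
    show "1 \<le> real (B j)" using B_pos[OF j(1)] by simp
  qed (use \<delta> \<kappa> in \<open>simp_all flip: j_def\<close>)
  then obtain g where g: "g \<in> PiE {..<\<kappa> j} (\<lambda>_. X)" and
    le: "(\<Sum>y<Y j. \<Sum>x\<in>X. F x y (\<beta> j y)) - card X * Y j * \<delta> \<le> (\<Sum>y<Y j. \<Sum>x\<in>X. F x y (resp g y))"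
    by auto
  define w where "w = (\<lambda>s. off (g s))"
  \<comment> \<open>Once the players other than \<open>j\<close> are fixed, the value of a profile
    depends only on the responses of \<open>j\<close>, and \<open>F\<close> records how.\<close>
  have val: "val \<gamma>' * N = H * (\<Sum>y<Y j. \<Sum>x\<in>X. F x y (\<gamma>' j y))"
    if "\<And>i. i < j \<Longrightarrow> \<gamma>' i = \<beta> i" "\<And>i. j < i \<Longrightarrow> i < k \<Longrightarrow> \<gamma>' i = \<gamma> i" for \<gamma>'
  proof -
    have "off x = (\<Sum>i<j. offset \<gamma>' i (x i))" for x
      unfolding off_def using that by (intro sum.cong) (auto simp: offset_def)
    moreover have "osum \<gamma>' {j<..<k} f = osum \<gamma> {j<..<k} f" for f
      using that by (intro osum_cong) auto
    ultimately show ?thesis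
      unfolding val_def osum_split_player[OF j(1)] using N_pos H
      by (simp add: F_def sum_distrib_left X_def[symmetric] offset_def[of _ j] sum.swap[of _ X] add.assoc)
  qed
  define \<sigma>' where "\<sigma>' = \<sigma>(j := w)"
  \<comment> \<open>The strategy of player \<open>i\<close> uses only samples of players from
    \<open>i\<close> upwards, so new samples for \<open>j\<close> leave the players above
    \<open>j\<close> alone.\<close>
  have strat_gt: "strat \<sigma>' i = strat \<sigma> i" if "j < i" "i < k" for i
  proof -
    have "high \<sigma>' (k - Suc i) = high \<sigma> (k - Suc i)"
      using that by (intro high_cong) (auto simp: \<sigma>'_def)
    then show ?thesis using that by (simp add: strat_def \<sigma>'_def)
  qed
  have "high \<sigma>' d = high \<sigma> d" using d j by (intro high_cong) (auto simp: \<sigma>'_def)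
  then have strat_j: "strat \<sigma>' j = resp g"
    using j by (auto simp: strat_def resp_def \<sigma>'_def w_def fun_eq_iff)
  have 1: "val \<gamma> * N = H * (\<Sum>y<Y j. \<Sum>x\<in>X. F x y (\<beta> j y))"
    by (subst val) (auto simp: \<gamma>_def hybrid_def)
  have 2: "val (hybrid \<beta> (strat \<sigma>') j) * N = H * (\<Sum>y<Y j. \<Sum>x\<in>X. F x y (resp g y))"
    by (subst val) (auto simp: \<gamma>_def hybrid_def strat_gt strat_j)
  have 3: "N = H * (card X * Y j)"
  proof -
    have "{..<k} = {..<j} \<union> insert j {j<..<k}" using j by auto
    then have "N = (\<Prod>i\<in>{..<j} \<union> insert j {j<..<k}. Y i)" by (simp add: N_def PY_def)
    also have "\<dots> = card X * (Y j * H)" 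
      by (subst prod.union_disjoint) (auto simp: X_def H_def card_PiE)
    finally show ?thesis by simp
  qed
  have "val \<gamma> * N - \<delta> * N = H * ((\<Sum>y<Y j. \<Sum>x\<in>X. F x y (\<beta> j y)) - card X * Y j * \<delta>)"
    unfolding 1 by (subst 3) (simp add: algebra_simps)
  also have "\<dots> \<le> val (hybrid \<beta> (strat \<sigma>') j) * N"
    unfolding 2 using le by (intro mult_left_mono) auto
  finally have "(val \<gamma> - \<delta>) * N \<le> val (hybrid \<beta> (strat \<sigma>') j) * N" by (simp add: algebra_simps)
  then have "val \<gamma> - \<delta> \<le> val (hybrid \<beta> (strat \<sigma>') j)" using N_pos by simp
  moreover have "sample_of \<beta> j (w s)" if "s < \<kappa> j" for s
    using g that by (auto simp: sample_of_def w_def off_def X_def intro!: bexI[of _ "g s"])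
  ultimately show ?thesis
    unfolding \<sigma>'_def \<gamma>_def j(2) j_def[symmetric] by blast
qed

text \<open>Induction on the number \<open>d\<close> of replaced players. A good sample exists only
  relative to the replies above it, and choosing samples for a lower player later does not disturb
  those replies.\<close>

lemma samples_exist:
  fixes \<delta> :: real
  assumes \<beta>: "strategy \<beta>" and \<delta>: "0 < \<delta>" "\<delta> \<le> 1"
    and \<kappa>: "\<And>j. j < k \<Longrightarrow> 4 * ln (B j) / \<delta>\<^sup>2 \<le> \<kappa> j" "\<And>j. j < k \<Longrightarrow> 0 < \<kappa> j"
    and "d \<le> k"
  shows "\<exists>\<sigma>. (\<forall>j\<in>{k-d..<k}. \<forall>s<\<kappa> j. sample_of \<beta> j (\<sigma> j s)) \<and>
     val \<beta> - d * \<delta> \<le> val (hybrid \<beta> (strat \<sigma>) (k - d))"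
  using \<open>d \<le> k\<close>
proof (induction d)
  case 0
  have "val (hybrid \<beta> \<gamma> k) = val \<beta>" for \<gamma>
    unfolding val_def by (subst osum_cong[of _ _ \<beta>]) (auto simp: hybrid_def)
  then show ?case by simp
next
  case (Suc d)
  then obtain \<sigma> where \<sigma>: "\<forall>j\<in>{k-d..<k}. \<forall>s<\<kappa> j. sample_of \<beta> j (\<sigma> j s)"
    "val \<beta> - d * \<delta> \<le> val (hybrid \<beta> (strat \<sigma>) (k - d))" by auto
  obtain w where w: "\<forall>s<\<kappa> (k - Suc d). sample_of \<beta> (k - Suc d) (w s)"
    "val (hybrid \<beta> (strat \<sigma>) (k - d)) - \<delta> \<le> val (hybrid \<beta> (strat (\<sigma>(k - Suc d := w))) (k - Suc d))"
    using hybrid_step[OF \<beta> _ \<delta> \<kappa>, of d \<sigma>] Suc.prems by auto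
  have "{k - Suc d..<k} = insert (k - Suc d) {k - d..<k}" using Suc.prems by auto
  then show ?case
    using \<sigma> w
    by (intro exI[of _ "\<sigma>(k - Suc d := w)"] conjI)
       (simp_all add: algebra_simps del: fun_upd_apply, simp)
qed

lemma outcome_cong:
  assumes "\<And>j s. j < k \<Longrightarrow> s < \<kappa> j \<Longrightarrow> \<sigma> j s = \<sigma>' j s"
  shows "outcome \<sigma> = outcome \<sigma>'"
proof -
  have "extend j (\<sigma> j) A = extend j (\<sigma>' j) A" if "j < k" for j A
    using assms that unfolding extend_def reply_def by simp
  then have "high \<sigma> d = high \<sigma>' d" if "d \<le> k" for d
    using that by (induction d) auto
  then show ?thesis by (simp add: outcome_def)
qed

text \<open>A digit packs the question index \<open>u\<close> and the answer index \<open>v\<close>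
  densely as \<open>u + PY j * v\<close>, while the table needs \<open>u + N * v\<close>;
  \<open>advice_digit\<close> converts. The statement ranges over all \<open>p\<close> with the
  given residue because \<open>samples\<close> divides without reducing.\<close>

lemma sample_of_digits:
  assumes "strategy \<beta>" "j < k" "sample_of \<beta> j n"
  shows "\<exists>f<radix j. \<forall>p. p mod radix j = f \<longrightarrow> advice_digit p j = n"
proof -
  obtain x where x: "x \<in> PiE {..<j} (\<lambda>i. {..<Y i})" "n = (\<Sum>i<j. offset \<beta> i (x i))"
    using assms by (auto simp: sample_of_def)
  define u where "u = tuple_index Y j x"
  define v where "v = tuple_index B j (\<lambda>i. \<beta> i (x i))"
  have u: "u < PY j" unfolding u_def PY_def using x by (intro tuple_index_less) auto
  have v: "v < PB j" unfolding v_def PB_def using x assms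
    by (intro tuple_index_less) (auto simp: strategy_def PiE_iff)
  have n: "n = u + N * v"
    by (simp add: x u_def v_def tuple_index_def offset_def PY_def PB_def sum.distrib sum_distrib_left mult_ac)
  have "u + PY j * v < PY j * Suc v" using u by simp
  also have "\<dots> \<le> PY j * PB j" using v by (intro mult_left_mono) auto
  finally have lt: "u + PY j * v < radix j" by (simp add: radix_def)
  have "advice_digit p j = n" if "p mod radix j = u + PY j * v" for p
  proof -
    have "p mod PY j + PY j * (p div PY j mod PB j) = u + PY j * v"
      using that by (simp add: radix_def mod_mult2_eq)
    then have "p mod PY j = u \<and> p div PY j mod PB j = v"
      using u by (intro mixed_radix_inject) auto
    then show ?thesis by (simp add: advice_digit_def n)
  qed
  with lt show ?thesis by blast
qed

text \<open>Three nested expansions: the advice into one block per player, a block into the samples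
  of that player, and a sample into its question and answer indices.\<close>

lemma advice_exists:
  assumes \<beta>: "strategy \<beta>" and \<sigma>: "\<And>j s. j < k \<Longrightarrow> s < \<kappa> j \<Longrightarrow> sample_of \<beta> j (\<sigma> j s)"
  shows "\<exists>adv<M. \<forall>j<k. \<forall>s<\<kappa> j. samples adv j s = \<sigma> j s"
proof -
  have "\<exists>f<radix j. \<forall>p. p mod radix j = f \<longrightarrow> advice_digit p j = \<sigma> j s" if "j < k" "s < \<kappa> j" for j s
    using sample_of_digits[OF \<beta> _ \<sigma>] that by blast
  then obtain f where f: "\<And>j s. j < k \<Longrightarrow> s < \<kappa> j \<Longrightarrow> f j s < radix j"
     "\<And>j s p. j < k \<Longrightarrow> s < \<kappa> j \<Longrightarrow> p mod radix j = f j s \<Longrightarrow> advice_digit p j = \<sigma> j s"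
    by metis
  have "\<exists>e. j < k \<longrightarrow> e < radix j ^ \<kappa> j \<and> (\<forall>s<\<kappa> j. e div radix j ^ s mod radix j = f j s)" for j
    using radix_exists[of "\<kappa> j" "f j" "radix j"] f(1) by blast
  then obtain e where e: "\<And>j. j < k \<Longrightarrow> e j < radix j ^ \<kappa> j"
     "\<And>j s. j < k \<Longrightarrow> s < \<kappa> j \<Longrightarrow> e j div radix j ^ s mod radix j = f j s"
    by metis
  obtain adv where adv: "adv < M" "\<And>j. j < k \<Longrightarrow> rest adv j mod radix j ^ \<kappa> j = e j"
    using mixed_radix_exists[of k e "\<lambda>j. radix j ^ \<kappa> j"] e(1) unfolding M_def rest_def by auto
  have "samples adv j s = \<sigma> j s" if "j < k" "s < \<kappa> j" for j s
    using f(2) that e(2)[OF that] mod_power_div_mod[OF that(2), of "rest adv j" "radix j"] adv(2)[OF that(1)]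
    by (simp add: samples_def)
  with adv(1) show ?thesis by blast
qed

theorem advice_suffices:
  fixes \<delta> :: real
  assumes \<beta>: "strategy \<beta>" and \<delta>: "0 < \<delta>" "\<delta> \<le> 1"
    and \<kappa>: "\<And>j. j < k \<Longrightarrow> 4 * ln (B j) / \<delta>\<^sup>2 \<le> \<kappa> j" "\<And>j. j < k \<Longrightarrow> 0 < \<kappa> j"
  shows "\<exists>adv<M. val \<beta> - k * \<delta> \<le> outcome (samples adv)"
proof -
  obtain \<sigma> where \<sigma>: "\<And>j s. j < k \<Longrightarrow> s < \<kappa> j \<Longrightarrow> sample_of \<beta> j (\<sigma> j s)"
     "val \<beta> - k * \<delta> \<le> val (hybrid \<beta> (strat \<sigma>) 0)"
    using samples_exist[OF assms, of k] by (auto simp: atLeast0LessThan)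
  obtain adv where "adv < M" "\<And>j s. j < k \<Longrightarrow> s < \<kappa> j \<Longrightarrow> samples adv j s = \<sigma> j s"
    using advice_exists[of \<beta> \<sigma>] \<beta> \<sigma>(1) by blast
  moreover have "hybrid \<beta> (strat \<sigma>) 0 = strat \<sigma>" by (simp add: hybrid_def fun_eq_iff)
  ultimately show ?thesis
    using \<sigma>(2) outcome_eq_val outcome_cong[of "samples adv" \<sigma>] by metis
qed

end

section \<open>Numbering a free game\<close>

lemma question_tuples_bij:
  assumes "\<And>i. i < players G \<Longrightarrow> bij_betw (\<eta> i) (questions G i) {..<card (questions G i)}"
  shows "bij_betw (\<lambda>y. \<lambda>i\<in>{..<players G}. \<eta> i (y i)) (question_tuples G)
    (PiE {..<players G} (\<lambda>i. {..<card (questions G i)}))"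
proof (rule bij_betwI[where g = "\<lambda>x. \<lambda>i\<in>{..<players G}. inv_into (questions G i) (\<eta> i) (x i)"])
  have e: "\<eta> i y \<in> {..<card (questions G i)}" if "i < players G" "y \<in> questions G i" for i y
    using assms that by (auto simp: bij_betw_def)
  have q: "inv_into (questions G i) (\<eta> i) n \<in> questions G i"
    "\<eta> i (inv_into (questions G i) (\<eta> i) n) = n"
    if "i < players G" "n < card (questions G i)" for i n
    using assms[OF that(1)] that(2) by (auto simp: bij_betw_def inv_into_into f_inv_into_f)
  have l: "inv_into (questions G i) (\<eta> i) (\<eta> i y) = y" if "i < players G" "y \<in> questions G i" for i y
    using assms that by (auto simp: bij_betw_def)
  show "(\<lambda>y. \<lambda>i\<in>{..<players G}. \<eta> i (y i)) \<in> question_tuples G \<rightarrow> (\<Pi>\<^sub>E i\<in>{..<players G}. {..<card (questions G i)})"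
    using e by (auto simp: question_tuples_def PiE_iff)
  show "(\<lambda>x. \<lambda>i\<in>{..<players G}. inv_into (questions G i) (\<eta> i) (x i))
    \<in> (\<Pi>\<^sub>E i\<in>{..<players G}. {..<card (questions G i)}) \<rightarrow> question_tuples G"
    using q by (auto simp: question_tuples_def PiE_iff)
  show "(\<lambda>i\<in>{..<players G}. inv_into (questions G i) (\<eta> i) ((\<lambda>i\<in>{..<players G}. \<eta> i (y i)) i)) = y"
    if "y \<in> question_tuples G" for y
    using l that by (auto simp: question_tuples_def PiE_iff extensional_def fun_eq_iff)
  show "(\<lambda>i\<in>{..<players G}. \<eta> i ((\<lambda>i\<in>{..<players G}. inv_into (questions G i) (\<eta> i) (x i)) i)) = x"
    if "x \<in> (\<Pi>\<^sub>E i\<in>{..<players G}. {..<card (questions G i)})" for x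
    using q that by (auto simp: PiE_iff extensional_def fun_eq_iff)
qed

text \<open>A product of uniform distributions is uniform on the product set.\<close>

lemma profile_value_average:
  assumes "is_free_game G"
  shows "profile_value G b =
    (\<Sum>y\<in>question_tuples G. verify G y (\<lambda>i\<in>{..<players G}. b i (y i))) / (\<Prod>i<players G. card (questions G i))"
proof -
  have q: "finite (questions G i)" "questions G i \<noteq> {}" if "i < players G" for i
    using assms that by (auto simp: is_free_game_def)
  have dflt: "PiE_dflt {..<players G} undefined (questions G) = question_tuples G"
    by (auto simp: PiE_dflt_def question_tuples_def PiE_iff extensional_def)
  have pmf: "question_pmf G = pmf_of_set (question_tuples G)"
    unfolding question_pmf_def using q by (subst Pi_pmf_of_set) (auto simp: dflt)
  have "finite (question_tuples G)" "question_tuples G \<noteq> {}"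
    using q by (auto simp: question_tuples_def PiE_eq_empty_iff intro!: finite_PiE)
  then show ?thesis
    unfolding profile_value_def pmf
    by (simp add: integral_pmf_of_set) (simp add: question_tuples_def card_PiE)
qed

lemma response_profiles_finite:
  assumes "is_free_game G"
  shows "finite (response_profiles G)" "response_profiles G \<noteq> {}"
  using assms unfolding response_profiles_def is_free_game_def
  by (auto simp: PiE_eq_empty_iff intro!: finite_PiE)

locale numbered_game =
  fixes G :: "('q, 'a) free_game" and s0 :: state and \<eta> \<beta> and \<kappa> :: "nat \<Rightarrow> nat"
  assumes G: "is_free_game G"
    and num: "i < players G \<Longrightarrow> bij_betw (\<eta> i) (questions G i) {..<card (questions G i)}"
      "i < players G \<Longrightarrow> bij_betw (\<beta> i) (answers G i) {..<card (answers G i)}"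
    and V: "y \<in> question_tuples G \<Longrightarrow> b \<in> answer_tuples G \<Longrightarrow>
           rarr s0 ''V'' (table_index G \<eta> \<beta> y b) = verify G y b"
begin

sublocale coded_game "players G" "\<lambda>i. card (questions G i)" "\<lambda>i. card (answers G i)" "rarr s0 ''V''" \<kappa>
  by unfold_locales (use G in \<open>auto simp: is_free_game_def card_gt_0_iff\<close>)

lemma table_entry:
  assumes y: "y \<in> question_tuples G" and b: "b \<in> response_profiles G"
    and \<gamma>: "\<And>i y. i < players G \<Longrightarrow> y \<in> questions G i \<Longrightarrow> \<beta> i (b i y) = \<gamma> i (\<eta> i y)"
  shows "rarr s0 ''V'' (\<Sum>i<players G. offset \<gamma> i (\<eta> i (y i))) = verify G y (\<lambda>i\<in>{..<players G}. b i (y i))"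
    "(\<lambda>i\<in>{..<players G}. b i (y i)) \<in> answer_tuples G"
proof -
  show a: "(\<lambda>i\<in>{..<players G}. b i (y i)) \<in> answer_tuples G"
    using y b by (auto simp: question_tuples_def response_profiles_def answer_tuples_def PiE_iff)
  have "(\<Sum>i<players G. offset \<gamma> i (\<eta> i (y i))) =
      (\<Sum>i<players G. \<eta> i (y i) * PY i) + N * (\<Sum>i<players G. \<gamma> i (\<eta> i (y i)) * PB i)"
    by (simp add: offset_def sum.distrib sum_distrib_left mult_ac)
  also have "(\<Sum>i<players G. \<gamma> i (\<eta> i (y i)) * PB i) = (\<Sum>i<players G. \<beta> i (b i (y i)) * PB i)"
    using \<gamma> y by (intro sum.cong) (auto simp: question_tuples_def PiE_iff)
  finally have "(\<Sum>i<players G. offset \<gamma> i (\<eta> i (y i))) = table_index G \<eta> \<beta> y (\<lambda>i\<in>{..<players G}. b i (y i))"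
    by (simp add: table_index_def tuple_index_def PY_def PB_def N_def)
  with V[OF y a] show "rarr s0 ''V'' (\<Sum>i<players G. offset \<gamma> i (\<eta> i (y i))) = verify G y (\<lambda>i\<in>{..<players G}. b i (y i))"
    by simp
qed

lemma profile_value_eq_val:
  assumes b: "b \<in> response_profiles G"
    and \<gamma>: "\<And>i y. i < players G \<Longrightarrow> y \<in> questions G i \<Longrightarrow> \<beta> i (b i y) = \<gamma> i (\<eta> i y)"
  shows "profile_value G b = val \<gamma>"
proof -
  have "(\<Sum>y\<in>question_tuples G. verify G y (\<lambda>i\<in>{..<players G}. b i (y i))) =
    (\<Sum>y\<in>question_tuples G. rarr s0 ''V'' (\<Sum>i<players G. offset \<gamma> i ((\<lambda>i\<in>{..<players G}. \<eta> i (y i)) i)))"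
    using table_entry(1)[OF _ b \<gamma>] by (intro sum.cong) auto
  also have "\<dots> = osum \<gamma> {..<players G} (rarr s0 ''V'')"
    unfolding osum_def using question_tuples_bij[OF num(1)] by (rule sum.reindex_bij_betw)
  finally show ?thesis
    by (simp add: profile_value_average[OF G] val_def N_def PY_def)
qed

definition decode :: "(nat \<Rightarrow> nat \<Rightarrow> nat) \<Rightarrow> nat \<Rightarrow> 'q \<Rightarrow> 'a" where
  "decode \<gamma> = (\<lambda>i\<in>{..<players G}. \<lambda>y\<in>questions G i. inv_into (answers G i) (\<beta> i) (\<gamma> i (\<eta> i y)))"

lemma decode:
  assumes "strategy \<gamma>"
  shows "decode \<gamma> \<in> response_profiles G"
    "\<And>i y. i < players G \<Longrightarrow> y \<in> questions G i \<Longrightarrow> \<beta> i (decode \<gamma> i y) = \<gamma> i (\<eta> i y)"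
proof -
  have lt: "\<gamma> i (\<eta> i y) \<in> \<beta> i ` answers G i" if "i < players G" "y \<in> questions G i" for i y
    using assms num[of i] that by (auto simp: strategy_def bij_betw_def)
  show "decode \<gamma> \<in> response_profiles G"
    using lt by (auto simp: decode_def response_profiles_def PiE_iff intro!: inv_into_into)
  show "\<And>i y. i < players G \<Longrightarrow> y \<in> questions G i \<Longrightarrow> \<beta> i (decode \<gamma> i y) = \<gamma> i (\<eta> i y)"
    using lt by (simp add: decode_def f_inv_into_f)
qed

text \<open>The bound on the table comes from decoding a strategy into a response profile, so it can
  be shown only after \<open>strategy\<close> and \<open>offset\<close> are available from the first
  interpretation.\<close>

sublocale bounded_coded_game "players G" "\<lambda>i. card (questions G i)" "\<lambda>i. card (answers G i)" "rarr s0 ''V''" \<kappa>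
proof
  fix \<gamma> x assume \<gamma>: "strategy \<gamma>" and "x \<in> (\<Pi>\<^sub>E i\<in>{..<players G}. {..<card (questions G i)})"
  then have "x \<in> (\<lambda>y. \<lambda>i\<in>{..<players G}. \<eta> i (y i)) ` question_tuples G"
    using question_tuples_bij[OF num(1)] by (simp add: bij_betw_def)
  then obtain y where y: "y \<in> question_tuples G" "x = (\<lambda>i\<in>{..<players G}. \<eta> i (y i))" by blast
  then show "rarr s0 ''V'' (\<Sum>i<players G. offset \<gamma> i (x i)) \<in> {0..1}"
    using table_entry[OF y(1) decode[OF \<gamma>]] G by (auto simp: is_free_game_def)
qed

lemma val_le_game_value: "strategy \<gamma> \<Longrightarrow> val \<gamma> \<le> game_value G"
  unfolding game_value_def using response_profiles_finite[OF G]
  by (intro Max_ge) (auto simp flip: profile_value_eq_val[OF decode] intro: decode(1))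

lemma game_value_attained: "\<exists>\<gamma>. strategy \<gamma> \<and> val \<gamma> = game_value G"
proof -
  have "game_value G \<in> profile_value G ` response_profiles G"
    unfolding game_value_def using response_profiles_finite[OF G] by (intro Max_in) auto
  then obtain b where b: "b \<in> response_profiles G" "profile_value G b = game_value G" by auto
  define \<gamma> where "\<gamma> i n = \<beta> i (b i (inv_into (questions G i) (\<eta> i) n))" for i n
  have "strategy \<gamma>"
    unfolding strategy_def
  proof safe
    fix i n assume i: "i < players G" "n < card (questions G i)"
    then have "inv_into (questions G i) (\<eta> i) n \<in> questions G i"
      using num(1)[of i] by (auto simp: bij_betw_def inv_into_into)
    then have "b i (inv_into (questions G i) (\<eta> i) n) \<in> answers G i"
      using b(1) i(1) by (auto simp: response_profiles_def PiE_iff)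
    then show "\<gamma> i n < card (answers G i)"
      using num(2)[OF i(1)] by (auto simp: \<gamma>_def bij_betw_def)
  qed
  moreover have "profile_value G b = val \<gamma>"
    using num(1) by (intro profile_value_eq_val b) (auto simp: \<gamma>_def bij_betw_def)
  ultimately show ?thesis using b by auto
qed

lemma game_value_01: "game_value G \<in> {0..1}"
  using game_value_attained val_01 by metis

end

section \<open>Reasoning about programs\<close>

text \<open>A weakest precondition for total correctness, with the exact running time passed to the
  postcondition.\<close>

definition run :: "com \<Rightarrow> (nat \<Rightarrow> state \<Rightarrow> bool) \<Rightarrow> state \<Rightarrow> bool" where
  "run c Q s \<longleftrightarrow> (\<exists>t s'. exec c s t s' \<and> Q t s')"

text \<open>Determinism turns the existential into an equation, so straight-line code can be
  evaluated by rewriting.\<close>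

lemma run_det: "exec c s t s' \<Longrightarrow> run c Q s \<longleftrightarrow> Q t s'"
  unfolding run_def using exec_deterministic by blast

lemmas run_Skip = run_det[OF exec_Skip]
  and run_NAssign = run_det[OF exec_NAssign]
  and run_NStore = run_det[OF exec_NStore]
  and run_RAssign = run_det[OF exec_RAssign]

lemma run_Seq: "run (Seq c d) Q s \<longleftrightarrow> run c (\<lambda>t s'. run d (\<lambda>u s''. Q (t + u) s'') s') s"
  unfolding run_def by (blast intro: exec_Seq elim: exec_SeqE)

lemma run_If: "run (If b c d) Q s \<longleftrightarrow>
    (if bval b s then run c (\<lambda>t s'. Q (1 + bcost b + t) s') s else run d (\<lambda>t s'. Q (1 + bcost b + t) s') s)"
proof (cases "bval b s")
  case True
  then have "exec (If b c d) s t s' \<longleftrightarrow> (\<exists>u. t = 1 + bcost b + u \<and> exec c s u s')" for t s'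
    by (intro iffI; elim exE conjE exec_IfE) (auto dest: exec_IfTrue[where d = d])
  then show ?thesis using True by (auto simp: run_def)
next
  case False
  then have "exec (If b c d) s t s' \<longleftrightarrow> (\<exists>u. t = 1 + bcost b + u \<and> exec d s u s')" for t s'
    by (intro iffI; elim exE conjE exec_IfE) (auto dest: exec_IfFalse[where c = c])
  then show ?thesis using False by (auto simp: run_def)
qed

fun nvars :: "com \<Rightarrow> string set" where
  "nvars (NAssign x e) = {x}"
| "nvars (Seq c d) = nvars c \<union> nvars d"
| "nvars (If b c d) = nvars c \<union> nvars d"
| "nvars (While b c) = nvars c"
| "nvars _ = {}"

fun narrs :: "com \<Rightarrow> string set" where
  "narrs (NStore a i e) = {a}"
| "narrs (Seq c d) = narrs c \<union> narrs d"
| "narrs (If b c d) = narrs c \<union> narrs d"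
| "narrs (While b c) = narrs c"
| "narrs _ = {}"

fun rvars :: "com \<Rightarrow> string set" where
  "rvars (RAssign x e) = {x}"
| "rvars (Seq c d) = rvars c \<union> rvars d"
| "rvars (If b c d) = rvars c \<union> rvars d"
| "rvars (While b c) = rvars c"
| "rvars _ = {}"

fun rarrs :: "com \<Rightarrow> string set" where
  "rarrs (RStore a i e) = {a}"
| "rarrs (Seq c d) = rarrs c \<union> rarrs d"
| "rarrs (If b c d) = rarrs c \<union> rarrs d"
| "rarrs (While b c) = rarrs c"
| "rarrs _ = {}"

text \<open>A frame condition read off the syntax; it spares the invariants from listing what a loop
  does not write.\<close>

definition keeps :: "com \<Rightarrow> state \<Rightarrow> state \<Rightarrow> bool" where
  "keeps c s s' \<longleftrightarrow> (\<forall>x. x \<notin> nvars c \<longrightarrow> nvar s' x = nvar s x) \<and> (\<forall>x. x \<notin> narrs c \<longrightarrow> narr s' x = narr s x) \<and>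
     (\<forall>x. x \<notin> rvars c \<longrightarrow> rvar s' x = rvar s x) \<and> (\<forall>x. x \<notin> rarrs c \<longrightarrow> rarr s' x = rarr s x)"

lemma exec_keeps: "exec c s t s' \<Longrightarrow> keeps c s s'"
  by (induction rule: exec.induct) (auto simp: keeps_def)

lemma run_mono:
  assumes "run c P s" "\<And>t s'. P t s' \<Longrightarrow> keeps c s s' \<Longrightarrow> Q t s'"
  shows "run c Q s"
  using assms exec_keeps unfolding run_def by blast

text \<open>
  Time bounds are kept in the form \<open>C * Z ^ d\<close>, where \<open>Z\<close> exceeds the number of iterations of every
  loop.
\<close>

lemma run_while:
  assumes init: "I 0 s"
    and step: "\<And>i s'. i < n \<Longrightarrow> I i s' \<Longrightarrow> keeps (While b c) s s' \<Longrightarrow>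
      bval b s' \<and> run c (\<lambda>t s''. t \<le> C * Z ^ d \<and> I (Suc i) s'') s'"
    and exit: "\<And>s'. I n s' \<Longrightarrow> keeps (While b c) s s' \<Longrightarrow> \<not> bval b s'"
    and n: "n < Z" and cost: "bcost b \<le> 4"
  shows "run (While b c) (\<lambda>t s'. t \<le> (C + 5) * Z ^ Suc d \<and> I n s') s"
proof -
  \<comment> \<open>The 5 pays for one evaluation of the test, \<open>1 + bcost b\<close>: once per
    iteration and once on leaving the loop.\<close>
  have "\<exists>t s''. exec (While b c) s' t s'' \<and> t \<le> (n - i) * (C * Z ^ d + 5) + 5 \<and> I n s''"
    if "i \<le> n" "I i s'" "keeps (While b c) s s'" for i s'
    using that
  proof (induction "n - i" arbitrary: i s')
    case 0
    then have "exec (While b c) s' (1 + bcost b) s'"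
      using exit[of s'] by (intro exec_WhileFalse) auto
    then show ?case using 0 cost by fastforce
  next
    case (Suc j)
    then have "i < n" by simp
    from step[OF this Suc.prems(2,3)] obtain t s''
      where 1: "bval b s'" "exec c s' t s''" "t \<le> C * Z ^ d" "I (Suc i) s''"
      by (auto simp: run_def)
    have "keeps (While b c) s s''"
      using Suc.prems(3) exec_keeps[OF 1(2)] by (simp add: keeps_def)
    moreover have "j = n - Suc i" using Suc.hyps(2) by simp
    ultimately obtain u s3 where 2: "exec (While b c) s'' u s3"
        "u \<le> (n - Suc i) * (C * Z ^ d + 5) + 5" "I n s3"
      using Suc.hyps(1)[of "Suc i" s''] 1(4) \<open>i < n\<close> by auto
    have "n - i = Suc (n - Suc i)" using \<open>i < n\<close> by simp
    then have "1 + bcost b + t + u \<le> (n - i) * (C * Z ^ d + 5) + 5"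
      using 1(3) 2(2) cost by simp
    with exec_WhileTrue[OF 1(1,2) 2(1)] 2(3) show ?case by blast
  qed
  from this[OF _ init] obtain t s'' where t: "exec (While b c) s t s''" "I n s''"
    "t \<le> n * (C * Z ^ d + 5) + 5"
    by (auto simp: keeps_def)
  have Z: "1 \<le> Z ^ d" using n by simp
  have "t \<le> Suc n * (C * Z ^ d + 5)" using t(3) by simp
  also have "\<dots> \<le> Z * ((C + 5) * Z ^ d)"
    using n Z by (intro mult_mono) (auto simp: add_mult_distrib)
  finally show ?thesis using t by (auto simp: run_def mult_ac)
qed

definition loop :: "string \<Rightarrow> nexp \<Rightarrow> com \<Rightarrow> com" where
  "loop x e c = Seq (NAssign x (NConst 0))
     (While (NLess (NVar x) e) (Seq c (NAssign x (NPlus (NVar x) (NConst 1)))))"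

lemma vars_loop [simp]: "nvars (loop x e c) = insert x (nvars c)" "narrs (loop x e c) = narrs c"
  "rvars (loop x e c) = rvars c" "rarrs (loop x e c) = rarrs c"
  by (auto simp: loop_def)

text \<open>The invariant is required after the counter has advanced, so a caller reasons about the
  body alone. The 11 consists of 4 for the increment, 5 for the test and 2 for resetting the
  counter.\<close>

lemma run_loop:
  assumes init: "I 0 (s\<lparr>nvar := (nvar s)(x := 0)\<rparr>)"
    and step: "\<And>i s'. i < n \<Longrightarrow> I i s' \<Longrightarrow> nvar s' x = i \<Longrightarrow> keeps (loop x e c) s s' \<Longrightarrow>
      run c (\<lambda>t s''. t \<le> C * Z ^ d \<and> I (Suc i) (s''\<lparr>nvar := (nvar s'')(x := Suc i)\<rparr>)) s'"
    and bound: "\<And>i s'. I i s' \<Longrightarrow> keeps (loop x e c) s s' \<Longrightarrow> nval e s' = n"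
    and n: "n < Z" and cost: "ncost e \<le> 2" and x: "x \<notin> nvars c"
  shows "run (loop x e c) (\<lambda>t s'. t \<le> (C + 11) * Z ^ Suc d \<and> I n s') s"
proof -
  let ?s = "s\<lparr>nvar := (nvar s)(x := 0)\<rparr>"
  let ?c = "Seq c (NAssign x (NPlus (NVar x) (NConst 1)))"
  have Z: "1 \<le> Z ^ d" "Z \<ge> 1" using n by simp_all
  have keeps: "keeps (loop x e c) s s'" if "keeps (While (NLess (NVar x) e) ?c) ?s s'" for s'
    using that by (auto simp: keeps_def)
  have "run (While (NLess (NVar x) e) ?c) (\<lambda>t s'. t \<le> (C + 4 + 5) * Z ^ Suc d \<and> I n s' \<and> nvar s' x = n) ?s"
  proof (rule run_while[where I = "\<lambda>i s. I i s \<and> nvar s x = i"])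
    fix i s' assume i: "i < n" and I: "I i s' \<and> nvar s' x = i"
      and k: "keeps (While (NLess (NVar x) e) ?c) ?s s'"
    have "run c (\<lambda>t s''. t + 4 \<le> (C + 4) * Z ^ d \<and> nvar s'' x = i \<and> I (Suc i) (s''\<lparr>nvar := (nvar s'')(x := Suc i)\<rparr>)) s'"
    proof (rule run_mono)
      show "run c (\<lambda>t s''. t \<le> C * Z ^ d \<and> I (Suc i) (s''\<lparr>nvar := (nvar s'')(x := Suc i)\<rparr>)) s'"
        using step[OF i _ _ keeps[OF k]] I by simp
    next
      fix t s'' assume *: "t \<le> C * Z ^ d \<and> I (Suc i) (s''\<lparr>nvar := (nvar s'')(x := Suc i)\<rparr>)" "keeps c s' s''"
      then have "nvar s'' x = i" using x I by (simp add: keeps_def)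
      moreover have "t + 4 \<le> (C + 4) * Z ^ d" using * Z(1) unfolding add_mult_distrib by linarith
      ultimately show "t + 4 \<le> (C + 4) * Z ^ d \<and> nvar s'' x = i \<and> I (Suc i) (s''\<lparr>nvar := (nvar s'')(x := Suc i)\<rparr>)"
        using * by simp
    qed
    then have "run ?c (\<lambda>t s''. t \<le> (C + 4) * Z ^ d \<and> I (Suc i) s'' \<and> nvar s'' x = Suc i) s'"
      unfolding run_Seq run_NAssign by (rule run_mono) auto
    then show "bval (NLess (NVar x) e) s' \<and> run ?c (\<lambda>t s''. t \<le> (C + 4) * Z ^ d \<and> I (Suc i) s'' \<and> nvar s'' x = Suc i) s'"
      using bound[OF _ keeps[OF k]] I i by auto
  next
    fix s' assume "I n s' \<and> nvar s' x = n" "keeps (While (NLess (NVar x) e) ?c) ?s s'"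
    then show "\<not> bval (NLess (NVar x) e) s'" using bound keeps by auto
  qed (use init n cost in auto)
  then show ?thesis
    unfolding loop_def run_Seq run_NAssign nval.simps
  proof (rule run_mono)
    fix t s' assume "t \<le> (C + 4 + 5) * Z ^ Suc d \<and> I n s' \<and> nvar s' x = n"
    moreover have "1 \<le> Z ^ Suc d" using Z by simp
    ultimately show "1 + ncost (NConst 0) + t \<le> (C + 11) * Z ^ Suc d \<and> I n s'"
      by (simp add: add_mult_distrib del: power_Suc)
  qed
qed

lemmas run_simps = run_Skip run_NAssign run_NStore run_RAssign run_Seq run_If

section \<open>The algorithm\<close>

definition mul :: "nexp \<Rightarrow> nexp \<Rightarrow> com" where
  "mul e f = Seq (NAssign ''x'' e) (Seq (NAssign ''y'' f) (Seq (NAssign ''z'' (NConst 0))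
     (loop ''c'' (NVar ''x'') (NAssign ''z'' (NPlus (NVar ''z'') (NVar ''y''))))))"

lemma vars_mul [simp]: "nvars (mul e f) = {''x'', ''y'', ''z'', ''c''}" "narrs (mul e f) = {}"
  "rvars (mul e f) = {}" "rarrs (mul e f) = {}"
  by (auto simp: mul_def)

text \<open>Multiplication is repeated addition, and only the first factor counts iterations, so
  only that factor has to stay below \<open>Z\<close>. The second is evaluated after
  \<open>x\<close> has been overwritten.\<close>

lemma run_mul:
  assumes "nval e s < Z" "nval f (s\<lparr>nvar := (nvar s)(''x'' := nval e s)\<rparr>) = b" "ncost e \<le> 5" "ncost f \<le> 5"
  shows "run (mul e f) (\<lambda>t s'. t \<le> 30 * Z \<and> nvar s' ''z'' = nval e s * b) s"
proof -
  let ?a = "nval e s"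
  have Z: "1 \<le> Z" using assms by simp
  let ?s = "s\<lparr>nvar := (nvar s)(''x'' := ?a, ''y'' := b, ''z'' := 0)\<rparr>"
  have "run (loop ''c'' (NVar ''x'') (NAssign ''z'' (NPlus (NVar ''z'') (NVar ''y''))))
     (\<lambda>t s'. t \<le> (4 + 11) * Z ^ Suc 0 \<and> nvar s' ''z'' = ?a * b \<and> nvar s' ''x'' = ?a \<and> nvar s' ''y'' = b) ?s"
    by (rule run_loop[where I = "\<lambda>i s. nvar s ''z'' = i * b \<and> nvar s ''x'' = ?a \<and> nvar s ''y'' = b"])
       (use assms in \<open>auto simp: run_simps\<close>)
  from run_mono[OF this] show ?thesis
    using assms Z by (simp add: mul_def run_Seq run_NAssign)
qed

definition divmod :: "nexp \<Rightarrow> com" where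
  "divmod e = Seq (NAssign ''x'' e) (Seq (NAssign ''d'' (NConst 0))
     (While (Not (NLess (NVar ''q'') (NVar ''x''))) (Seq (NAssign ''q'' (NMinus (NVar ''q'') (NVar ''x'')))
        (NAssign ''d'' (NPlus (NVar ''d'') (NConst 1))))))"

lemma vars_divmod [simp]: "nvars (divmod e) = {''x'', ''d'', ''q''}" "narrs (divmod e) = {}"
  "rvars (divmod e) = {}" "rarrs (divmod e) = {}"
  by (auto simp: divmod_def)

lemma run_divmod:
  assumes "0 < nval e s" "nvar s ''q'' < Z" "ncost e \<le> 5"
  shows "run (divmod e) (\<lambda>t s'. t \<le> 30 * Z \<and>
     nvar s' ''q'' = nvar s ''q'' mod nval e s \<and> nvar s' ''d'' = nvar s ''q'' div nval e s) s"
proof -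
  let ?r = "nval e s" and ?q = "nvar s ''q''"
  have Z: "1 \<le> Z" using assms by simp
  let ?s = "s\<lparr>nvar := (nvar s)(''x'' := ?r, ''d'' := 0)\<rparr>"
  \<comment> \<open>The conjunct \<open>i * ?r \<le> ?q\<close> keeps the truncated subtraction
    exact.\<close>
  let ?I = "\<lambda>i (s::state). nvar s ''q'' = ?q - i * ?r \<and> i * ?r \<le> ?q \<and> nvar s ''x'' = ?r \<and> nvar s ''d'' = i"
  have *: "Suc i * ?r \<le> ?q" if "i < ?q div ?r" for i
  proof -
    have "Suc i * ?r \<le> ?q div ?r * ?r" using that by (intro mult_right_mono) auto
    then show ?thesis using div_times_less_eq_dividend[of ?q ?r] by linarith
  qed
  have le: "?q div ?r < Z" using assms(2) div_le_dividend le_less_trans by blast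
  have "run (While (Not (NLess (NVar ''q'') (NVar ''x''))) (Seq (NAssign ''q'' (NMinus (NVar ''q'') (NVar ''x'')))
        (NAssign ''d'' (NPlus (NVar ''d'') (NConst 1)))))
     (\<lambda>t s'. t \<le> (8 + 5) * Z ^ Suc 0 \<and> ?I (?q div ?r) s') ?s"
  proof (rule run_while[where I = ?I])
    fix i s' assume i: "i < ?q div ?r" and "?I i s'"
    then show "bval (Not (NLess (NVar ''q'') (NVar ''x''))) s' \<and>
      run (Seq (NAssign ''q'' (NMinus (NVar ''q'') (NVar ''x'')))
        (NAssign ''d'' (NPlus (NVar ''d'') (NConst 1)))) (\<lambda>t s''. t \<le> 8 * Z ^ 0 \<and> ?I (Suc i) s'') s'"
      using *[OF i] by (auto simp: run_simps)
  next
    fix s' assume "?I (?q div ?r) s'"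
    then show "\<not> bval (Not (NLess (NVar ''q'') (NVar ''x''))) s'"
      using assms by (simp add: minus_div_mult_eq_mod)
  qed (use assms le in auto)
  from run_mono[OF this] show ?thesis
    using assms Z by (simp add: divmod_def run_Seq run_NAssign minus_div_mult_eq_mod)
qed

text \<open>Reads the lowest sample off \<open>q\<close>: the remainder modulo \<open>PY j\<close>
  is its question index, the next one, modulo \<open>PB j\<close>, its answer index. The latter is
  multiplied by \<open>N\<close> to give a table position, and \<open>q\<close> keeps the remaining
  digits.\<close>

definition draw :: com where
  "draw = Seq (divmod (NArr ''PY'' (NVar ''j''))) (Seq (NAssign ''u'' (NVar ''q'')) (Seq (NAssign ''q'' (NVar ''d''))
     (Seq (divmod (NArr ''PB'' (NVar ''j''))) (Seq (mul (NVar ''q'') (NVar ''N''))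
     (Seq (NStore ''O'' (NVar ''s'') (NPlus (NVar ''u'') (NVar ''z''))) (NAssign ''q'' (NVar ''d'')))))))"

lemma vars_draw [simp]: "nvars draw = {''x'', ''d'', ''q'', ''u'', ''y'', ''z'', ''c''}" "narrs draw = {''O''}"
  "rvars draw = {}" "rarrs draw = {}"
  by (auto simp: draw_def)

definition draws :: com where
  "draws = loop ''s'' (NArr ''K'' (NVar ''j'')) draw"

lemma vars_draws [simp]: "nvars draws = {''s'', ''x'', ''d'', ''q'', ''u'', ''y'', ''z'', ''c''}" "narrs draws = {''O''}"
  "rvars draws = {}" "rarrs draws = {}"
  by (auto simp: draws_def)

definition score :: com where
  "score = Seq (RAssign ''est'' (RNat (NConst 0))) (loop ''s'' (NArr ''K'' (NVar ''j'')) (loop ''a'' (NVar ''H'')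
     (RAssign ''est'' (RPlus (RVar ''est'') (RArr ''V'' (NPlus (NPlus (NPlus
        (NArr ''O'' (NVar ''s'')) (NArr ''A'' (NVar ''a''))) (NVar ''yo'')) (NVar ''bo'')))))))"

lemma vars_score [simp]: "nvars score = {''s'', ''a''}" "narrs score = {}"
  "rvars score = {''est''}" "rarrs score = {}"
  by (auto simp: score_def)

text \<open>The variable \<open>bo\<close> runs through the multiples of \<open>g\<close>, the place
  value of an answer, which avoids a multiplication in every iteration. \<open>ao\<close> records
  the multiple belonging to the best answer so far.\<close>

definition answer :: com where
  "answer = Seq (NAssign ''bo'' (NConst 0)) (Seq (NAssign ''ao'' (NConst 0))
     (loop ''b'' (NArr ''B'' (NVar ''j''))
       (Seq score (Seq (If (And (Not (NLess (NVar ''b'') (NConst 1))) (Not (RLess (RVar ''best'') (RVar ''est''))))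
            Skip (Seq (RAssign ''best'' (RVar ''est'')) (NAssign ''ao'' (NVar ''bo''))))
         (NAssign ''bo'' (NPlus (NVar ''bo'') (NVar ''g'')))))))"

lemma vars_answer [simp]: "nvars answer = {''b'', ''bo'', ''ao'', ''s'', ''a''}" "narrs answer = {}"
  "rvars answer = {''est'', ''best''}" "rarrs answer = {}"
  by (auto simp: answer_def)

text \<open>The new list goes to \<open>D\<close> because \<open>A\<close> is read again for every
  further question of the same player.\<close>

definition append_offsets :: com where
  "append_offsets = loop ''a'' (NVar ''H'') (Seq (NStore ''D'' (NVar ''h'')
      (NPlus (NPlus (NArr ''A'' (NVar ''a'')) (NVar ''yo'')) (NVar ''ao'')))
    (NAssign ''h'' (NPlus (NVar ''h'') (NConst 1))))"

lemma vars_append_offsets [simp]: "nvars append_offsets = {''a'', ''h''}" "narrs append_offsets = {''D''}"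
  "rvars append_offsets = {}" "rarrs append_offsets = {}"
  by (auto simp: append_offsets_def)

definition replies :: com where
  "replies = Seq (NAssign ''h'' (NConst 0)) (Seq (NAssign ''yo'' (NConst 0))
     (loop ''i'' (NArr ''Y'' (NVar ''j''))
       (Seq answer (Seq append_offsets (NAssign ''yo'' (NPlus (NVar ''yo'') (NArr ''PY'' (NVar ''j''))))))))"

lemma vars_replies [simp]: "nvars replies = {''i'', ''h'', ''yo'', ''b'', ''bo'', ''ao'', ''s'', ''a''}"
  "narrs replies = {''D''}" "rvars replies = {''est'', ''best''}" "rarrs replies = {}"
  by (auto simp: replies_def)

definition copy_back :: com where
  "copy_back = Seq (NAssign ''H'' (NVar ''h''))
     (loop ''a'' (NVar ''H'') (NStore ''A'' (NVar ''a'') (NArr ''D'' (NVar ''a''))))"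

lemma vars_copy_back [simp]: "nvars copy_back = {''H'', ''a''}"
  "narrs copy_back = {''A''}" "rvars copy_back = {}" "rarrs copy_back = {}"
  by (auto simp: copy_back_def)

definition stage :: com where
  "stage = Seq (mul (NVar ''N'') (NArr ''PB'' (NVar ''j''))) (Seq (NAssign ''g'' (NVar ''z''))
     (Seq draws (Seq replies copy_back)))"

lemma vars_stage [simp]: "nvars stage = {''x'', ''y'', ''z'', ''c'', ''g'', ''s'', ''d'', ''q'', ''u'',
     ''i'', ''h'', ''yo'', ''b'', ''bo'', ''ao'', ''a'', ''H''}"
  "narrs stage = {''O'', ''D'', ''A''}" "rvars stage = {''est'', ''best''}" "rarrs stage = {}"
  by (auto simp: stage_def)

definition stages :: com where
  "stages = Seq (NStore ''A'' (NConst 0) (NConst 0)) (Seq (NAssign ''H'' (NConst 1)) (Seq (NAssign ''j'' (NVar ''k''))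
     (While (NLess (NConst 0) (NVar ''j'')) (Seq (NAssign ''j'' (NMinus (NVar ''j'') (NConst 1))) stage))))"

lemma vars_stages [simp]: "nvars stages = {''j'', ''x'', ''y'', ''z'', ''c'', ''g'', ''s'', ''d'', ''q'', ''u'',
     ''i'', ''h'', ''yo'', ''b'', ''bo'', ''ao'', ''a'', ''H''}"
  "narrs stages = {''O'', ''D'', ''A''}" "rvars stages = {''est'', ''best''}" "rarrs stages = {}"
  by (auto simp: stages_def)

definition evaluate :: com where
  "evaluate = Seq (RAssign ''est'' (RNat (NConst 0))) (Seq
     (loop ''a'' (NVar ''H'') (RAssign ''est'' (RPlus (RVar ''est'') (RArr ''V'' (NArr ''A'' (NVar ''a''))))))
     (Seq (RAssign ''est'' (RDiv (RVar ''est'') (NVar ''N'')))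
        (If (RLess (RVar ''out'') (RVar ''est'')) (RAssign ''out'' (RVar ''est'')) Skip)))"

lemma vars_evaluate [simp]: "nvars evaluate = {''a''}"
  "narrs evaluate = {}" "rvars evaluate = {''est'', ''out''}" "rarrs evaluate = {}"
  by (auto simp: evaluate_def)

text \<open>
  What is left of the number in \<open>q\<close> after all samples have been read is \<open>adv div M\<close>, so the search
  can stop at the first nonzero remainder, without computing \<open>M\<close>.
\<close>

definition search :: com where
  "search = Seq (RAssign ''out'' (RNat (NConst 0))) (Seq (NAssign ''q'' (NConst 0)) (Seq (NAssign ''adv'' (NConst 0))
     (While (NLess (NVar ''q'') (NConst 1)) (Seq (NAssign ''q'' (NVar ''adv''))
        (Seq (NAssign ''adv'' (NPlus (NVar ''adv'') (NConst 1))) (Seq stages evaluate))))))"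

section \<open>Correctness and cost of the search\<close>

locale ram_game = bounded_coded_game +
  fixes Z :: nat
  assumes Z: "k < Z" "N < Z" "PB k < Z" "Suc M < Z" "\<And>j. j < k \<Longrightarrow> \<kappa> j < Z"
begin

definition env :: "state \<Rightarrow> bool" where
  "env s \<longleftrightarrow> nvar s ''k'' = k \<and> nvar s ''N'' = N \<and>
     (\<forall>i<k. narr s ''Y'' i = Y i \<and> narr s ''B'' i = B i \<and> narr s ''K'' i = \<kappa> i) \<and>
     (\<forall>i\<le>k. narr s ''PY'' i = PY i \<and> narr s ''PB'' i = PB i) \<and> rarr s ''V'' = T"

lemma env_update [simp]:
  "x \<notin> {''k'', ''N''} \<Longrightarrow> env (s\<lparr>nvar := (nvar s)(x := v)\<rparr>) = env s"
  "a \<notin> {''Y'', ''B'', ''K'', ''PY'', ''PB''} \<Longrightarrow> env (s\<lparr>narr := (narr s)(a := f)\<rparr>) = env s"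
  "env (s\<lparr>rvar := g\<rparr>) = env s"
  by (auto simp: env_def)

lemma env_keeps:
  assumes "keeps c s s'" "env s" "nvars c \<inter> {''k'', ''N''} = {}"
    "narrs c \<inter> {''Y'', ''B'', ''K'', ''PY'', ''PB''} = {}" "''V'' \<notin> rarrs c"
  shows "env s'"
proof -
  have "x \<notin> nvars c" if "x \<in> {''k'', ''N''}" for x using assms(3) that by auto
  moreover have "x \<notin> narrs c" if "x \<in> {''Y'', ''B'', ''K'', ''PY'', ''PB''}" for x using assms(4) that by auto
  ultimately show ?thesis using assms(1,2,5) by (simp add: env_def keeps_def)
qed

lemma PY_dvd: "j \<le> k \<Longrightarrow> PY j * (\<Prod>i\<in>{j..<k}. Y i) = N"
  unfolding PY_def N_def lessThan_atLeast0 by (rule prod.atLeastLessThan_concat) auto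

lemma PB_le: "j \<le> k \<Longrightarrow> PB j \<le> PB k"
proof -
  assume "j \<le> k"
  then have "PB j * (\<Prod>i\<in>{j..<k}. B i) = PB k"
    unfolding PB_def lessThan_atLeast0 by (intro prod.atLeastLessThan_concat) auto
  moreover have "0 < (\<Prod>i\<in>{j..<k}. B i)" using B_pos by (intro prod_pos) auto
  ultimately show ?thesis by (metis One_nat_def Suc_leI mult.right_neutral mult_le_mono2)
qed

lemma PY_le: "j \<le> k \<Longrightarrow> PY j \<le> N"
  using PY_dvd[of j] N_pos by (metis dvd_triv_left dvd_imp_le)

lemma Z_pos: "0 < Z" using Z(1) by simp

lemma run_draw:
  assumes "env s" "nvar s ''j'' < k" "nvar s ''q'' < Z"
  shows "run draw (\<lambda>t s'. t \<le> 110 * Z ^ 1 \<and> nvar s' ''q'' = nvar s ''q'' div radix (nvar s ''j'') \<and>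
     narr s' ''O'' = (narr s ''O'')(nvar s ''s'' := advice_digit (nvar s ''q'') (nvar s ''j''))) s"
proof -
  let ?j = "nvar s ''j''" and ?q = "nvar s ''q''"
  have pos: "0 < PY ?j" "0 < PB ?j" using PY_pos PB_pos assms(2) by simp_all
  have div: "?q div PY ?j < Z" using assms(3) div_le_dividend le_less_trans by blast
  have "?q div PY ?j mod PB ?j < PB ?j" using pos by simp
  \<comment> \<open>The answer index is the first factor of the following multiplication and hence
    its number of iterations.\<close>
  then have mod: "?q div PY ?j mod PB ?j < Z" using PB_le[of ?j] Z(3) assms(2) by linarith
  note e = assms(1)[unfolded env_def]
  show ?thesis
    unfolding draw_def run_Seq run_NAssign run_NStore
    apply (rule run_mono[OF run_divmod[where Z = Z]])
       apply (use e assms pos in simp_all)[3]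
    subgoal for t1 s1
      apply (rule run_mono[OF run_divmod[where Z = Z]])
         apply (use e assms pos div in \<open>simp_all add: keeps_def\<close>)[3]
      subgoal for t2 s2
        apply (rule run_mono[OF run_mul[where Z = Z and b = N]])
            apply (use e assms pos div mod in \<open>simp_all add: keeps_def\<close>)[4]
        subgoal for t3 s3
          using e assms pos Z_pos
          by (simp add: keeps_def radix_def advice_digit_def div_mult2_eq mult.commute[of _ N])
        done
      done
    done
qed

lemma run_draws:
  assumes "env s" "nvar s ''j'' < k" "nvar s ''q'' < Z"
  shows "run draws (\<lambda>t s'. t \<le> 121 * Z ^ 2 \<and>
     nvar s' ''q'' = nvar s ''q'' div radix (nvar s ''j'') ^ \<kappa> (nvar s ''j'') \<and>
     (\<forall>i<\<kappa> (nvar s ''j''). narr s' ''O'' i = advice_digit (nvar s ''q'' div radix (nvar s ''j'') ^ i) (nvar s ''j''))) s"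
proof -
  define j where "j = nvar s ''j''"
  define q where "q = nvar s ''q''"
  have "run draws (\<lambda>t s'. t \<le> (110 + 11) * Z ^ Suc 1 \<and> (nvar s' ''q'' = q div radix j ^ \<kappa> j \<and> nvar s' ''j'' = j \<and> env s' \<and>
     (\<forall>i<\<kappa> j. narr s' ''O'' i = advice_digit (q div radix j ^ i) j))) s"
    unfolding draws_def
  proof (rule run_loop[where I = "\<lambda>n s'. nvar s' ''q'' = q div radix j ^ n \<and> nvar s' ''j'' = j \<and> env s' \<and>
     (\<forall>i<n. narr s' ''O'' i = advice_digit (q div radix j ^ i) j)"])
    fix n s' assume n: "n < \<kappa> j" and I: "nvar s' ''q'' = q div radix j ^ n \<and> nvar s' ''j'' = j \<and> env s' \<and>
       (\<forall>i<n. narr s' ''O'' i = advice_digit (q div radix j ^ i) j)" "nvar s' ''s'' = n"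
    have "q div radix j ^ n < Z" using assms(3) div_le_dividend le_less_trans unfolding q_def by blast
    then have "run draw (\<lambda>t s''. t \<le> 110 * Z ^ 1 \<and> nvar s'' ''q'' = nvar s' ''q'' div radix (nvar s' ''j'') \<and>
     narr s'' ''O'' = (narr s' ''O'')(nvar s' ''s'' := advice_digit (nvar s' ''q'') (nvar s' ''j''))) s'"
      using I assms by (intro run_draw) (auto simp: j_def)
    then show "run draw (\<lambda>t s''. t \<le> 110 * Z ^ 1 \<and> (nvar (s''\<lparr>nvar := (nvar s'')(''s'' := Suc n)\<rparr>) ''q'' = q div radix j ^ Suc n \<and>
       nvar (s''\<lparr>nvar := (nvar s'')(''s'' := Suc n)\<rparr>) ''j'' = j \<and> env (s''\<lparr>nvar := (nvar s'')(''s'' := Suc n)\<rparr>) \<and>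
      (\<forall>i<Suc n. narr (s''\<lparr>nvar := (nvar s'')(''s'' := Suc n)\<rparr>) ''O'' i = advice_digit (q div radix j ^ i) j))) s'"
    proof (rule run_mono)
      fix t s'' assume *: "t \<le> 110 * Z ^ 1 \<and> nvar s'' ''q'' = nvar s' ''q'' div radix (nvar s' ''j'') \<and>
       narr s'' ''O'' = (narr s' ''O'')(nvar s' ''s'' := advice_digit (nvar s' ''q'') (nvar s' ''j''))" "keeps draw s' s''"
      have "env s''" using env_keeps[OF *(2)] I by simp
      moreover have "nvar s'' ''j'' = j" using *(2) I by (simp add: keeps_def)
      ultimately show "t \<le> 110 * Z ^ 1 \<and> (nvar (s''\<lparr>nvar := (nvar s'')(''s'' := Suc n)\<rparr>) ''q'' = q div radix j ^ Suc n \<and>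
       nvar (s''\<lparr>nvar := (nvar s'')(''s'' := Suc n)\<rparr>) ''j'' = j \<and> env (s''\<lparr>nvar := (nvar s'')(''s'' := Suc n)\<rparr>) \<and>
      (\<forall>i<Suc n. narr (s''\<lparr>nvar := (nvar s'')(''s'' := Suc n)\<rparr>) ''O'' i = advice_digit (q div radix j ^ i) j))"
        using * I by (auto simp: less_Suc_eq mult.commute[of "radix j"] div_mult2_eq)
    qed
  qed (use assms Z in \<open>auto simp: env_def q_def j_def\<close>)
  then show ?thesis
    by (rule run_mono) (simp add: j_def q_def power2_eq_square)
qed


lemma run_score_row:
  assumes "nvar s ''H'' = H" "H < Z"
  shows "run (loop ''a'' (NVar ''H'')
     (RAssign ''est'' (RPlus (RVar ''est'') (RArr ''V'' (NPlus (NPlus (NPlus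
        (NArr ''O'' (NVar ''s'')) (NArr ''A'' (NVar ''a''))) (NVar ''yo'')) (NVar ''bo''))))))
     (\<lambda>t s'. t \<le> 25 * Z ^ 1 \<and> rvar s' ''est'' = rvar s ''est'' +
       (\<Sum>a<H. rarr s ''V'' (narr s ''O'' (nvar s ''s'') + narr s ''A'' a + nvar s ''yo'' + nvar s ''bo''))) s"
proof -
  define F where "F a = rarr s ''V'' (narr s ''O'' (nvar s ''s'') + narr s ''A'' a + nvar s ''yo'' + nvar s ''bo'')" for a
  have "run (loop ''a'' (NVar ''H'')
     (RAssign ''est'' (RPlus (RVar ''est'') (RArr ''V'' (NPlus (NPlus (NPlus
        (NArr ''O'' (NVar ''s'')) (NArr ''A'' (NVar ''a''))) (NVar ''yo'')) (NVar ''bo''))))))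
     (\<lambda>t s'. t \<le> (14 + 11) * Z ^ Suc 0 \<and> rvar s' ''est'' = rvar s ''est'' + (\<Sum>a<H. F a)) s"
    by (rule run_loop[where I = "\<lambda>n s'. rvar s' ''est'' = rvar s ''est'' + (\<Sum>a<n. F a)"])
       (use assms in \<open>auto simp: run_simps keeps_def F_def\<close>)
  then show ?thesis by (simp add: F_def)
qed

lemma run_score:
  assumes "env s" "nvar s ''j'' < k" "nvar s ''H'' = H" "H < Z"
  shows "run score (\<lambda>t s'. t \<le> 40 * Z ^ 2 \<and> rvar s' ''est'' = (\<Sum>i<\<kappa> (nvar s ''j''). \<Sum>a<H.
       T (narr s ''O'' i + narr s ''A'' a + nvar s ''yo'' + nvar s ''bo''))) s"
proof -
  define F where "F i = (\<Sum>a<H. T (narr s ''O'' i + narr s ''A'' a + nvar s ''yo'' + nvar s ''bo''))" for i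
  let ?s = "s\<lparr>rvar := (rvar s)(''est'' := 0)\<rparr>"
  let ?loop = "loop ''s'' (NArr ''K'' (NVar ''j'')) (loop ''a'' (NVar ''H'')
     (RAssign ''est'' (RPlus (RVar ''est'') (RArr ''V'' (NPlus (NPlus (NPlus
        (NArr ''O'' (NVar ''s'')) (NArr ''A'' (NVar ''a''))) (NVar ''yo'')) (NVar ''bo''))))))"
  have "run ?loop (\<lambda>t s'. t \<le> (25 + 11) * Z ^ Suc 1 \<and> rvar s' ''est'' = (\<Sum>i<\<kappa> (nvar s ''j''). F i)) ?s"
  proof (rule run_loop[where I = "\<lambda>n s'. rvar s' ''est'' = (\<Sum>i<n. F i)"])
    fix n s' assume n: "n < \<kappa> (nvar s ''j'')" and I: "rvar s' ''est'' = (\<Sum>i<n. F i)" "nvar s' ''s'' = n"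
      and k: "keeps ?loop ?s s'"
    have "nvar s' ''H'' = H" using k assms by (simp add: keeps_def)
    from run_score_row[OF this assms(4)]
    show "run (loop ''a'' (NVar ''H'')
     (RAssign ''est'' (RPlus (RVar ''est'') (RArr ''V'' (NPlus (NPlus (NPlus
        (NArr ''O'' (NVar ''s'')) (NArr ''A'' (NVar ''a''))) (NVar ''yo'')) (NVar ''bo''))))))
      (\<lambda>t s''. t \<le> 25 * Z ^ 1 \<and> rvar (s''\<lparr>nvar := (nvar s'')(''s'' := Suc n)\<rparr>) ''est'' = (\<Sum>i<Suc n. F i)) s'"
      using k I assms(1) by (elim run_mono) (simp add: keeps_def F_def env_def)
  qed (use assms Z in \<open>auto simp: env_def keeps_def\<close>)
  note loop = this
  define z where "z = Z ^ 2"
  have z: "Z ^ Suc 1 = z" "1 \<le> z" using Z_pos by (simp_all add: z_def power2_eq_square Suc_leI)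
  from run_mono[OF loop[unfolded z(1)]] show ?thesis
    using z(2) by (simp add: score_def run_Seq run_RAssign F_def flip: z_def)
qed

lemma run_answer:
  assumes "env s" "nvar s ''j'' < k" "nvar s ''H'' = H" "H < Z"
  defines "f \<equiv> \<lambda>b. \<Sum>i<\<kappa> (nvar s ''j''). \<Sum>a<H. T (narr s ''O'' i + narr s ''A'' a + nvar s ''yo'' + b * nvar s ''g'')"
  shows "run answer (\<lambda>t s'. t \<le> 90 * Z ^ 3 \<and> nvar s' ''ao'' = argm f (B (nvar s ''j'')) * nvar s ''g'') s"
proof -
  let ?s = "s\<lparr>nvar := (nvar s)(''bo'' := 0, ''ao'' := 0)\<rparr>"
  let ?g = "nvar s ''g''" and ?j = "nvar s ''j''"
  let ?upd = "If (And (Not (NLess (NVar ''b'') (NConst 1))) (Not (RLess (RVar ''best'') (RVar ''est''))))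
            Skip (Seq (RAssign ''best'' (RVar ''est'')) (NAssign ''ao'' (NVar ''bo'')))"
  let ?body = "Seq score (Seq ?upd (NAssign ''bo'' (NPlus (NVar ''bo'') (NVar ''g''))))"
  let ?loop = "loop ''b'' (NArr ''B'' (NVar ''j'')) ?body"
  \<comment> \<open>Before the first iteration \<open>best\<close> holds an arbitrary value; the
    conjunct guarded by \<open>0 < n\<close> matches the test on \<open>b\<close> in the
    program.\<close>
  let ?I = "\<lambda>n (s'::state). env s' \<and> nvar s' ''bo'' = n * ?g \<and> nvar s' ''ao'' = argm f n * ?g \<and>
      (0 < n \<longrightarrow> rvar s' ''best'' = f (argm f n))"
  have Z2: "1 \<le> Z ^ 2" using Z_pos by simp
  have B: "B ?j < Z"
  proof -
    have "1 * B ?j \<le> PB ?j * B ?j" using PB_pos[of ?j] assms(2) by (intro mult_right_mono) auto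
    then have "B ?j \<le> PB (Suc ?j)" by (simp add: PB_def)
    then show ?thesis using PB_le[of "Suc ?j"] Z(3) assms(2) by simp
  qed
  have "run ?loop (\<lambda>t s'. t \<le> (70 + 11) * Z ^ Suc 2 \<and> ?I (B ?j) s') ?s"
  proof (rule run_loop[where I = ?I])
    fix n s' assume n: "n < B ?j" and I: "?I n s'" "nvar s' ''b'' = n" and k: "keeps ?loop ?s s'"
    have same: "nvar s' ''j'' = ?j" "nvar s' ''H'' = H" "narr s' = narr s" "nvar s' ''yo'' = nvar s ''yo''" "nvar s' ''g'' = ?g"
      using k assms by (auto simp: keeps_def)
    have "run score (\<lambda>t s''. t \<le> 40 * Z ^ 2 \<and> rvar s'' ''est'' = f n) s'"
      using run_score[of s' H] I assms(2,4) unfolding same f_def by simp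
    then show "run ?body (\<lambda>t s''. t \<le> 70 * Z ^ 2 \<and> ?I (Suc n) (s''\<lparr>nvar := (nvar s'')(''b'' := Suc n)\<rparr>)) s'"
      unfolding run_Seq
    proof (rule run_mono)
      fix t s'' assume *: "t \<le> 40 * Z ^ 2 \<and> rvar s'' ''est'' = f n" "keeps score s' s''"
      then have "nvar s'' ''b'' = n" "nvar s'' ''bo'' = n * ?g" "nvar s'' ''g'' = ?g" 
        "nvar s'' ''ao'' = argm f n * ?g" "rvar s'' ''best'' = rvar s' ''best''" "rvar s'' ''est'' = f n"
        using I same by (auto simp: keeps_def)
      moreover have "env s''" using env_keeps[OF *(2)] I by simp
      ultimately show "run ?upd (\<lambda>u s''. run (NAssign ''bo'' (NPlus (NVar ''bo'') (NVar ''g''))) 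
         (\<lambda>ua s''. t + (u + ua) \<le> 70 * Z ^ 2 \<and> ?I (Suc n) (s''\<lparr>nvar := (nvar s'')(''b'' := Suc n)\<rparr>)) s'') s''"
        using * I Z2 by (auto simp: run_simps not_less simp del: one_le_power)
    qed
  next
    fix n s' assume "keeps ?loop ?s s'" "?I n s'"
    then show "nval (NArr ''B'' (NVar ''j'')) s' = B ?j"
      using assms by (auto simp: keeps_def env_def)
  qed (use assms(1-4) B in \<open>auto simp: env_def\<close>)
  note loop = this
  define z where "z = Z ^ 3"
  have z: "Z ^ Suc 2 = z" "1 \<le> z" using Z_pos by (simp_all add: z_def eval_nat_numeral Suc_leI)
  from run_mono[OF loop[unfolded z(1)]] show ?thesis
    using z(2) by (simp add: answer_def run_Seq run_NAssign flip: z_def)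
qed

lemma run_append_offsets:
  assumes "nvar s ''H'' = H" "H < Z"
  shows "run append_offsets (\<lambda>t s'. t \<le> 30 * Z ^ 1 \<and> map (narr s' ''D'') [0..<nvar s' ''h''] =
     map (narr s ''D'') [0..<nvar s ''h''] @ map (\<lambda>a. a + nvar s ''yo'' + nvar s ''ao'') (map (narr s ''A'') [0..<H])) s"
proof -
  let ?I = "\<lambda>n (s'::state). map (narr s' ''D'') [0..<nvar s' ''h''] =
     map (narr s ''D'') [0..<nvar s ''h''] @ map (\<lambda>a. a + nvar s ''yo'' + nvar s ''ao'') (map (narr s ''A'') [0..<n])"
  have "run append_offsets (\<lambda>t s'. t \<le> (14 + 11) * Z ^ Suc 0 \<and> ?I H s') s"
    unfolding append_offsets_def
  proof (rule run_loop[where I = ?I])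
    fix n s' assume n: "n < H" and I: "?I n s'" "nvar s' ''a'' = n"
      and k: "keeps (loop ''a'' (NVar ''H'') (Seq (NStore ''D'' (NVar ''h'')
        (NPlus (NPlus (NArr ''A'' (NVar ''a'')) (NVar ''yo'')) (NVar ''ao'')))
        (NAssign ''h'' (NPlus (NVar ''h'') (NConst 1))))) s s'"
    then have "nvar s' ''yo'' = nvar s ''yo''" "nvar s' ''ao'' = nvar s ''ao''" "narr s' ''A'' = narr s ''A''"
      by (simp_all add: keeps_def)
    then show "run (Seq (NStore ''D'' (NVar ''h'') (NPlus (NPlus (NArr ''A'' (NVar ''a'')) (NVar ''yo'')) (NVar ''ao'')))
        (NAssign ''h'' (NPlus (NVar ''h'') (NConst 1))))
      (\<lambda>t s''. t \<le> 14 * Z ^ 0 \<and> ?I (Suc n) (s''\<lparr>nvar := (nvar s'')(''a'' := Suc n)\<rparr>)) s'"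
      using I by (simp add: run_simps)
  qed (use assms in \<open>auto simp: keeps_def\<close>)
  then show ?thesis by (rule run_mono) simp
qed

lemma run_replies:
  assumes "env s" "nvar s ''j'' < k" "nvar s ''H'' = H" "H < Z" "nvar s ''g'' = N * PB (nvar s ''j'')"
  shows "run replies (\<lambda>t s'. t \<le> 150 * Z ^ 4 \<and> map (narr s' ''D'') [0..<nvar s' ''h''] =
     extend (nvar s ''j'') (narr s ''O'') (map (narr s ''A'') [0..<H])) s"
proof -
  let ?s = "s\<lparr>nvar := (nvar s)(''h'' := 0, ''yo'' := 0)\<rparr>"
  let ?j = "nvar s ''j''"
  let ?A = "map (narr s ''A'') [0..<H]"
  let ?R = "\<lambda>y. map (\<lambda>a. a + y * PY ?j + reply ?j (narr s ''O'') ?A y * (N * PB ?j)) ?A"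
  let ?body = "Seq answer (Seq append_offsets (NAssign ''yo'' (NPlus (NVar ''yo'') (NArr ''PY'' (NVar ''j'')))))"
  let ?loop = "loop ''i'' (NArr ''Y'' (NVar ''j'')) ?body"
  let ?I = "\<lambda>n (s'::state). env s' \<and> nvar s' ''yo'' = n * PY ?j \<and>
      map (narr s' ''D'') [0..<nvar s' ''h''] = concat (map ?R [0..<n])"
  have Z3: "1 \<le> Z ^ 3" "Z ^ 1 \<le> Z ^ 3" using Z_pos by (simp_all add: power_increasing self_le_power)
  have Y: "Y ?j < Z"
  proof -
    have "1 * Y ?j \<le> PY ?j * Y ?j" using PY_pos[of ?j] assms(2) by (intro mult_right_mono) auto
    then have "Y ?j \<le> PY (Suc ?j)" by (simp add: PY_def)
    then show ?thesis using PY_le[of "Suc ?j"] Z(2) assms(2) by simp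
  qed
  have reply: "argm (\<lambda>b. \<Sum>i<\<kappa> ?j. \<Sum>a<H. T (narr s ''O'' i + narr s ''A'' a + y * PY ?j + b * (N * PB ?j))) (B ?j)
      = reply ?j (narr s ''O'') ?A y" for y
    by (simp add: reply_def o_def interv_sum_list_conv_sum_set_nat atLeast0LessThan)
  have "run ?loop (\<lambda>t s'. t \<le> (130 + 11) * Z ^ Suc 3 \<and> ?I (Y ?j) s') ?s"
  proof (rule run_loop[where I = ?I])
    fix n s' assume n: "n < Y ?j" and I: "?I n s'" "nvar s' ''i'' = n" and k: "keeps ?loop ?s s'"
    have same: "nvar s' ''j'' = ?j" "nvar s' ''H'' = H" "narr s' ''A'' = narr s ''A''" "narr s' ''O'' = narr s ''O''"
       "nvar s' ''g'' = N * PB ?j"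
      using k assms by (auto simp: keeps_def)
    have "run answer (\<lambda>t s''. t \<le> 90 * Z ^ 3 \<and> nvar s'' ''ao'' = reply ?j (narr s ''O'') ?A n * (N * PB ?j)) s'"
      using run_answer[of s' H] I assms(2,4) unfolding same reply[symmetric] by simp
    then show "run ?body (\<lambda>t s''. t \<le> 130 * Z ^ 3 \<and> ?I (Suc n) (s''\<lparr>nvar := (nvar s'')(''i'' := Suc n)\<rparr>)) s'"
      unfolding run_Seq
    proof (rule run_mono)
      fix t s1 assume 1: "t \<le> 90 * Z ^ 3 \<and> nvar s1 ''ao'' = reply ?j (narr s ''O'') ?A n * (N * PB ?j)" "keeps answer s' s1"
      have same1: "nvar s1 ''j'' = ?j" "nvar s1 ''H'' = H" "narr s1 ''A'' = narr s ''A''" "nvar s1 ''h'' = nvar s' ''h''"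
         "narr s1 ''D'' = narr s' ''D''" "nvar s1 ''yo'' = n * PY ?j"
        using same 1(2) I by (auto simp: keeps_def)
      have env1: "env s1" using env_keeps[OF 1(2)] I by simp
      show "run append_offsets (\<lambda>u s''. run (NAssign ''yo'' (NPlus (NVar ''yo'') (NArr ''PY'' (NVar ''j''))))
         (\<lambda>ua s''. t + (u + ua) \<le> 130 * Z ^ 3 \<and> ?I (Suc n) (s''\<lparr>nvar := (nvar s'')(''i'' := Suc n)\<rparr>)) s'') s1"
      proof (rule run_mono[OF run_append_offsets[OF same1(2) assms(4)]])
        fix u s2 assume 2: "u \<le> 30 * Z ^ 1 \<and> map (narr s2 ''D'') [0..<nvar s2 ''h''] =
           map (narr s1 ''D'') [0..<nvar s1 ''h''] @ map (\<lambda>a. a + nvar s1 ''yo'' + nvar s1 ''ao'') (map (narr s1 ''A'') [0..<H])"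
          "keeps append_offsets s1 s2"
        have same2: "nvar s2 ''j'' = ?j" "nvar s2 ''yo'' = n * PY ?j"
          using same1 2(2) by (auto simp: keeps_def)
        have env2: "env s2" using env_keeps[OF 2(2)] env1 by simp
        then have "narr s2 ''PY'' ?j = PY ?j" using assms(2) by (simp add: env_def)
        moreover have "map (narr s2 ''D'') [0..<nvar s2 ''h''] = concat (map ?R [0..<Suc n])"
          using 2(1) 1(1) I unfolding same1 by simp
        ultimately show "run (NAssign ''yo'' (NPlus (NVar ''yo'') (NArr ''PY'' (NVar ''j''))))
         (\<lambda>ua s''. t + (u + ua) \<le> 130 * Z ^ 3 \<and> ?I (Suc n) (s''\<lparr>nvar := (nvar s'')(''i'' := Suc n)\<rparr>)) s2"
          using 1(1) 2(1) Z3 env2 same2 by (simp add: run_NAssign del: upt_Suc one_le_power power_one_right)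
      qed
    qed
  next
    fix n s' assume "keeps ?loop ?s s'" "?I n s'"
    then show "nval (NArr ''Y'' (NVar ''j'')) s' = Y ?j"
      using assms by (auto simp: keeps_def env_def)
  qed (use assms(1-4) Y in \<open>auto simp: env_def\<close>)
  note loop = this
  define z where "z = Z ^ 4"
  have z: "Z ^ Suc 3 = z" "1 \<le> z" using Z_pos by (simp_all add: z_def eval_nat_numeral Suc_leI)
  from run_mono[OF loop[unfolded z(1)]] show ?thesis
    using z(2) by (simp add: replies_def extend_def run_Seq run_NAssign del: upt_Suc flip: z_def)
qed

lemma run_copy_back:
  assumes "nvar s ''h'' < Z"
  shows "run copy_back (\<lambda>t s'. t \<le> 30 * Z ^ 1 \<and> nvar s' ''H'' = nvar s ''h'' \<and>
     map (narr s' ''A'') [0..<nvar s ''h''] = map (narr s ''D'') [0..<nvar s ''h'']) s"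
proof -
  let ?s = "s\<lparr>nvar := (nvar s)(''H'' := nvar s ''h'')\<rparr>"
  let ?I = "\<lambda>n (s'::state). map (narr s' ''A'') [0..<n] = map (narr s ''D'') [0..<n] \<and> nvar s' ''H'' = nvar s ''h''"
  have "run (loop ''a'' (NVar ''H'') (NStore ''A'' (NVar ''a'') (NArr ''D'' (NVar ''a''))))
     (\<lambda>t s'. t \<le> (4 + 11) * Z ^ Suc 0 \<and> ?I (nvar s ''h'') s') ?s"
    by (rule run_loop[where I = ?I]) (use assms in \<open>auto simp: run_simps keeps_def\<close>)
  from run_mono[OF this] show ?thesis
    using Z_pos by (simp add: copy_back_def run_Seq run_NAssign)
qed

text \<open>After \<open>draws\<close>, only the first \<open>\<kappa> j\<close> cells of
  \<open>O\<close> are known; the others may hold leftovers.\<close>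

lemma extend_cong:
  assumes "\<And>s. s < \<kappa> j \<Longrightarrow> w s = w' s"
  shows "extend j w A = extend j w' A"
  using assms by (simp add: extend_def reply_def)

lemma length_extend: "length (extend j w A) = Y j * length A"
  by (simp add: extend_def length_concat o_def sum_list_triv)

lemma run_stage:
  assumes "env s" "nvar s ''j'' = j" "j < k" "nvar s ''q'' = q" "q < Z" "map (narr s ''A'') [0..<nvar s ''H''] = A"
    "length A < Z" "Y j * length A < Z"
  shows "run stage (\<lambda>t s'. t \<le> 400 * Z ^ 4 \<and> nvar s' ''q'' = q div radix j ^ \<kappa> j \<and>
     map (narr s' ''A'') [0..<nvar s' ''H''] = extend j (\<lambda>i. advice_digit (q div radix j ^ i) j) A) s"
proof -
  let ?H = "nvar s ''H''"
  have H: "?H < Z" using assms(6,7) by auto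
  have env: "nvar s ''N'' = N" "narr s ''PB'' j = PB j" using assms(1,3) by (auto simp: env_def)
  have Z4: "1 \<le> Z ^ 4" "Z ^ 1 \<le> Z ^ 4" "Z ^ 2 \<le> Z ^ 4" using Z_pos by (simp_all add: power_increasing self_le_power)
  show ?thesis
    unfolding stage_def run_Seq
  proof (rule run_mono[OF run_mul[where Z = Z and b = "PB j"]])
    fix t1 s1 assume 1: "t1 \<le> 30 * Z \<and> nvar s1 ''z'' = nval (NVar ''N'') s * PB j"
      "keeps (mul (NVar ''N'') (NArr ''PB'' (NVar ''j''))) s s1"
    let ?s1 = "s1\<lparr>nvar := (nvar s1)(''g'' := nvar s1 ''z'')\<rparr>"
    have s1: "env ?s1" using env_keeps[OF 1(2)] assms(1) by simp
    have same1: "nvar ?s1 ''j'' = j" "nvar ?s1 ''q'' = q" "nvar ?s1 ''H'' = ?H" "narr ?s1 ''A'' = narr s ''A''" 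
      "nvar ?s1 ''g'' = N * PB j"
      using 1 assms env by (simp_all add: keeps_def)
    have "run draws (\<lambda>t s'. t \<le> 121 * Z ^ 2 \<and> nvar s' ''q'' = q div radix j ^ \<kappa> j \<and>
     (\<forall>i<\<kappa> j. narr s' ''O'' i = advice_digit (q div radix j ^ i) j)) ?s1"
      using run_draws[OF s1] unfolding same1 using assms(3,5) by simp
    then have "run draws (\<lambda>t2. run replies (\<lambda>t3. run copy_back (\<lambda>t4 s'. t1 + (2 + (t2 + (t3 + t4))) \<le> 400 * Z ^ 4 \<and>
       nvar s' ''q'' = q div radix j ^ \<kappa> j \<and>
       map (narr s' ''A'') [0..<nvar s' ''H''] = extend j (\<lambda>i. advice_digit (q div radix j ^ i) j) A))) ?s1"
    proof (rule run_mono)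
      fix t2 s2 assume 2: "t2 \<le> 121 * Z ^ 2 \<and> nvar s2 ''q'' = q div radix j ^ \<kappa> j \<and>
        (\<forall>i<\<kappa> j. narr s2 ''O'' i = advice_digit (q div radix j ^ i) j)" "keeps draws ?s1 s2"
      have s2: "env s2" using env_keeps[OF 2(2)] s1 by simp
      have same2: "nvar s2 ''j'' = j" "nvar s2 ''H'' = ?H" "narr s2 ''A'' = narr s ''A''" 
        "nvar s2 ''g'' = N * PB j"
        using 2(2) same1 by (auto simp: keeps_def)
      have ext: "extend j (narr s2 ''O'') A = extend j (\<lambda>i. advice_digit (q div radix j ^ i) j) A"
        using 2(1) by (intro extend_cong) auto
      have "run replies (\<lambda>t s'. t \<le> 150 * Z ^ 4 \<and> map (narr s' ''D'') [0..<nvar s' ''h''] =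
         extend j (\<lambda>i. advice_digit (q div radix j ^ i) j) A) s2"
        using run_replies[OF s2 _ same2(2) H] unfolding same2 assms(6) ext using assms(3) by simp
      then show "run replies (\<lambda>t3. run copy_back (\<lambda>t4 s'. t1 + (2 + (t2 + (t3 + t4))) \<le> 400 * Z ^ 4 \<and>
       nvar s' ''q'' = q div radix j ^ \<kappa> j \<and>
       map (narr s' ''A'') [0..<nvar s' ''H''] = extend j (\<lambda>i. advice_digit (q div radix j ^ i) j) A)) s2"
      proof (rule run_mono)
        fix t3 s3 assume 3: "t3 \<le> 150 * Z ^ 4 \<and> map (narr s3 ''D'') [0..<nvar s3 ''h''] =
          extend j (\<lambda>i. advice_digit (q div radix j ^ i) j) A" "keeps replies s2 s3"
        have q: "nvar s3 ''q'' = q div radix j ^ \<kappa> j" using 2(1) 3(2) by (simp add: keeps_def)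
        have "nvar s3 ''h'' = Y j * length A" using arg_cong[OF conjunct2[OF 3(1)], of length] by (simp add: length_extend)
        then have "nvar s3 ''h'' < Z" using assms(8) by simp
        from run_copy_back[OF this]
        show "run copy_back (\<lambda>t4 s'. t1 + (2 + (t2 + (t3 + t4))) \<le> 400 * Z ^ 4 \<and>
           nvar s' ''q'' = q div radix j ^ \<kappa> j \<and>
           map (narr s' ''A'') [0..<nvar s' ''H''] = extend j (\<lambda>i. advice_digit (q div radix j ^ i) j) A) s3"
        proof (rule run_mono)
          fix t4 s4 assume 4: "t4 \<le> 30 * Z ^ 1 \<and> nvar s4 ''H'' = nvar s3 ''h'' \<and>
             map (narr s4 ''A'') [0..<nvar s3 ''h''] = map (narr s3 ''D'') [0..<nvar s3 ''h'']" "keeps copy_back s3 s4"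
          have "nvar s4 ''q'' = q div radix j ^ \<kappa> j" using q 4(2) by (simp add: keeps_def)
          moreover have "t1 + (2 + (t2 + (t3 + t4))) \<le> 400 * Z ^ 4"
            using 1(1) 2(1) 3(1) 4(1) Z4 unfolding power_one_right by linarith
          ultimately show "t1 + (2 + (t2 + (t3 + t4))) \<le> 400 * Z ^ 4 \<and>
           nvar s4 ''q'' = q div radix j ^ \<kappa> j \<and>
           map (narr s4 ''A'') [0..<nvar s4 ''H''] = extend j (\<lambda>i. advice_digit (q div radix j ^ i) j) A"
            using 4(1) 3(1) by simp
        qed
      qed
    qed
    then show "run (NAssign ''g'' (NVar ''z'')) (\<lambda>t'. run draws (\<lambda>t2. run replies (\<lambda>t3. run copy_back
       (\<lambda>t4 s'. t1 + (t' + (t2 + (t3 + t4))) \<le> 400 * Z ^ 4 \<and>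
       nvar s' ''q'' = q div radix j ^ \<kappa> j \<and>
       map (narr s' ''A'') [0..<nvar s' ''H''] = extend j (\<lambda>i. advice_digit (q div radix j ^ i) j) A)))) s1"
      by (simp add: run_NAssign)
  qed (use assms env Z in simp_all)
qed

end

context ram_game
begin

lemma prod_Icc_le_N: "j \<le> k \<Longrightarrow> (\<Prod>i\<in>{j..<k}. Y i) \<le> N"
  using PY_dvd[of j] N_pos by (metis dvd_triv_right dvd_imp_le)

lemma run_stages:
  assumes "env s" "nvar s ''q'' = adv" "adv < Z"
  shows "run stages (\<lambda>t s'. t \<le> 420 * Z ^ 5 \<and> nvar s' ''q'' = adv div M \<and>
     map (narr s' ''A'') [0..<nvar s' ''H''] = high (samples adv) k) s"
proof -
  let ?s = "s\<lparr>narr := (narr s)(''A'' := (narr s ''A'')(0 := 0)), nvar := (nvar s)(''H'' := 1, ''j'' := k)\<rparr>"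
  \<comment> \<open>The digits of the last \<open>n\<close> players have been consumed. For player
    \<open>k - Suc n\<close> this quotient is exactly the number \<open>rest\<close> from which
    \<open>samples\<close> reads.\<close>
  let ?Q = "\<lambda>n. adv div (\<Prod>i\<in>{k-n..<k}. radix i ^ \<kappa> i)"
  let ?I = "\<lambda>n (s'::state). env s' \<and> nvar s' ''j'' = k - n \<and> nvar s' ''q'' = ?Q n \<and>
     map (narr s' ''A'') [0..<nvar s' ''H''] = high (samples adv) n"
  let ?body = "Seq (NAssign ''j'' (NMinus (NVar ''j'') (NConst 1))) stage"
  let ?loop = "While (NLess (NConst 0) (NVar ''j'')) ?body"
  have Z4: "1 \<le> Z ^ 4" using Z_pos by (simp add: Suc_leI)
  have "run ?loop (\<lambda>t s'. t \<le> (404 + 5) * Z ^ Suc 4 \<and> ?I k s') ?s"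
  proof (rule run_while[where I = ?I])
    show "?I 0 ?s" using assms by (auto simp: env_def)
  next
    fix n s' assume n: "n < k" and I: "?I n s'" and "keeps ?loop ?s s'"
    let ?j = "k - Suc n"
    let ?s' = "s'\<lparr>nvar := (nvar s')(''j'' := ?j)\<rparr>"
    have ins: "{?j..<k} = insert ?j {k - n..<k}" and gt: "{?j<..<k} = {k - n..<k}" using n by auto
    have len: "length (high (samples adv) n) < Z"
      using length_high[of n] prod_Icc_le_N[of "k - n"] Z(2) n by simp
    have len': "Y ?j * length (high (samples adv) n) < Z"
      using length_high[of "Suc n"] prod_Icc_le_N[of ?j] Z(2) n by (simp add: length_extend)
    have q: "?Q n < Z" using assms(3) div_le_dividend le_less_trans by blast
    have "run stage (\<lambda>t s''. t \<le> 400 * Z ^ 4 \<and> nvar s'' ''q'' = ?Q n div radix ?j ^ \<kappa> ?j \<and>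
       map (narr s'' ''A'') [0..<nvar s'' ''H''] =
         extend ?j (\<lambda>i. advice_digit (?Q n div radix ?j ^ i) ?j) (high (samples adv) n)) ?s'"
      using I n by (intro run_stage q len len') auto
    moreover have "?Q n div radix ?j ^ \<kappa> ?j = ?Q (Suc n)"
      unfolding ins by (subst prod.insert) (use n in \<open>auto simp: mult.commute[of "radix ?j ^ \<kappa> ?j"] div_mult2_eq\<close>)
    moreover have "extend ?j (\<lambda>i. advice_digit (?Q n div radix ?j ^ i) ?j) (high (samples adv) n)
       = high (samples adv) (Suc n)"
      by (simp add: samples_def[abs_def] rest_def gt)
    ultimately have st: "run stage (\<lambda>t s''. t \<le> 400 * Z ^ 4 \<and> nvar s'' ''q'' = ?Q (Suc n) \<and>
       map (narr s'' ''A'') [0..<nvar s'' ''H''] = high (samples adv) (Suc n)) ?s'"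
      by (simp only:)
    have "run stage (\<lambda>t s''. Suc (Suc (Suc (Suc t))) \<le> 404 * Z ^ 4 \<and> ?I (Suc n) s'') ?s'"
    proof (rule run_mono[OF st])
      fix t s'' assume *: "t \<le> 400 * Z ^ 4 \<and> nvar s'' ''q'' = ?Q (Suc n) \<and>
         map (narr s'' ''A'') [0..<nvar s'' ''H''] = high (samples adv) (Suc n)" "keeps stage ?s' s''"
      have "env s''" using env_keeps[OF *(2)] I by simp
      moreover have "nvar s'' ''j'' = ?j" using *(2) by (simp add: keeps_def)
      moreover have "Suc (Suc (Suc (Suc t))) \<le> 404 * Z ^ 4" using *(1) Z4 by linarith
      ultimately show "Suc (Suc (Suc (Suc t))) \<le> 404 * Z ^ 4 \<and> ?I (Suc n) s''" using *(1) by blast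
    qed
    then show "bval (NLess (NConst 0) (NVar ''j'')) s' \<and> run ?body (\<lambda>t s''. t \<le> 404 * Z ^ 4 \<and> ?I (Suc n) s'') s'"
      using I n by (simp add: run_Seq run_NAssign del: high.simps)
  qed (use Z in auto)
  note loop = this
  define z where "z = Z ^ 5"
  have z: "Z ^ Suc 4 = z" "1 \<le> z" using Z_pos by (simp_all add: z_def eval_nat_numeral Suc_leI)
  have "run ?loop (\<lambda>t s'. Suc (Suc (Suc (Suc (Suc (Suc (Suc t)))))) \<le> 420 * z \<and> nvar s' ''q'' = adv div M \<and>
     map (narr s' ''A'') [0..<nvar s' ''H''] = high (samples adv) k) ?s"
    by (rule run_mono[OF loop[unfolded z(1)]]) (use z(2) in \<open>simp add: M_def lessThan_atLeast0\<close>)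
  moreover have "nvar s ''k'' = k" using assms(1) by (simp add: env_def)
  ultimately show ?thesis
    by (simp add: stages_def run_Seq run_NAssign run_NStore flip: z_def)
qed

lemma run_evaluate:
  assumes "env s" "map (narr s ''A'') [0..<nvar s ''H''] = high \<sigma> k"
  shows "run evaluate (\<lambda>t s'. t \<le> 40 * Z ^ 1 \<and> rvar s' ''out'' = max (rvar s ''out'') (outcome \<sigma>)) s"
proof -
  let ?s = "s\<lparr>rvar := (rvar s)(''est'' := 0)\<rparr>"
  let ?loop = "loop ''a'' (NVar ''H'') (RAssign ''est'' (RPlus (RVar ''est'') (RArr ''V'' (NArr ''A'' (NVar ''a'')))))"
  let ?H = "nvar s ''H''"
  define F where "F a = T (narr s ''A'' a)" for a
  have V: "rarr s ''V'' = T" "nvar s ''N'' = N" using assms(1) by (simp_all add: env_def)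
  have "?H = length (high \<sigma> k)" using arg_cong[OF assms(2), of length] by simp
  then have H: "?H < Z" using length_high[of k \<sigma>] prod_Icc_le_N[of 0] Z(2) by simp
  have out: "(\<Sum>a<?H. F a) / N = outcome \<sigma>"
    unfolding outcome_def assms(2)[symmetric] F_def
    by (simp add: o_def interv_sum_list_conv_sum_set_nat atLeast0LessThan)
  have "run ?loop (\<lambda>t s'. t \<le> (7 + 11) * Z ^ Suc 0 \<and> rvar s' ''est'' = (\<Sum>a<?H. F a)) ?s"
    by (rule run_loop[where I = "\<lambda>n s'. rvar s' ''est'' = (\<Sum>a<n. F a)"])
       (use V H in \<open>auto simp: run_simps keeps_def F_def\<close>)
  then have "run ?loop (\<lambda>t. run (Seq (RAssign ''est'' (RDiv (RVar ''est'') (NVar ''N'')))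
        (If (RLess (RVar ''out'') (RVar ''est'')) (RAssign ''out'' (RVar ''est'')) Skip))
       (\<lambda>u s'. Suc (Suc (Suc (t + u))) \<le> 40 * Z ^ 1 \<and> rvar s' ''out'' = max (rvar s ''out'') (outcome \<sigma>))) ?s"
  proof (rule run_mono)
    fix t s' assume *: "t \<le> (7 + 11) * Z ^ Suc 0 \<and> rvar s' ''est'' = (\<Sum>a<?H. F a)" "keeps ?loop ?s s'"
    then have "nvar s' ''N'' = N" "rvar s' ''out'' = rvar s ''out''" using V by (simp_all add: keeps_def)
    then show "run (Seq (RAssign ''est'' (RDiv (RVar ''est'') (NVar ''N'')))
        (If (RLess (RVar ''out'') (RVar ''est'')) (RAssign ''out'' (RVar ''est'')) Skip))
       (\<lambda>u s'. Suc (Suc (Suc (t + u))) \<le> 40 * Z ^ 1 \<and> rvar s' ''out'' = max (rvar s ''out'') (outcome \<sigma>)) s'"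
      using * Z_pos by (simp add: run_simps out max_def)
  qed
  then show ?thesis
    unfolding evaluate_def run_Seq[of "RAssign ''est'' (RNat (NConst 0))"] run_Seq[of ?loop]
    by (simp add: run_RAssign)
qed

lemma M_pos: "0 < M"
  using PY_pos PB_pos by (auto simp: M_def radix_def intro!: prod_pos)

text \<open>The output is 0 or the outcome of some advice, neither of which exceeds the game value,
  and it is at least the outcome of each advice below \<open>M\<close>. The search also runs the
  number \<open>M\<close> itself, whose remainder 1 stops it; hence the assumption
  \<open>Suc M < Z\<close>. The exponent 6 is the nesting depth: advices, players, questions,
  answers, samples and list entries.\<close>

lemma run_search:
  assumes "env s"
  shows "run search (\<lambda>t s'. t \<le> 500 * Z ^ 6 \<and>
    (rvar s' ''out'' = 0 \<or> (\<exists>a. rvar s' ''out'' = outcome (samples a))) \<and>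
    (\<forall>a<M. outcome (samples a) \<le> rvar s' ''out'')) s"
proof -
  let ?s = "s\<lparr>rvar := (rvar s)(''out'' := 0), nvar := (nvar s)(''q'' := 0, ''adv'' := 0)\<rparr>"
  \<comment> \<open>After \<open>n\<close> rounds the last number tried is \<open>n - 1\<close>.
    Truncated subtraction makes the formula agree with the initial \<open>q = 0\<close>, and the
    quotient becomes 1 exactly at \<open>n = Suc M\<close>.\<close>
  let ?I = "\<lambda>n (s'::state). env s' \<and> nvar s' ''adv'' = n \<and> nvar s' ''q'' = (n - 1) div M \<and>
     (rvar s' ''out'' = 0 \<or> (\<exists>a. rvar s' ''out'' = outcome (samples a))) \<and>
     (\<forall>a<n. outcome (samples a) \<le> rvar s' ''out'')"
  let ?body = "Seq (NAssign ''q'' (NVar ''adv''))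
        (Seq (NAssign ''adv'' (NPlus (NVar ''adv'') (NConst 1))) (Seq stages evaluate))"
  let ?loop = "While (NLess (NVar ''q'') (NConst 1)) ?body"
  have Z5: "1 \<le> Z ^ 5" "Z ^ 1 \<le> Z ^ 5" using Z_pos by (simp_all add: Suc_leI self_le_power)
  have "run ?loop (\<lambda>t s'. t \<le> (470 + 5) * Z ^ Suc 5 \<and> ?I (Suc M) s') ?s"
  proof (rule run_while[where I = ?I])
    show "?I 0 ?s" using assms by (auto simp: env_def)
  next
    fix n s' assume n: "n < Suc M" and I: "?I n s'"
    let ?s' = "s'\<lparr>nvar := (nvar s')(''q'' := n, ''adv'' := Suc n)\<rparr>"
    have env': "env ?s'" using I by (auto simp: env_def)
    have "run stages (\<lambda>t s'. t \<le> 420 * Z ^ 5 \<and> nvar s' ''q'' = n div M \<and>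
     map (narr s' ''A'') [0..<nvar s' ''H''] = high (samples n) k) ?s'"
      by (rule run_stages[OF env']) (use n Z(4) in auto)
    then have "run stages (\<lambda>t. run evaluate (\<lambda>u s''. Suc (Suc (Suc (Suc (Suc (Suc (t + u)))))) \<le> 470 * Z ^ 5 \<and> ?I (Suc n) s'')) ?s'"
    proof (rule run_mono)
      fix t s1 assume 1: "t \<le> 420 * Z ^ 5 \<and> nvar s1 ''q'' = n div M \<and>
         map (narr s1 ''A'') [0..<nvar s1 ''H''] = high (samples n) k" "keeps stages ?s' s1"
      have env1: "env s1" using env_keeps[OF 1(2) env'] by simp
      have same1: "nvar s1 ''adv'' = Suc n" "rvar s1 ''out'' = rvar s' ''out''" using 1(2) by (simp_all add: keeps_def)
      show "run evaluate (\<lambda>u s''. Suc (Suc (Suc (Suc (Suc (Suc (t + u)))))) \<le> 470 * Z ^ 5 \<and> ?I (Suc n) s'') s1"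
      proof (rule run_mono[OF run_evaluate[OF env1, of "samples n"]])
        fix u s2 assume 2: "u \<le> 40 * Z ^ 1 \<and> rvar s2 ''out'' = max (rvar s1 ''out'') (outcome (samples n))"
          "keeps evaluate s1 s2"
        have "env s2" using env_keeps[OF 2(2) env1] by simp
        moreover have "nvar s2 ''adv'' = Suc n" "nvar s2 ''q'' = n div M"
          using 2(2) 1(1) same1 by (simp_all add: keeps_def)
        moreover have "Suc (Suc (Suc (Suc (Suc (Suc (t + u)))))) \<le> 470 * Z ^ 5" using 1(1) 2(1) Z5 by linarith
        moreover have "rvar s2 ''out'' = max (rvar s' ''out'') (outcome (samples n))" using 2(1) same1 by simp
        ultimately show "Suc (Suc (Suc (Suc (Suc (Suc (t + u)))))) \<le> 470 * Z ^ 5 \<and> ?I (Suc n) s2"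
          using I by (auto simp: max_def less_Suc_eq)
      qed (use 1 in simp)
    qed
    then show "bval (NLess (NVar ''q'') (NConst 1)) s' \<and> run ?body (\<lambda>t s''. t \<le> 470 * Z ^ 5 \<and> ?I (Suc n) s'') s'"
      using I n M_pos by (simp add: run_Seq run_NAssign div_less)
  next
    fix s' assume "?I (Suc M) s'"
    then show "\<not> bval (NLess (NVar ''q'') (NConst 1)) s'" using M_pos by simp
  qed (use Z in auto)
  note loop = this
  define z where "z = Z ^ 6"
  have z: "Z ^ Suc 5 = z" "1 \<le> z" using Z_pos by (simp_all add: z_def eval_nat_numeral Suc_leI)
  have "run ?loop (\<lambda>t s'. Suc (Suc (Suc (Suc (Suc (Suc (Suc t)))))) \<le> 500 * z \<and> 
    (rvar s' ''out'' = 0 \<or> (\<exists>a. rvar s' ''out'' = outcome (samples a))) \<and>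
    (\<forall>a<M. outcome (samples a) \<le> rvar s' ''out'')) ?s"
    by (rule run_mono[OF loop[unfolded z(1)]]) (use z(2) in auto)
  then show ?thesis
    by (simp add: search_def run_Seq run_NAssign run_RAssign flip: z_def)
qed

end

section \<open>Preprocessing: sample counts and place values\<close>

definition ceiling_log :: "nat \<Rightarrow> nat" where
  "ceiling_log b = (LEAST l. b \<le> 2 ^ l)"

lemma ceiling_log_upper: "b \<le> 2 ^ ceiling_log b"
  unfolding ceiling_log_def by (rule LeastI[of _ b]) (simp add: less_imp_le)

lemma ceiling_log_lower: "i < ceiling_log b \<Longrightarrow> 2 ^ i < b"
  unfolding ceiling_log_def by (metis not_less_Least not_le)

lemma ceiling_log_le: "ceiling_log b \<le> b"
  unfolding ceiling_log_def by (rule Least_le) (simp add: less_imp_le)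

text \<open>Reals cannot be rounded, so \<open>m\<close> counts how many copies of
  \<open>eps\<close> have to be added to reach \<open>k\<close>; the count is the ceiling of the
  quotient.\<close>

definition compute_ceiling :: com where
  "compute_ceiling = Seq (NAssign ''m'' (NConst 0)) (Seq (RAssign ''acc'' (RNat (NConst 0)))
     (While (RLess (RVar ''acc'') (RNat (NVar ''k'')))
       (Seq (RAssign ''acc'' (RPlus (RVar ''acc'') (RVar ''eps''))) (NAssign ''m'' (NPlus (NVar ''m'') (NConst 1))))))"

lemma vars_compute_ceiling [simp]: "nvars compute_ceiling = {''m''}" "narrs compute_ceiling = {}"
  "rvars compute_ceiling = {''acc''}" "rarrs compute_ceiling = {}"
  by (auto simp: compute_ceiling_def)

lemma run_compute_ceiling:
  assumes "rvar s ''eps'' = \<epsilon>" "0 < \<epsilon>" "nvar s ''k'' = k" "nat \<lceil>real k / \<epsilon>\<rceil> < Z"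
  shows "run compute_ceiling (\<lambda>t s'. t \<le> 30 * Z \<and> nvar s' ''m'' = nat \<lceil>real k / \<epsilon>\<rceil>) s"
proof -
  let ?s = "s\<lparr>nvar := (nvar s)(''m'' := 0), rvar := (rvar s)(''acc'' := 0)\<rparr>"
  let ?I = "\<lambda>n (s'::state). nvar s' ''m'' = n \<and> rvar s' ''acc'' = real n * \<epsilon> \<and> nvar s' ''k'' = k \<and> rvar s' ''eps'' = \<epsilon>"
  let ?n = "nat \<lceil>real k / \<epsilon>\<rceil>"
  let ?loop = "While (RLess (RVar ''acc'') (RNat (NVar ''k'')))
       (Seq (RAssign ''acc'' (RPlus (RVar ''acc'') (RVar ''eps''))) (NAssign ''m'' (NPlus (NVar ''m'') (NConst 1))))"
  have lt: "real i * \<epsilon> < real k" if "i < ?n" for i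
  proof -
    have "real i < real k / \<epsilon>" using that by linarith
    then show ?thesis using assms(2) by (simp add: field_simps)
  qed
  have ge: "real k \<le> real ?n * \<epsilon>"
  proof -
    have "real k / \<epsilon> \<le> real ?n" by linarith
    then show ?thesis using assms(2) by (simp only: pos_divide_le_eq)
  qed
  have "run ?loop (\<lambda>t s'. t \<le> (8 + 5) * Z ^ Suc 0 \<and> ?I ?n s') ?s"
    by (rule run_while[where I = ?I]) (use assms lt ge in \<open>auto simp: run_simps algebra_simps\<close>)
  from run_mono[OF this] show ?thesis
    using assms(4) by (simp add: compute_ceiling_def run_Seq run_NAssign run_RAssign)
qed

text \<open>Doubling stands in for the logarithm. The result is at least \<open>ln b\<close> and,
  when \<open>b\<close> is at least 2, at most \<open>3 * ln b\<close>, so the number of samples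
  suffices and is right up to a constant.\<close>

definition compute_log :: com where
  "compute_log = Seq (NAssign ''p'' (NConst 1)) (Seq (NAssign ''l'' (NConst 0))
     (While (NLess (NVar ''p'') (NArr ''B'' (NVar ''j'')))
       (Seq (NAssign ''p'' (NPlus (NVar ''p'') (NVar ''p''))) (NAssign ''l'' (NPlus (NVar ''l'') (NConst 1))))))"

lemma vars_compute_log [simp]: "nvars compute_log = {''p'', ''l''}" "narrs compute_log = {}"
  "rvars compute_log = {}" "rarrs compute_log = {}"
  by (auto simp: compute_log_def)

lemma run_compute_log:
  assumes "narr s ''B'' (nvar s ''j'') = b" "b < Z"
  shows "run compute_log (\<lambda>t s'. t \<le> 30 * Z \<and> nvar s' ''l'' = ceiling_log b) s"
proof -
  let ?s = "s\<lparr>nvar := (nvar s)(''p'' := 1, ''l'' := 0)\<rparr>"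
  let ?I = "\<lambda>n (s'::state). nvar s' ''p'' = 2 ^ n \<and> nvar s' ''l'' = n \<and> narr s' ''B'' (nvar s' ''j'') = b"
  let ?loop = "While (NLess (NVar ''p'') (NArr ''B'' (NVar ''j'')))
       (Seq (NAssign ''p'' (NPlus (NVar ''p'') (NVar ''p''))) (NAssign ''l'' (NPlus (NVar ''l'') (NConst 1))))"
  have "ceiling_log b < Z" using ceiling_log_le[of b] assms(2) by simp
  then have "run ?loop (\<lambda>t s'. t \<le> (8 + 5) * Z ^ Suc 0 \<and> ?I (ceiling_log b) s') ?s"
    by (intro run_while[where I = ?I])
       (use assms ceiling_log_lower[of _ b] ceiling_log_upper[of b] in \<open>auto simp: run_simps not_less\<close>)
  from run_mono[OF this] show ?thesis
    using assms(2) by (simp add: compute_log_def run_Seq run_NAssign)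
qed

definition prepare_player :: com where
  "prepare_player = Seq (mul (NArr ''PY'' (NVar ''j'')) (NArr ''Y'' (NVar ''j'')))
     (Seq (NStore ''PY'' (NPlus (NVar ''j'') (NConst 1)) (NVar ''z''))
     (Seq (mul (NArr ''PB'' (NVar ''j'')) (NArr ''B'' (NVar ''j'')))
     (Seq (NStore ''PB'' (NPlus (NVar ''j'') (NConst 1)) (NVar ''z''))
     (Seq compute_log (Seq (mul (NVar ''mm'') (NVar ''l'')) (NStore ''K'' (NVar ''j'') (NVar ''z'')))))))"

lemma vars_prepare_player [simp]: "nvars prepare_player = {''x'', ''y'', ''z'', ''c'', ''p'', ''l''}"
  "narrs prepare_player = {''PY'', ''PB'', ''K''}" "rvars prepare_player = {}" "rarrs prepare_player = {}"
  by (auto simp: prepare_player_def)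

definition prepare :: com where
  "prepare = Seq (NStore ''PY'' (NConst 0) (NConst 1)) (Seq (NStore ''PB'' (NConst 0) (NConst 1))
     (Seq (loop ''j'' (NVar ''k'') prepare_player) (NAssign ''N'' (NArr ''PY'' (NVar ''k'')))))"

text \<open>Values lie in the unit interval, so 0 is accurate enough once \<open>eps\<close> is at
  least 1. Otherwise the loss \<open>eps / k\<close> per player is at most 1, as the sampling bound
  demands, and rounding \<open>k / eps\<close> up at most doubles it. The four summands in
  \<open>mm\<close> are the factor 4 of the sampling bound.\<close>

definition approximate_value :: com where
  "approximate_value = If (RLess (RVar ''eps'') (RNat (NConst 1)))
     (Seq compute_ceiling (Seq (mul (NVar ''m'') (NVar ''m''))
       (Seq (NAssign ''mm'' (NPlus (NPlus (NVar ''z'') (NVar ''z'')) (NPlus (NVar ''z'') (NVar ''z''))))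
       (Seq prepare search))))
     (RAssign ''out'' (RNat (NConst 0)))"

locale prepared_game = ram_game +
  fixes mm :: nat
  assumes mm: "mm < Z" "\<And>j. \<kappa> j = mm * ceiling_log (B j)"
begin

definition raw :: "state \<Rightarrow> bool" where
  "raw s \<longleftrightarrow> nvar s ''k'' = k \<and> nvar s ''mm'' = mm \<and>
     (\<forall>i<k. narr s ''Y'' i = Y i \<and> narr s ''B'' i = B i) \<and> rarr s ''V'' = T"

lemma run_prepare_player:
  assumes "raw s" "nvar s ''j'' = j" "j < k" "narr s ''PY'' j = PY j" "narr s ''PB'' j = PB j"
  shows "run prepare_player (\<lambda>t s'. t \<le> 140 * Z ^ 1 \<and> narr s' ''PY'' = (narr s ''PY'')(Suc j := PY (Suc j)) \<and>
     narr s' ''PB'' = (narr s ''PB'')(Suc j := PB (Suc j)) \<and> narr s' ''K'' = (narr s ''K'')(j := \<kappa> j)) s"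
proof -
  have "1 * B j \<le> PB j * B j" using PB_pos[of j] assms(3) by (intro mult_right_mono) auto
  then have "B j \<le> PB (Suc j)" by (simp add: PB_def)
  then have B: "B j < Z" using PB_le[of "Suc j"] Z(3) assms(3) by simp
  have P: "PY j < Z" "PB j < Z" using PY_le[of j] PB_le[of j] Z assms(3) by auto
  have PS: "PY (Suc j) = PY j * Y j" "PB (Suc j) = PB j * B j" by (simp_all add: PY_def PB_def)
  note e = assms[unfolded raw_def]
  show ?thesis
    unfolding prepare_player_def run_Seq run_NStore
    apply (rule run_mono[OF run_mul[where Z = Z and b = "Y j"]])
        apply (use e P in simp_all)[4]
    subgoal for t1 s1
      apply (rule run_mono[OF run_mul[where Z = Z and b = "B j"]])
          apply (use e P in \<open>simp_all add: keeps_def\<close>)[4]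
      subgoal for t2 s2
        apply (rule run_mono[OF run_compute_log[where Z = Z and b = "B j"]])
          apply (use e B in \<open>simp_all add: keeps_def\<close>)[2]
        subgoal for t3 s3
          apply (rule run_mono[OF run_mul[where Z = Z and b = "ceiling_log (B j)"]])
              apply (use e mm in \<open>simp_all add: keeps_def\<close>)[4]
          subgoal for t4 s4
            using e Z_pos PS mm by (simp add: keeps_def)
          done
        done
      done
    done
qed

lemma run_prepare:
  assumes "raw s"
  shows "run prepare (\<lambda>t s'. t \<le> 170 * Z ^ 2 \<and> env s') s"
proof -
  let ?s = "s\<lparr>narr := (narr s)(''PY'' := (narr s ''PY'')(0 := 1), ''PB'' := (narr s ''PB'')(0 := 1))\<rparr>"
  let ?loop = "loop ''j'' (NVar ''k'') prepare_player"
  let ?I = "\<lambda>n (s'::state). raw s' \<and> (\<forall>i\<le>n. narr s' ''PY'' i = PY i \<and> narr s' ''PB'' i = PB i) \<and>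
      (\<forall>i<n. narr s' ''K'' i = \<kappa> i)"
  have "run ?loop (\<lambda>t s'. t \<le> (140 + 11) * Z ^ Suc 1 \<and> ?I k s') ?s"
  proof (rule run_loop[where I = ?I])
    show "?I 0 (?s\<lparr>nvar := (nvar ?s)(''j'' := 0)\<rparr>)"
      using assms by (simp add: raw_def PY_def PB_def)
  next
    fix n s' assume n: "n < k" and I: "?I n s'" "nvar s' ''j'' = n"
    show "run prepare_player (\<lambda>t s''. t \<le> 140 * Z ^ 1 \<and> ?I (Suc n) (s''\<lparr>nvar := (nvar s'')(''j'' := Suc n)\<rparr>)) s'"
    proof (rule run_mono[OF run_prepare_player[of s' n]])
      fix t s'' assume *: "t \<le> 140 * Z ^ 1 \<and> narr s'' ''PY'' = (narr s' ''PY'')(Suc n := PY (Suc n)) \<and>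
        narr s'' ''PB'' = (narr s' ''PB'')(Suc n := PB (Suc n)) \<and> narr s'' ''K'' = (narr s' ''K'')(n := \<kappa> n)"
        "keeps prepare_player s' s''"
      have "raw s''" using I * by (simp add: raw_def keeps_def)
      then show "t \<le> 140 * Z ^ 1 \<and> ?I (Suc n) (s''\<lparr>nvar := (nvar s'')(''j'' := Suc n)\<rparr>)"
        using I * by (auto simp: raw_def le_Suc_eq less_Suc_eq)
    qed (use I n in auto)
  qed (use assms Z in \<open>auto simp: raw_def keeps_def\<close>)
  note loop = this
  define z where "z = Z ^ 2"
  have z: "Z ^ Suc 1 = z" "1 \<le> z" using Z_pos by (simp_all add: z_def power2_eq_square Suc_leI)
  from run_mono[OF loop[unfolded z(1)]] show ?thesis
    using z(2) by (simp add: prepare_def run_Seq run_NAssign run_NStore raw_def env_def N_def flip: z_def)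
qed

lemma run_approximate:
  assumes s: "nvar s ''k'' = k" "\<And>i. i < k \<Longrightarrow> narr s ''Y'' i = Y i \<and> narr s ''B'' i = B i" "rarr s ''V'' = T"
    "rvar s ''eps'' = \<epsilon>"
    and \<epsilon>: "0 < \<epsilon>" "\<epsilon> < 1"
    and m: "m = nat \<lceil>real k / \<epsilon>\<rceil>" "m < Z" "mm = 4 * (m * m)"
  shows "run approximate_value (\<lambda>t s'. t \<le> 1000 * Z ^ 6 \<and>
    (rvar s' ''out'' = 0 \<or> (\<exists>a. rvar s' ''out'' = outcome (samples a))) \<and>
    (\<forall>a<M. outcome (samples a) \<le> rvar s' ''out'')) s"
proof -
  have Z6: "1 \<le> Z ^ 6" "Z \<le> Z ^ 6" "Z ^ 2 \<le> Z ^ 6"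
    using Z_pos by (simp_all add: Suc_leI self_le_power power_increasing)
  let ?Q = "\<lambda>t s'. t \<le> 1000 * Z ^ 6 \<and>
    (rvar s' ''out'' = 0 \<or> (\<exists>a. rvar s' ''out'' = outcome (samples a))) \<and>
    (\<forall>a<M. outcome (samples a) \<le> rvar s' ''out'')"
  let ?mm = "NAssign ''mm'' (NPlus (NPlus (NVar ''z'') (NVar ''z'')) (NPlus (NVar ''z'') (NVar ''z'')))"
  have "run (Seq compute_ceiling (Seq (mul (NVar ''m'') (NVar ''m'')) (Seq ?mm (Seq prepare search))))
      (\<lambda>t. ?Q (1 + bcost (RLess (RVar ''eps'') (RNat (NConst 1))) + t)) s"
    unfolding run_Seq
  proof (rule run_mono[OF run_compute_ceiling[where Z = Z and k = k and \<epsilon> = \<epsilon>]])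
    fix t1 s1 assume 1: "t1 \<le> 30 * Z \<and> nvar s1 ''m'' = nat \<lceil>real k / \<epsilon>\<rceil>" "keeps compute_ceiling s s1"
    show "run (mul (NVar ''m'') (NVar ''m'')) (\<lambda>t2. run ?mm (\<lambda>t3. run prepare (\<lambda>t4. run search
       (\<lambda>t5. ?Q (1 + bcost (RLess (RVar ''eps'') (RNat (NConst 1))) + (t1 + (t2 + (t3 + (t4 + t5))))))))) s1"
    proof (rule run_mono[OF run_mul[where Z = Z and b = m]])
      fix t2 s2 assume 2: "t2 \<le> 30 * Z \<and> nvar s2 ''z'' = nval (NVar ''m'') s1 * m" "keeps (mul (NVar ''m'') (NVar ''m'')) s1 s2"
      let ?s2 = "s2\<lparr>nvar := (nvar s2)(''mm'' := mm)\<rparr>"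
      have "raw ?s2" using 1 2 s by (simp add: raw_def keeps_def)
      then have "run prepare (\<lambda>t4. run search (\<lambda>t5. ?Q (13 + (t1 + (t2 + (t4 + t5)))))) ?s2"
      proof (rule run_mono[OF run_prepare])
        fix t4 s4 assume 4: "t4 \<le> 170 * Z ^ 2 \<and> env s4"
        show "run search (\<lambda>t5. ?Q (13 + (t1 + (t2 + (t4 + t5))))) s4"
        proof (rule run_mono[OF run_search])
          fix t5 s5 assume 5: "t5 \<le> 500 * Z ^ 6 \<and>
            (rvar s5 ''out'' = 0 \<or> (\<exists>a. rvar s5 ''out'' = outcome (samples a))) \<and>
            (\<forall>a<M. outcome (samples a) \<le> rvar s5 ''out'')"
          have "13 + (t1 + (t2 + (t4 + t5))) \<le> 1000 * Z ^ 6"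
            using 1 2 4 5 Z6 by linarith
          then show "?Q (13 + (t1 + (t2 + (t4 + t5)))) s5" using 5 by blast
        qed (use 4 in simp)
      qed
      moreover have "nvar s2 ''z'' = m * m" using 1 2 m(1) by simp
      then have "nval (NPlus (NPlus (NVar ''z'') (NVar ''z'')) (NPlus (NVar ''z'') (NVar ''z''))) s2 = mm"
        using m(3) by simp
      moreover have "1 + bcost (RLess (RVar ''eps'') (RNat (NConst 1))) +
         (t1 + (t2 + (1 + ncost (NPlus (NPlus (NVar ''z'') (NVar ''z'')) (NPlus (NVar ''z'') (NVar ''z''))) + (t4 + t5))))
        = 13 + (t1 + (t2 + (t4 + t5)))" for t4 t5
        by simp
      ultimately show "run ?mm (\<lambda>t3. run prepare (\<lambda>t4. run search
         (\<lambda>t5. ?Q (1 + bcost (RLess (RVar ''eps'') (RNat (NConst 1))) + (t1 + (t2 + (t3 + (t4 + t5)))))))) s2"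
        unfolding run_NAssign by (simp only:)
    qed (use 1 m in simp_all)
  qed (use s \<epsilon> m in simp_all)
  moreover have "bval (RLess (RVar ''eps'') (RNat (NConst 1))) s" using s \<epsilon> by simp
  ultimately show ?thesis unfolding approximate_value_def run_If by simp
qed

end

section \<open>Running time\<close>

text \<open>With \<open>l\<close> the rounded logarithm, minimality gives
  \<open>(l - 1) * ln 2 \<le> ln b\<close>. The missing \<open>ln 2\<close> is itself at most
  \<open>ln b\<close>, and \<open>ln 2\<close> is at least 2/3, whence 2 / (2/3) = 3.\<close>

lemma ceiling_log_le_ln:
  assumes "2 \<le> b"
  shows "real (ceiling_log b) \<le> 3 * ln (real b)"
proof -
  have l0: "ceiling_log b \<noteq> 0" using ceiling_log_upper[of b] assms by (cases "ceiling_log b") auto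
  then have "2 ^ (ceiling_log b - 1) < b" by (intro ceiling_log_lower) simp
  then have "real (2 ^ (ceiling_log b - 1)) \<le> real b" by linarith
  then have "ln (2 ^ (ceiling_log b - 1)) \<le> ln (real b)" using assms by (subst ln_le_cancel_iff) auto
  then have 1: "(real (ceiling_log b) - 1) * ln 2 \<le> ln (real b)" using l0 by (simp add: ln_realpow of_nat_diff)
  have 2: "ln 2 \<le> ln (real b)" using assms by simp
  have "real (ceiling_log b) * (2 / 3) \<le> real (ceiling_log b) * ln 2"
    using ln2_ge_two_thirds by (intro mult_left_mono) auto
  also have "\<dots> \<le> 2 * ln (real b)" using 1 2 by (simp add: algebra_simps)
  finally show ?thesis by simp
qed

lemma ln_le_ceiling_log:
  assumes "0 < b"
  shows "ln (real b) \<le> real (ceiling_log b)"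
proof -
  have "real b \<le> 2 ^ ceiling_log b" using ceiling_log_upper[of b] by (metis of_nat_le_iff of_nat_numeral of_nat_power)
  then have "ln (real b) \<le> ln (2 ^ ceiling_log b)" using assms by (subst ln_le_cancel_iff) auto
  also have "\<dots> = real (ceiling_log b) * ln 2" by (simp add: ln_realpow)
  also have "\<dots> \<le> real (ceiling_log b) * 1" using ln_2_less_1 by (intro mult_left_mono) auto
  finally show ?thesis by simp
qed

section \<open>Sums over pairs of players\<close>

locale log_sizes =
  fixes k :: nat and L :: "nat \<Rightarrow> real"
  assumes k: "2 \<le> k" and L: "\<And>i. i < k \<Longrightarrow> 1 / 2 \<le> L i"
begin

definition S where "S = (\<Sum>j<k. \<Sum>i<j. L i * L j)"

lemma pair_le_S:
  assumes "i < j" "j < k"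
  shows "L i * L j \<le> S"
proof -
  have nn: "0 \<le> L i * L j" if "i < j" "j < k" for i j
    using L[of i] L[of j] that by (intro mult_nonneg_nonneg) auto
  have "L i * L j \<le> (\<Sum>i<j. L i * L j)"
    using nn assms by (intro member_le_sum) auto
  also have "\<dots> \<le> S"
    unfolding S_def using nn assms by (intro member_le_sum[where f = "\<lambda>j. \<Sum>i<j. L i * L j"]) (auto intro!: sum_nonneg)
  finally show ?thesis .
qed

text \<open>Every player has a partner, player 0 or, for player 0 itself, player 1, whose logarithm
  is at least 1/2. This is how terms with a single player are absorbed by the sum over pairs, which
  would be empty for one player.\<close>

lemma L_le_S: "j < k \<Longrightarrow> L j \<le> 2 * S"
proof -
  assume j: "j < k"
  have "\<exists>i<k. L i * L j \<le> S"
  proof (cases "j = 0")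
    case True
    then show ?thesis using pair_le_S[of 0 1] k by (auto simp: mult.commute intro!: exI[of _ 1])
  next
    case False
    then show ?thesis using pair_le_S[of 0 j] j by (intro exI[of _ 0]) auto
  qed
  then obtain i where i: "i < k" "L i * L j \<le> S" by auto
  have "1 / 2 * L j \<le> L i * L j" using L[of i] L[of j] i j by (intro mult_right_mono) auto
  then show ?thesis using i by simp
qed

lemma S_ge: "1 / 4 \<le> S"
  using L_le_S[of 0] L[of 0] k by simp

lemma sum_L_le_S: "(\<Sum>i<k. L i) \<le> k * (2 * S)"
  using sum_bounded_above[of "{..<k}" L "2 * S"] L_le_S by simp

lemma S_le_square: "S \<le> (\<Sum>i<k. L i)\<^sup>2"
proof -
  have "S \<le> (\<Sum>j<k. \<Sum>i<k. L i * L j)"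
    unfolding S_def
  proof (intro sum_mono sum_mono2)
    fix i j assume "j \<in> {..<k}" "i \<in> {..<k} - {..<j}"
    then show "0 \<le> L i * L j" using L[of i] L[of j] by (intro mult_nonneg_nonneg) auto
  qed auto
  also have "\<dots> = (\<Sum>i<k. L i)\<^sup>2"
    by (simp add: power2_eq_square sum_product mult.commute)
  finally show ?thesis .
qed

end

text \<open>The factor \<open>1000 * 201 ^ 6\<close> is below \<open>2 ^ 60\<close> and so below
  \<open>exp 60\<close>; the sixth power turns 48 into 288. The maximum with 1 absorbs the 60, and
  60 + 288 = 348.\<close>

lemma polynomial_time_bound:
  fixes X :: real
  assumes X: "0 \<le> X" and Z: "real Z \<le> 200 * exp (48 * X) + 1" and t: "t \<le> 1000 * Z ^ 6"
  shows "real t \<le> exp (348 * max 1 X)"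
proof -
  have E: "1 \<le> exp (48 * X)" using X by simp
  have "real t \<le> 1000 * real Z ^ 6" using t by (metis of_nat_le_iff of_nat_mult of_nat_numeral of_nat_power)
  also have "\<dots> \<le> 1000 * (201 * exp (48 * X)) ^ 6"
  proof (intro mult_left_mono power_mono)
    show "real Z \<le> 201 * exp (48 * X)" using Z E by linarith
  qed auto
  also have "\<dots> = 1000 * 201 ^ 6 * exp (288 * X)"
    by (simp add: power_mult_distrib flip: exp_of_nat_mult)
  also have "\<dots> \<le> 2 ^ 60 * exp (288 * X)"
    by (intro mult_right_mono) auto
  also have "\<dots> \<le> exp 1 ^ 60 * exp (288 * X)"
    using exp_ge_add_one_self[of 1] by (intro mult_right_mono power_mono) auto
  also have "\<dots> = exp (60 + 288 * X)"
    by (simp add: exp_add flip: exp_of_nat_mult)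
  also have "\<dots> \<le> exp (348 * max 1 X)" by simp
  finally show ?thesis .
qed

section \<open>Counting the advices and collecting the bounds\<close>

context numbered_game
begin

lemma radix_pos: "j \<le> players G \<Longrightarrow> 0 < radix j"
  using PY_pos PB_pos by (simp add: radix_def)

lemma ln_radix: "j \<le> players G \<Longrightarrow> ln (real (radix j)) = (\<Sum>i<j. ln (real (player_size G i)))"
proof -
  assume j: "j \<le> players G"
  have "real (radix j) = (\<Prod>i<j. real (player_size G i))"
    by (simp add: radix_def PY_def PB_def player_size_def prod.distrib)
  moreover have "player_size G i \<noteq> 0" if "i < j" for i
    using Y_pos[of i] B_pos[of i] that j by (simp add: player_size_def)
  ultimately show ?thesis by (simp, subst ln_prod) auto
qed

text \<open>Player \<open>j\<close> guesses \<open>\<kappa> j\<close> samples of the players below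
  it, which is where the pairs \<open>i < j\<close> arise. The second logarithm of each pair comes
  from bounding \<open>\<kappa> j\<close>.\<close>

lemma ln_M: "ln (real M) = (\<Sum>j<players G. real (\<kappa> j) * (\<Sum>i<j. ln (real (player_size G i))))"
proof -
  have "real M = (\<Prod>j<players G. real (radix j) ^ \<kappa> j)" by (simp add: M_def)
  then have "ln (real M) = (\<Sum>j<players G. ln (real (radix j) ^ \<kappa> j))"
    using radix_pos by (simp, subst ln_prod) auto
  also have "\<dots> = (\<Sum>j<players G. real (\<kappa> j) * (\<Sum>i<j. ln (real (player_size G i))))"
    using radix_pos by (intro sum.cong) (auto simp: ln_realpow ln_radix)
  finally show ?thesis .
qed

end

lemma approximate_correct:
  fixes G :: "('q, 'a) free_game"
  assumes game: "is_free_game G" "2 \<le> players G" "\<forall>i<players G. 2 \<le> card (answers G i)" and \<epsilon>: "0 < \<epsilon>"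
    and s: "is_input G \<epsilon> s"
  shows "\<exists>t s'. exec approximate_value s t s' \<and> \<bar>rvar s' ''out'' - game_value G\<bar> \<le> \<epsilon> \<and>
    real t \<le> exp (348 * max 1 ((real (players G))\<^sup>2 / \<epsilon>\<^sup>2 *
           (\<Sum>j<players G. \<Sum>i<j. ln (real (player_size G i)) * ln (real (player_size G j)))))"
proof -
  define k where "k = players G"
  define m where "m = nat \<lceil>real k / \<epsilon>\<rceil>"
  define mm where "mm = 4 * (m * m)"
  define \<kappa> where "\<kappa> j = mm * ceiling_log (card (answers G j))" for j
  define L where "L i = ln (real (player_size G i))" for i
  obtain \<eta> \<beta> where num: "\<forall>i<players G. bij_betw (\<eta> i) (questions G i) {..<card (questions G i)} \<and>
                       bij_betw (\<beta> i) (answers G i) {..<card (answers G i)}"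
    and V: "\<forall>y\<in>question_tuples G. \<forall>b\<in>answer_tuples G. rarr s ''V'' (table_index G \<eta> \<beta> y b) = verify G y b"
    using s by (auto simp: is_input_def)
  have inp: "nvar s ''k'' = k" "\<And>i. i < k \<Longrightarrow> narr s ''Y'' i = card (questions G i) \<and> narr s ''B'' i = card (answers G i)"
     "rvar s ''eps'' = \<epsilon>"
    using s by (auto simp: is_input_def k_def)
  interpret numbered_game G s \<eta> \<beta> \<kappa>
    using game(1) num V by unfold_locales auto
  have size2: "2 \<le> player_size G i" "card (answers G i) \<le> player_size G i" if "i < k" for i
  proof -
    have "1 * card (answers G i) \<le> card (questions G i) * card (answers G i)"
      using Y_pos[of i] that by (intro mult_right_mono) (auto simp: k_def)
    then show "card (answers G i) \<le> player_size G i" by (simp add: player_size_def)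
    then show "2 \<le> player_size G i" using game(3) that by (metis k_def le_trans)
  qed
  have L_ge: "1 / 2 \<le> L i" if "i < k" for i
  proof -
    have "ln 2 \<le> L i" unfolding L_def using size2(1)[OF that] by (subst ln_le_cancel_iff) auto
    then show ?thesis using ln2_ge_two_thirds by simp
  qed
  interpret log_sizes k L using game(2) L_ge by unfold_locales (auto simp: k_def)
  define c where "c = (real k)\<^sup>2 / \<epsilon>\<^sup>2"
  define X where "X = c * S"
  have X_eq: "X = (real (players G))\<^sup>2 / \<epsilon>\<^sup>2 *
           (\<Sum>j<players G. \<Sum>i<j. ln (real (player_size G i)) * ln (real (player_size G j)))"
    unfolding X_def c_def S_def by (simp add: L_def k_def)
  have c0: "0 \<le> c" and X0: "0 \<le> X" using S_ge by (simp_all add: c_def X_def)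
  have "run approximate_value (\<lambda>t s'. \<bar>rvar s' ''out'' - game_value G\<bar> \<le> \<epsilon> \<and> real t \<le> exp (348 * max 1 X)) s"
  proof (cases "\<epsilon> < 1")
    case False
    \<comment> \<open>The test takes 5 steps and the assignment 3.\<close>
    have "8 \<le> exp (348 * max 1 X)" using exp_ge_add_one_self[of "348 * max 1 X"] by linarith
    then show ?thesis
      using False inp game_value_01 by (auto simp: approximate_value_def run_If run_RAssign)
  next
    case True
    have "\<epsilon> * real k \<le> 1 * real k" using True by (intro mult_right_mono) auto
    then have ke: "real k \<le> real k / \<epsilon>" using \<epsilon> by (simp add: field_simps)
    have m_ge: "real k / \<epsilon> \<le> real m" unfolding m_def by linarith
    have k1: "1 \<le> real k" using k by simp
    have "0 \<le> real k / \<epsilon>" using \<epsilon> by simp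
    then have "real m \<le> real k / \<epsilon> + 1" unfolding m_def by linarith
    also have "\<dots> \<le> 2 * (real k / \<epsilon>)" using ke k1 by linarith
    finally have m_le: "real m \<le> 2 * (real k / \<epsilon>)" .
    have c_eq: "c = (real k / \<epsilon>)\<^sup>2" by (simp add: c_def power_divide)
    \<comment> \<open>\<open>mm\<close> is four times the square of \<open>m\<close>, and
      \<open>m\<close> is at most twice \<open>k / \<epsilon>\<close>.\<close>
    have mm_le: "real mm \<le> 16 * c"
    proof -
      have "(real m)\<^sup>2 \<le> (2 * (real k / \<epsilon>))\<^sup>2" using m_le by (intro power_mono) auto
      then show ?thesis unfolding c_eq power_mult_distrib mm_def power2_eq_square by simp
    qed
    have mm_ge: "4 * c \<le> real mm"
    proof -
      have "(real k / \<epsilon>)\<^sup>2 \<le> (real m)\<^sup>2" using m_ge \<epsilon> by (intro power_mono) auto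
      then show ?thesis unfolding c_eq mm_def power2_eq_square by simp
    qed
    have k_sq: "real k * real k \<le> c" 
      using ke unfolding c_eq power2_eq_square by (intro mult_mono) auto
    have "c * (1 / 4) \<le> X" unfolding X_def using S_ge c0 by (intro mult_left_mono) auto
    then have c_le: "c \<le> 4 * X" by simp
    have k_le_c: "2 * real k \<le> c"
    proof -
      have "2 * real k \<le> real k * real k" using k by (intro mult_right_mono) auto
      then show ?thesis using k_sq by simp
    qed
    \<comment> \<open>The sum over players is at most \<open>2 * k\<close> times \<open>S\<close>,
      and \<open>2 * k\<close> is at most \<open>c\<close>. Hence quantities polynomial in the input
      size are also bounded by an exponential in \<open>X\<close>.\<close>
    have sumL: "(\<Sum>i<k. L i) \<le> X"
    proof -
      have "real k * (2 * S) \<le> c * S" using k_le_c S_ge by (simp add: mult_right_mono flip: mult.assoc) 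
      then show ?thesis using sum_L_le_S unfolding X_def by simp
    qed
    \<comment> \<open>48 is 16 from \<open>mm\<close> times 3 from the rounded logarithm.\<close>
    have \<kappa>_le: "real (\<kappa> j) \<le> 48 * (c * L j)" if "j < k" for j
    proof -
      have "ln (real (card (answers G j))) \<le> L j"
        unfolding L_def using size2(2)[OF that] game(3) that B_pos[of j] by (subst ln_le_cancel_iff) (auto simp: k_def)
      moreover have "real (ceiling_log (card (answers G j))) \<le> 3 * ln (real (card (answers G j)))"
        using game(3) that by (intro ceiling_log_le_ln) (auto simp: k_def)
      ultimately have "real (ceiling_log (card (answers G j))) \<le> 3 * L j" by linarith
      then have "real mm * real (ceiling_log (card (answers G j))) \<le> (16 * c) * (3 * L j)"
        using mm_le c0 by (intro mult_mono) auto
      then show ?thesis by (simp add: \<kappa>_def mult.assoc)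
    qed
    have lnM: "ln (real M) \<le> 48 * X"
    proof -
      have "ln (real M) = (\<Sum>j<k. real (\<kappa> j) * (\<Sum>i<j. L i))"
        using ln_M by (simp add: k_def L_def)
      also have "\<dots> \<le> (\<Sum>j<k. 48 * (c * L j) * (\<Sum>i<j. L i))"
      proof (intro sum_mono mult_right_mono)
        fix j assume "j \<in> {..<k}"
        then show "real (\<kappa> j) \<le> 48 * (c * L j)" using \<kappa>_le by simp
        have "0 \<le> L i" if "i < j" for i using L[of i] that \<open>j \<in> {..<k}\<close> by simp
        then show "0 \<le> (\<Sum>i<j. L i)" by (intro sum_nonneg) auto
      qed
      also have "\<dots> = 48 * X"
        unfolding X_def S_def sum_distrib_left sum_distrib_right
        by (intro sum.cong refl) (simp add: mult_ac)
      finally show ?thesis .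
    qed
    define E where "E = exp (48 * X)"
    have M_pos: "0 < real M" using radix_pos by (auto simp: M_def intro!: prod_pos)
    have ME: "real M \<le> E" using lnM M_pos unfolding E_def by (metis exp_le_cancel_iff exp_ln)
    have "X \<le> 48 * X" using X0 by simp
    then have XE: "exp X \<le> E" "X \<le> E" "1 \<le> E"
      unfolding E_def using X0 exp_ge_add_one_self[of "48 * X"] by (auto, linarith)
    have NE: "real N * real (PB k) \<le> E"
    proof -
      have "ln (real (radix k)) \<le> X" using ln_radix[of k] sumL by (simp add: k_def L_def)
      then have "real (radix k) \<le> exp X"
        using radix_pos[of k] by (metis exp_le_cancel_iff exp_ln k_def le_refl of_nat_0_less_iff)
      then show ?thesis using XE by (simp add: radix_def N_def k_def)
    qed
    have N1: "1 \<le> real N" "1 \<le> real (PB k)" using N_pos PB_pos[of k] by (simp_all add: k_def)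
    have N: "real N \<le> E" using mult_left_mono[OF N1(2), of "real N"] NE by simp
    have PB: "real (PB k) \<le> E" using mult_right_mono[OF N1(1), of "real (PB k)"] NE by simp
    have mm_E: "real mm \<le> 64 * E" using mm_le c_le XE by linarith
    have "m \<le> mm" unfolding mm_def by (cases m) auto
    then have m_E: "real m \<le> 64 * E" using mm_E by linarith
    have k_E: "real k \<le> 4 * E" using k_le_c c_le XE k1 by linarith
    have \<kappa>_E: "real (\<kappa> j) \<le> 96 * E" if "j < k" for j
    proof -
      have "c * L j \<le> c * (2 * S)" using L_le_S[OF that] c0 by (intro mult_left_mono)
      then show ?thesis using \<kappa>_le[OF that] XE unfolding X_def by linarith
    qed
    \<comment> \<open>All loop bounds are at most \<open>96 * E\<close> or, for the search,
      \<open>E + 1\<close>; since \<open>E\<close> is at least 1, the factor 200 leaves room for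
      strict inequalities.\<close>
    define Z where "Z = nat \<lceil>200 * E\<rceil>"
    have Z_ge: "200 * E \<le> real Z" and Z_le: "real Z \<le> 200 * E + 1" unfolding Z_def using XE(3) by linarith+
    interpret prepared_game "players G" "\<lambda>i. card (questions G i)" "\<lambda>i. card (answers G i)" "rarr s ''V''" \<kappa> Z mm
    proof unfold_locales
      show "players G < Z" using k_E Z_ge XE(3) unfolding k_def by linarith
      show "N < Z" using N Z_ge XE(3) by linarith
      show "PB (players G) < Z" using PB Z_ge XE(3) unfolding k_def by linarith
      show "Suc M < Z" using ME Z_ge XE(3) by linarith
      show "\<kappa> j < Z" if "j < players G" for j using \<kappa>_E[of j] that Z_ge XE(3) unfolding k_def by linarith
      show "mm < Z" using mm_E Z_ge XE(3) by linarith
    qed (simp add: \<kappa>_def)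
    have mZ: "m < Z" using m_E Z_ge XE(3) by linarith
    have run: "run approximate_value (\<lambda>t s'. t \<le> 1000 * Z ^ 6 \<and>
      (rvar s' ''out'' = 0 \<or> (\<exists>a. rvar s' ''out'' = outcome (samples a))) \<and>
      (\<forall>a<M. outcome (samples a) \<le> rvar s' ''out'')) s"
      by (rule run_approximate[where m = m and \<epsilon> = \<epsilon>])
         (use inp \<epsilon> True mZ in \<open>auto simp: k_def m_def mm_def\<close>)
    show ?thesis
    proof (rule run_mono[OF run])
      fix t s' assume *: "t \<le> 1000 * Z ^ 6 \<and>
        (rvar s' ''out'' = 0 \<or> (\<exists>a. rvar s' ''out'' = outcome (samples a))) \<and>
        (\<forall>a<M. outcome (samples a) \<le> rvar s' ''out'')"
      have upper: "rvar s' ''out'' \<le> game_value G"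
        using * game_value_01 val_le_game_value strategy_strat by (auto simp: outcome_eq_val)
      obtain \<gamma> where \<gamma>: "strategy \<gamma>" "val \<gamma> = game_value G" using game_value_attained by auto
      \<comment> \<open>A loss of \<open>\<epsilon> / k\<close> for each of the \<open>k\<close>
        players adds up to \<epsilon>.\<close>
      have "\<exists>adv<M. val \<gamma> - players G * (\<epsilon> / k) \<le> outcome (samples adv)"
      proof (rule advice_suffices[OF \<gamma>(1)])
        show "0 < \<epsilon> / k" "\<epsilon> / k \<le> 1" using \<epsilon> True k1 by (simp_all add: field_simps)
        fix j assume j: "j < players G"
        have B: "2 \<le> card (answers G j)" using game(3) j by simp
        have "4 * ln (card (answers G j)) / (\<epsilon> / k)\<^sup>2 = (4 * c) * ln (card (answers G j))"
          by (simp add: c_def power_divide)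
        also have "\<dots> \<le> real mm * real (ceiling_log (card (answers G j)))"
          using mm_ge B by (intro mult_mono ln_le_ceiling_log) auto
        finally show "4 * ln (card (answers G j)) / (\<epsilon> / k)\<^sup>2 \<le> \<kappa> j" by (simp add: \<kappa>_def)
        \<comment> \<open>A second answer makes the logarithm positive, so at least one sample is
          drawn.\<close>
        have "0 < (4 * c) * ln (card (answers G j))" using k_le_c k1 B by (intro mult_pos_pos) auto
        also note \<open>\<dots> \<le> real mm * real (ceiling_log (card (answers G j)))\<close>
        finally show "0 < \<kappa> j" by (simp add: \<kappa>_def flip: of_nat_mult)
      qed
      then have "game_value G - \<epsilon> \<le> rvar s' ''out''"
        using * \<gamma>(2) k1 by (auto simp: k_def)
      with upper \<epsilon> show "\<bar>rvar s' ''out'' - game_value G\<bar> \<le> \<epsilon> \<and> real t \<le> exp (348 * max 1 X)"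
        using polynomial_time_bound[OF X0 Z_le[unfolded E_def]] * by auto
    qed
  qed
  then show ?thesis unfolding run_def X_eq by blast
qed

text \<open>The pairs \<open>i < j\<close> are among all pairs, so \<open>S\<close> is at most the
  square of the logarithm of the input size; one of the two factors becomes the base of the power.
  Two players with at least two answers each make this logarithm at least 4/3, so the maximum with 1
  survives the rewriting.\<close>

lemma input_size_bound:
  fixes G :: "('q, 'a) free_game"
  assumes G: "is_free_game G" "2 \<le> players G" "\<forall>i<players G. 2 \<le> card (answers G i)" and C: "0 \<le> C"
  shows "exp (C * max 1 ((real (players G))\<^sup>2 / \<epsilon>\<^sup>2 *
        (\<Sum>j<players G. \<Sum>i<j. ln (real (player_size G i)) * ln (real (player_size G j)))))
      \<le> real (input_size G) powr
          (C * max 1 ((real (players G))\<^sup>2 / \<epsilon>\<^sup>2 * ln (real (input_size G))))"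
proof -
  define k where "k = players G"
  define L where "L i = ln (real (player_size G i))" for i
  have size2: "2 \<le> player_size G i" if "i < k" for i
  proof -
    have "1 * 2 \<le> card (questions G i) * card (answers G i)"
      using G that by (intro mult_mono) (auto simp: k_def is_free_game_def Suc_le_eq card_gt_0_iff)
    then show ?thesis by (simp add: player_size_def)
  qed
  have L_ge: "2 / 3 \<le> L i" if "i < k" for i
  proof -
    have "ln 2 \<le> L i" unfolding L_def using size2[OF that] by (subst ln_le_cancel_iff) auto
    then show ?thesis using ln2_ge_two_thirds by simp
  qed
  have L_half: "1 / 2 \<le> L i" if "i < k" for i using L_ge[OF that] by simp
  interpret log_sizes k L using G(2) L_half by unfold_locales (auto simp: k_def)
  have pos: "0 < player_size G i" if "i < k" for i using size2[OF that] by simp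
  then have ln_n: "ln (real (input_size G)) = (\<Sum>i<k. L i)"
    unfolding input_size_def L_def k_def[symmetric] by (simp, subst ln_prod) auto
  have n: "0 < input_size G" using pos by (auto simp: input_size_def k_def intro!: prod_pos)
  have "real k * (2 / 3) \<le> (\<Sum>i<k. L i)" using sum_bounded_below[of "{..<k}" "2/3" L] L_ge by simp
  then have ln1: "1 \<le> (\<Sum>i<k. L i)" using k by simp
  define c where "c = (real k)\<^sup>2 / \<epsilon>\<^sup>2"
  have "c * S \<le> c * (\<Sum>i<k. L i)\<^sup>2" using S_le_square by (intro mult_left_mono) (auto simp: c_def)
  also have "\<dots> = (\<Sum>i<k. L i) * (c * (\<Sum>i<k. L i))" by (simp add: power2_eq_square)
  also have "\<dots> \<le> (\<Sum>i<k. L i) * max 1 (c * (\<Sum>i<k. L i))" using ln1 by (intro mult_left_mono) auto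
  finally have "c * S \<le> (\<Sum>i<k. L i) * max 1 (c * (\<Sum>i<k. L i))" .
  moreover have "1 * 1 \<le> (\<Sum>i<k. L i) * max 1 (c * (\<Sum>i<k. L i))" using ln1 by (intro mult_mono) auto
  ultimately have "max 1 (c * S) \<le> (\<Sum>i<k. L i) * max 1 (c * (\<Sum>i<k. L i))" by simp
  then have "C * max 1 (c * S) \<le> C * ((\<Sum>i<k. L i) * max 1 (c * (\<Sum>i<k. L i)))" using C by (intro mult_left_mono)
  then have "exp (C * max 1 (c * S)) \<le> real (input_size G) powr (C * max 1 (c * ln (real (input_size G))))"
    using n by (simp add: powr_def ln_n mult_ac)
  then show ?thesis unfolding c_def S_def by (simp add: L_def k_def)
qed

text \<open>The program and the constants are chosen before the game, so a single uniform algorithm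
  is claimed. The maximum with 1 is needed because the exponent tends to 0 as \<epsilon> grows,
  while every run takes some steps.\<close>

theorem theorem48:
  shows "\<exists>(P::com) (C::real) (D::real). \<forall>(G::('q, 'a) free_game) (\<epsilon>::real).
    is_free_game G \<and> 2 \<le> players G \<and> (\<forall>i<players G. 2 \<le> card (answers G i)) \<and> 0 < \<epsilon> \<longrightarrow>
    (\<forall>s. is_input G \<epsilon> s \<longrightarrow>
      (\<exists>t s'. exec P s t s' \<and>
         \<bar>rvar s' ''out'' - game_value G\<bar> \<le> \<epsilon> \<and>
         real t \<le> exp (C * max 1 ((real (players G))\<^sup>2 / \<epsilon>\<^sup>2 *
           (\<Sum>j<players G. \<Sum>i<j. ln (real (player_size G i)) * ln (real (player_size G j))))))) \<and>
    exp (C * max 1 ((real (players G))\<^sup>2 / \<epsilon>\<^sup>2 *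
        (\<Sum>j<players G. \<Sum>i<j. ln (real (player_size G i)) * ln (real (player_size G j)))))
      \<le> real (input_size G) powr
          (D * max 1 ((real (players G))\<^sup>2 / \<epsilon>\<^sup>2 * ln (real (input_size G))))"
proof (rule exI[of _ approximate_value], rule exI[of _ 348], rule exI[of _ 348], intro allI impI, elim conjE)
qed (intro conjI allI impI approximate_correct input_size_bound; simp)

end
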